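(* Fix $k\in\mathbb N$ and let $p_{\mathbb P_k}(n)$ be the number of partitions of $n$ with all parts in $\mathbb P_k=\{p^k: p\text{ prime}\}$. Let $\Psi(z)=\prod_{p\text{ prime}}(1-z^{p^k})^{-1}$ and $\Phi(z)=\sum_{j=1}^\infty\sum_{p\text{ prime}}\frac1j z^{jp^k}$ for $|z|<1$. Let $\rho=\rho(n)\in(0,1)$ be defined by $n=\rho\Phi'(\rho)$ and let $\Phi_{(2)}(\rho)=\left(\rho\frac{d}{d\rho}\right)^2\Phi(\rho)$. Then $$p_{\mathbb P_k}(n+1)-p_{\mathbb P_k}(n)\sim\frac{\rho^{-n}\log(\frac1\rho)\Psi(\rho)}{\sqrt{2\pi\Phi_{(2)}(\rho)}}\left(1+O\left(n^{-\frac1{2k+3}}\right)\right).$$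
   Context: The map $\rho\mapsto\rho\Phi'(\rho)$ is continuous and strictly increasing on $(0,1)$ tending to $\infty$ as $\rho\to1^-$, so $\rho(n)$ is well defined for large $n$. Implicit constants may depend on $k$. *)

theory Defs
  imports "HOL-Analysis.Analysis" "HOL-Library.Multiset" "HOL-Library.Landau_Symbols"
begin

definition primePows :: "nat \<Rightarrow> nat set" where
  "primePows k = {q. \<exists>p. prime p \<and> q = p ^ k}"

definition pP :: "nat \<Rightarrow> nat \<Rightarrow> nat" where
  "pP k n = card {M :: nat multiset. set_mset M \<subseteq> primePows k \<and> sum_mset M = n}"

definition Psi :: "nat \<Rightarrow> real \<Rightarrow> real" where
  "Psi k z = (\<Prod>m. if prime m then 1 / (1 - z ^ (m ^ k)) else 1)"

definition Phi :: "nat \<Rightarrow> real \<Rightarrow> real" where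
  "Phi k z = (\<Sum>j. \<Sum>p. if prime p then z ^ (Suc j * p ^ k) / real (Suc j) else 0)"

definition rho :: "nat \<Rightarrow> nat \<Rightarrow> real" where
  "rho k n = (THE r. r \<in> {0<..<1} \<and> r * deriv (Phi k) r = real n)"

definition Phi2 :: "nat \<Rightarrow> real \<Rightarrow> real" where
  "Phi2 k r = r * deriv (\<lambda>s. s * deriv (Phi k) s) r"

end

theory Submission
  imports Defs "HOL-Probability.Characteristic_Functions" "HOL-Real_Asymp.Real_Asymp"
begin

text \<open>
  Put \<open>\<rho> = exp (- s)\<close>. The coefficient \<open>pP k n\<close> is a contour integral of \<open>exp (\<Phi> z) / z ^ (n + 1)\<close>
  over \<open>\<bar>z\<bar> = \<rho>\<close>, and taking differences inserts the factor \<open>exp (s - i t) - 1\<close>, which is about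
  \<open>s = ln (1 / \<rho>)\<close> near \<open>t = 0\<close>. There a second order Taylor expansion of \<open>\<Phi>\<close> at the saddle point
  produces a Gaussian. The exponent \<open>1 / (2 k + 3)\<close> is smaller than the \<open>1 / (2 k + 2)\<close> that crude
  bounds give, so powers of logarithms are harmless and the only fact needed about the density of
  primes is that at least \<open>N powr (1 - \<eta>)\<close> of them are below \<open>N\<close>.

  Away from \<open>t = 0\<close> it suffices that the sum of \<open>1 - cos (p ^ k t)\<close> over primes \<open>p \<le> N\<close> exceeds some
  power of \<open>N\<close>. If it does not, \<open>p ^ k t / (2 pi)\<close> is nearly an integer for most primes; such a
  dense set contains a \<open>k\<close>-dimensional cube with small steps, and the \<open>k\<close>-th difference over this cube
  shows that \<open>t / (2 pi)\<close> is close to a rational number with a tiny denominator. These remaining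
  \<open>t\<close> are handled directly, using primes on a smaller scale.
\<close>

section \<open>Chebyshev's lower bound\<close>

text \<open>Where 1/(2k+2) comes from: the i-th moment (r d/dr)^i \<Phi> is about s^(-i-1/k) up to
  arbitrarily small powers of s, so n is about s^(-1-1/k) and the Gaussian has width about
  s^(1+1/(2k)). On an arc of half-width T barely above that, the cubic Taylor remainder is about
  s^(1/(2k)), and replacing e^(s-it) - 1 by s costs the relative error T/s of the same order,
  because the odd term -it is estimated in absolute value, without cancellation over t. Finally
  s^(1/(2k)) is about n^(-1/(2k+2)). Differencing shrinks the main term by the factor s, so the rest
  of the circle must be shown to be smaller than a power of s. A saving exp(-s^(-\<delta>)) with any
  \<delta> > 0 beats all powers, so some power lower bound for \<Phi>(\<rho>) - Re \<Phi>(z) is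
  enough. All coefficients of \<Phi> are nonnegative. Hence this difference is a series of
  nonnegative terms that may be cut down to m = p^k with s p^k <= 1, and Taylor remainders on the
  circle are bounded term by term.\<close>

lemma harmonic_triangle:
  assumes "1 \<le> m" "m \<le> n"
  shows "1 / (real (Suc m) * real (Suc n choose Suc m)) =
         1 / (real m * real (n choose m)) - 1 / (real m * real (Suc n choose m))"
proof -
  define x where "x = real (n choose m)"
  have x: "x > 0" using assms by (simp add: x_def)
  have 1: "real (Suc m) * real (Suc n choose Suc m) = real (Suc n) * x"
    using Suc_times_binomial[of m n] by (metis of_nat_mult x_def)
  have "(Suc n - m) * (Suc n choose m) = Suc n * (n choose m)"
    using binomial_absorb_comp[of "Suc n" m] by simp
  then have "real (Suc n - m) * real (Suc n choose m) = real (Suc n) * x"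
    by (metis of_nat_mult x_def)
  then have 2: "real (Suc n choose m) = real (Suc n) * x / (real (Suc n) - real m)"
    using assms by (simp add: field_simps of_nat_diff)
  have 3: "real m > 0" "real (Suc n) - real m > 0" "real (Suc n) > 0" using assms by auto
  have "1 / (N * x) = 1 / (M * x) - 1 / (M * (N * x / (N - M)))"
    if "M > 0" "N - M > 0" "N > 0" for M N :: real
    using that x by (simp add: divide_simps)
  from this[OF 3] show ?thesis unfolding 1 2 x_def[symmetric] .
qed

text \<open>Multiplied by \<open>d\<close>, the recurrence of Leibniz's harmonic triangle makes d /
  (m (n choose m)) a difference of two entries of column m - 1, which are integers by induction; in
  the first column the entries are d / n.\<close>

lemma times_binomial_dvd_common_multiple:
  assumes "1 \<le> m" "m \<le> n" "\<And>i. 1 \<le> i \<Longrightarrow> i \<le> n \<Longrightarrow> i dvd d"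
  shows "m * (n choose m) dvd d"
  using assms
proof (induction m arbitrary: n rule: nat_induct_at_least)
  case base
  then show ?case by simp
next
  case (Suc m)
  from Suc.prems(1) obtain n' where n: "n = Suc n'" by (cases n) auto
  have "m * (n' choose m) dvd d" "m * (n choose m) dvd d"
    using Suc.prems n by (auto intro!: Suc.IH)
  then obtain u v where u: "d = m * (n' choose m) * u" and v: "d = m * (n choose m) * v"
    unfolding dvd_def by blast
  have pos: "real m * real (n' choose m) > 0" "real m * real (n choose m) > 0"
            "real (Suc m) * real (n choose Suc m) > 0"
    using Suc.hyps Suc.prems n by (auto simp del: of_nat_Suc binomial_Suc_Suc)
  have cancel: "x * w * (1 / x) = w" if "x > 0" for x w :: real
    using that by simp
  have cancel2: "d = d * (1 / x) * x" if "x > 0" for x d :: real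
    using that by simp
  have "real d * (1 / (real (Suc m) * real (n choose Suc m))) = 
        real d * (1 / (real m * real (n' choose m))) - real d * (1 / (real m * real (n choose m)))"
    unfolding right_diff_distrib[symmetric] n
    by (subst harmonic_triangle) (use Suc.hyps Suc.prems n in simp_all)
  also have "real d * (1 / (real m * real (n' choose m))) = real u"
    unfolding u of_nat_mult by (rule cancel[OF pos(1)])
  also have "real d * (1 / (real m * real (n choose m))) = real v"
    unfolding v of_nat_mult by (rule cancel[OF pos(2)])
  finally have "real d = (real u - real v) * (real (Suc m) * real (n choose Suc m))"
    using cancel2[OF pos(3), of "real d"] by simp
  then have "real_of_int (int d) = real_of_int ((int u - int v) * (int (Suc m * (n choose Suc m))))"
    by (simp add: algebra_simps)
  then have "int d = (int u - int v) * (int (Suc m * (n choose Suc m)))"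
    using of_int_eq_iff by blast
  then have "int (Suc m * (n choose Suc m)) dvd int d" by (metis dvd_triv_right)
  then show ?case using int_dvd_int_iff by blast
qed

text \<open>The witness is lcm(1, ..., n): for each prime p <= n take the largest power of p not
  exceeding n. Each of these factors is at most n, and there is one per prime.\<close>

lemma common_multiple_le_power_prime_count:
  assumes "n \<ge> 1"
  obtains d :: nat where "d > 0" "\<And>i. 1 \<le> i \<Longrightarrow> i \<le> n \<Longrightarrow> i dvd d" "d \<le> n ^ card {p. prime p \<and> p \<le> n}"
proof -
  define S where "S = {p. prime p \<and> p \<le> n}"
  have finS: "finite S" by (auto simp: S_def)
  define e where "e p = (GREATEST j. p ^ j \<le> n)" for p
  have e: "p ^ j \<le> n \<Longrightarrow> j \<le> e p" "p ^ e p \<le> n" if "p \<in> S" for p j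
  proof -
    have p: "p \<ge> 2" using that prime_ge_2_nat by (auto simp: S_def)
    have bd: "j \<le> n" if "p ^ j \<le> n" for j
    proof -
      have "j < 2 ^ j" by simp
      also have "2 ^ j \<le> p ^ j" using p by (rule power_mono) simp
      finally show ?thesis using that by simp
    qed
    show "j \<le> e p" if "p ^ j \<le> n" unfolding e_def
      by (rule Greatest_le_nat[where b = n]) (use that bd in auto)
    show "p ^ e p \<le> n" unfolding e_def
      by (rule GreatestI_nat[of _ 0 n]) (use bd assms in auto)
  qed
  define d where "d = (\<Prod>p\<in>S. p ^ e p)"
  have d0: "d > 0" unfolding d_def by (auto intro!: prod_pos simp: S_def prime_gt_0_nat)
  have "i dvd d" if i: "1 \<le> i" "i \<le> n" for i
  proof (rule multiplicity_le_imp_dvd)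
    show "i \<noteq> 0" using i by simp
    fix p :: nat assume p: "prime p"
    have pd: "p ^ multiplicity p i dvd i" by (rule multiplicity_dvd)
    then have le: "p ^ multiplicity p i \<le> n" using i dvd_imp_le[OF pd] by simp
    show "multiplicity p i \<le> multiplicity p d"
    proof (cases "p \<in> S")
      case True
      have "multiplicity p d = e p" unfolding d_def
        using True finS by (subst multiplicity_prod_prime_powers) (auto simp: S_def)
      then show ?thesis using e(1)[OF True le] by simp
    next
      case False
      then have "\<not> p dvd i" using p i dvd_imp_le[of p i] by (auto simp: S_def)
      then show ?thesis by (simp add: not_dvd_imp_multiplicity_0)
    qed
  qed
  moreover have "d \<le> n ^ card S" unfolding d_def
    using prod_mono[of S "\<lambda>p. p ^ e p" "\<lambda>_. n"] e(2) by simp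
  ultimately show ?thesis using that d0 by (auto simp: S_def)
qed

text \<open>With m = n div 2, the number m (2m choose m) divides a common multiple of size at most
  n^c, where c is the number of primes. The extra factor m cancels the loss in (2m choose m) >= 4^m
  / (2m).\<close>

lemma prime_count_ln_ge:
  assumes "n \<ge> 2"
  shows "real (card {p. prime p \<and> p \<le> n}) * ln (real n) \<ge> (real n - 2) * ln 2"
proof -
  define c where "c = card {p. prime p \<and> p \<le> n}"
  define m where "m = n div 2"
  have m: "m \<ge> 1" "2 * m \<le> n" "n \<le> 2 * m + 1" using assms by (auto simp: m_def)
  obtain d :: nat where d: "d > 0" "\<And>i. 1 \<le> i \<Longrightarrow> i \<le> n \<Longrightarrow> i dvd d" "d \<le> n ^ c"
    using common_multiple_le_power_prime_count[of n] assms unfolding c_def by auto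
  have "m * ((2 * m) choose m) dvd d"
    by (rule times_binomial_dvd_common_multiple) (use m d in auto)
  then have "m * ((2 * m) choose m) \<le> n ^ c" using d(3) dvd_imp_le[OF _ d(1)] le_trans by blast
  then have "real (m * ((2 * m) choose m)) \<le> real (n ^ c)" by (simp only: of_nat_le_iff)
  then have A: "real m * real ((2 * m) choose m) \<le> real n ^ c" by (simp only: of_nat_mult of_nat_power)
  have "4 ^ m / (2 * real m) \<le> real ((2 * m) choose m)"
    using central_binomial_lower_bound[of m] m by simp
  then have "4 ^ m / 2 \<le> real m * real ((2 * m) choose m)"
    using m by (simp add: field_simps)
  with A have B: "(4::real) ^ m / 2 \<le> real n ^ c" by linarith
  have "(2::real) powr (real n - 2) \<le> 2 powr (2 * real m - 1)"
    using m by (intro powr_mono) auto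
  also have "\<dots> = 4 ^ m / 2"
    by (simp add: powr_diff powr_realpow[symmetric] powr_powr[symmetric])
  finally have "2 powr (real n - 2) \<le> real n ^ c" using B by linarith
  then have "ln (2 powr (real n - 2)) \<le> ln (real n ^ c)"
    using assms by (subst ln_le_cancel_iff) auto
  then show ?thesis using assms by (simp add: ln_powr ln_realpow c_def)
qed

text \<open>The logarithm is absorbed by n^\<eta>. This weak form is the input on primes for
  everything that follows.\<close>

lemma prime_count_ge_powr:
  assumes "\<eta> > 0"
  shows "eventually (\<lambda>n. real (card {p. prime p \<and> p \<le> n}) \<ge> real n powr (1 - \<eta>)) at_top"
proof -
  have "eventually (\<lambda>n. real n powr (1 - \<eta>) * ln (real n) \<le> (real n - 2) * ln 2) at_top"
    using assms by real_asymp
  with eventually_ge_at_top[of 2] show ?thesis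
  proof eventually_elim
    case (elim n)
    have "real n powr (1 - \<eta>) * ln (real n) \<le> real (card {p. prime p \<and> p \<le> n}) * ln (real n)"
      using elim prime_count_ln_ge[of n] by linarith
    then show ?case using elim by (subst (asm) mult_le_cancel_right_pos) auto
  qed
qed

section \<open>Exponential sums over prime powers\<close>

text \<open>Pigeonhole on differences: elements of \<open>S\<close> with no further element of
  \<open>S\<close> within distance \<open>D\<close> above them are more than \<open>D\<close> apart,
  so there are at most \<open>N div D + 1\<close> of them. All others lie in one of the
  \<open>D\<close> sets on the right, and the largest of these is at least of average size.\<close>

lemma popular_gap:
  fixes S :: "nat set"
  assumes "S \<subseteq> {..N}" "D > 0"
  shows "\<exists>h\<in>{1..D}. card S \<le> N div D + 1 + D * card {x\<in>S. x + h \<in> S}"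
proof (rule ccontr)
  assume neg: "\<not> ?thesis"
  have finS: "finite S" using assms finite_subset by blast
  define S0 where "S0 = {x\<in>S. \<forall>h\<in>{1..D}. x + h \<notin> S}"
  have inj: "inj_on (\<lambda>x. x div D) S0"
  proof (rule linorder_inj_onI)
    fix x y assume xy: "x < y" "x \<in> S0" "y \<in> S0"
    have "x + D < y"
    proof (rule ccontr)
      assume "\<not> x + D < y"
      then have "y - x \<in> {1..D}" "x + (y - x) = y" using xy by auto
      moreover have "x + (y - x) \<notin> S" using xy(2) calculation(1) unfolding S0_def by blast
      ultimately show False using xy(3) unfolding S0_def by simp
    qed
    then have "(x + D) div D \<le> y div D" by (intro div_le_mono) simp
    then show "x div D \<noteq> y div D" using assms by simp
  qed auto
  have "(\<lambda>x. x div D) ` S0 \<subseteq> {..N div D}" using assms by (auto simp: S0_def intro!: div_le_mono)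
  then have c0: "card S0 \<le> N div D + 1"
    using card_inj_on_le[OF inj, of "{..N div D}"] by simp
  have "S \<subseteq> S0 \<union> (\<Union>h\<in>{1..D}. {x\<in>S. x + h \<in> S})" by (auto simp: S0_def)
  then have "card S \<le> card (S0 \<union> (\<Union>h\<in>{1..D}. {x\<in>S. x + h \<in> S}))"
    using finS by (intro card_mono) (auto simp: S0_def)
  also have "\<dots> \<le> card S0 + (\<Sum>h\<in>{1..D}. card {x\<in>S. x + h \<in> S})"
    by (rule order.trans[OF card_Un_le]) (simp add: card_UN_le)
  finally have le: "card S \<le> N div D + 1 + (\<Sum>h\<in>{1..D}. card {x\<in>S. x + h \<in> S})" using c0 by simp
  have "D * (\<Sum>h\<in>{1..D}. card {x\<in>S. x + h \<in> S}) = (\<Sum>h\<in>{1..D}. D * card {x\<in>S. x + h \<in> S})"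
    by (simp add: sum_distrib_left)
  also have "\<dots> < (\<Sum>h\<in>{1..D}. card S - (N div D + 1))"
  proof (rule sum_strict_mono)
    fix h assume "h \<in> {1..D}"
    then have "\<not> card S \<le> N div D + 1 + D * card {x\<in>S. x + h \<in> S}" using neg by blast
    then show "D * card {x\<in>S. x + h \<in> S} < card S - (N div D + 1)" by linarith
  qed (use assms in auto)
  also have "\<dots> = D * (card S - (N div D + 1))" by simp
  finally show False using le assms by simp
qed

text \<open>\<open>poly_phase d b f\<close> says that every \<open>d\<close>-fold difference of \<open>f\<close> with steps \<open>h\<^sub>1, \<dots>, h\<^sub>d\<close> is the
  constant \<open>d! b h\<^sub>1 \<dots> h\<^sub>d\<close>, so \<open>b\<close> plays the role of the leading coefficient.\<close>

fun poly_phase :: "nat \<Rightarrow> real \<Rightarrow> (nat \<Rightarrow> real) \<Rightarrow> bool" where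
  "poly_phase 0 b f = (\<forall>x. f x = b)"
| "poly_phase (Suc d) b f = (\<forall>h. poly_phase d (b * real (Suc d) * real h) (\<lambda>x. f (x + h) - f x))"

lemma poly_phase_add:
  "poly_phase d b f \<Longrightarrow> poly_phase d c g \<Longrightarrow> poly_phase d (b + c) (\<lambda>x. f x + g x)"
proof (induction d arbitrary: b c f g)
  case (Suc d)
  show ?case unfolding poly_phase.simps
  proof
    fix h
    have "poly_phase d (b * real (Suc d) * real h + c * real (Suc d) * real h)
            (\<lambda>x. (f (x + h) - f x) + (g (x + h) - g x))"
      using Suc.prems by (intro Suc.IH) simp_all
    then show "poly_phase d ((b + c) * real (Suc d) * real h) (\<lambda>x. f (x + h) + g (x + h) - (f x + g x))"
      by (simp add: algebra_simps)
  qed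
qed simp

lemma poly_phase_sum_zero:
  assumes "\<And>i. i \<in> I \<Longrightarrow> poly_phase d 0 (f i)"
  shows "poly_phase d 0 (\<lambda>x. \<Sum>i\<in>I. f i x)"
proof -
  have z: "poly_phase d 0 (\<lambda>x. 0)" for d by (induction d) auto
  show ?thesis using assms
  proof (induction I rule: infinite_finite_induct)
    case (insert i I)
    then show ?case using poly_phase_add[of d 0 "f i" 0 "\<lambda>x. \<Sum>i\<in>I. f i x"] by simp
  qed (use z in auto)
qed

lemma power_diff_binomial:
  "(x + h) ^ n - x ^ n = (\<Sum>l<n. real (n choose l) * h ^ (n - l) * x ^ l)" for x h :: real
proof -
  have "(x + h) ^ n = (\<Sum>l\<le>n. real (n choose l) * x ^ l * h ^ (n - l))" by (rule binomial_ring)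
  also have "\<dots> = (\<Sum>l<n. real (n choose l) * x ^ l * h ^ (n - l)) + x ^ n"
    by (simp add: lessThan_Suc_atMost[symmetric])
  finally show ?thesis by (simp add: mult_ac)
qed

text \<open>Both claims go through one induction: a difference of c x^(d+1) has leading term c (d+1)
  h x^d, handled by the first claim in degree d, plus lower powers, which the second claim in degree
  d annihilates.\<close>

lemma poly_phase_monomial:
  "poly_phase d c (\<lambda>x. c * real x ^ d)" "i < d \<Longrightarrow> poly_phase d 0 (\<lambda>x. c * real x ^ i)"
proof (induction d arbitrary: c i)
  case 0
  { case 1 then show ?case by simp next case 2 then show ?case by simp }
next
  case (Suc d)
  have diff: "c * real (x + h) ^ n - c * real x ^ n =
              (\<Sum>l<n. (c * real (n choose l) * real h ^ (n - l)) * real x ^ l)" for x h n and c :: real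
    using power_diff_binomial[of "real x" "real h" n]
    by (simp add: right_diff_distrib[symmetric] sum_distrib_left mult_ac)
  {
    case 1
    show ?case unfolding poly_phase.simps diff sum.lessThan_Suc
    proof
      fix h
      have A: "poly_phase d 0 (\<lambda>x. \<Sum>l<d. (c * real (Suc d choose l) * real h ^ (Suc d - l)) * real x ^ l)"
        by (rule poly_phase_sum_zero) (use Suc.IH(2) in auto)
      have B: "poly_phase d (c * real (Suc d choose d) * real h ^ (Suc d - d))
           (\<lambda>x. (c * real (Suc d choose d) * real h ^ (Suc d - d)) * real x ^ d)"
        by (rule Suc.IH(1))
      have "c * real (Suc d choose d) * real h ^ (Suc d - d) = c * real (Suc d) * real h"
        by (simp add: Suc_diff_le)
      with poly_phase_add[OF A B]
      show "poly_phase d (c * real (Suc d) * real h) (\<lambda>x. 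
         (\<Sum>l<d. (c * real (Suc d choose l) * real h ^ (Suc d - l)) * real x ^ l) +
         (c * real (Suc d choose d) * real h ^ (Suc d - d)) * real x ^ d)"
        by simp
    qed
  next
    case 2
    show ?case unfolding poly_phase.simps diff
    proof
      fix h
      have "poly_phase d 0 (\<lambda>x. \<Sum>l<i. (c * real (i choose l) * real h ^ (i - l)) * real x ^ l)"
        by (rule poly_phase_sum_zero) (use Suc.IH(2) 2 in auto)
      then show "poly_phase d (0 * real (Suc d) * real h) (\<lambda>x. \<Sum>l<i. (c * real (i choose l) * real h ^ (i - l)) * real x ^ l)"
        by simp
    qed
  }
qed

definition near_int :: "real \<Rightarrow> real \<Rightarrow> bool" where
  "near_int \<epsilon> x \<longleftrightarrow> (\<exists>a::int. \<bar>x - of_int a\<bar> \<le> \<epsilon>)"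

lemma near_int_diff: "near_int \<epsilon> x \<Longrightarrow> near_int \<epsilon> y \<Longrightarrow> near_int (2 * \<epsilon>) (x - y)"
  unfolding near_int_def
proof (elim exE)
  fix a b :: int assume "\<bar>x - of_int a\<bar> \<le> \<epsilon>" "\<bar>y - of_int b\<bar> \<le> \<epsilon>"
  then have "\<bar>(x - y) - of_int (a - b)\<bar> \<le> 2 * \<epsilon>" by simp
  then show "\<exists>a::int. \<bar>(x - y) - of_int a\<bar> \<le> 2 * \<epsilon>" by blast
qed

text \<open>A substitute for Weyl's inequality that tolerates sets as thin as the primes: \<open>S\<close> contains a
  \<open>d\<close>-dimensional cube with steps at most a small power of \<open>N\<close>, and the alternating sum of
  \<open>f\<close> over that cube is \<open>b\<close> times an integer \<open>q\<close>.\<close>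

lemma dense_near_int_imp_rational:
  assumes "\<eta> > 0" "4 ^ d * \<eta> \<le> 1" "\<eta> < 1"
  shows "eventually (\<lambda>N. \<forall>S f b \<epsilon>. S \<subseteq> {..N} \<longrightarrow> real (card S) \<ge> real N powr (1 - \<eta>) \<longrightarrow>
           poly_phase d b f \<longrightarrow> (\<forall>x\<in>S. near_int \<epsilon> (f x)) \<longrightarrow>
           (\<exists>q::nat. q \<ge> 1 \<and> real q \<le> real N powr ((4 ^ d - 1) * \<eta>) \<and> near_int (2 ^ d * \<epsilon>) (b * real q))) at_top"
  using assms
proof (induction d arbitrary: \<eta>)
  case 0
  show ?case using eventually_gt_at_top[of 0]
  proof eventually_elim
    case (elim N)
    show ?case
    proof (intro allI impI)
      fix S :: "nat set" and f :: "nat \<Rightarrow> real" and b \<epsilon> :: real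
      assume *: "S \<subseteq> {..N}" "real N powr (1 - \<eta>) \<le> real (card S)" "poly_phase 0 b f" "\<forall>x\<in>S. near_int \<epsilon> (f x)"
      have "card S > 0" using *(2) elim by (metis powr_gt_zero of_nat_0_less_iff of_nat_0 less_le_trans less_irrefl)
      then obtain x where "x \<in> S" by (metis card.empty equals0I less_irrefl)
      then have "near_int \<epsilon> b" using * by auto
      then show "\<exists>q::nat. q \<ge> 1 \<and> real q \<le> real N powr ((4 ^ 0 - 1) * \<eta>) \<and> near_int (2 ^ 0 * \<epsilon>) (b * real q)"
        using elim by (intro exI[of _ 1]) auto
    qed
  qed
next
  case (Suc d)
  have \<eta>: "\<eta> > 0" "\<eta> \<le> 1 / 4"
  proof -
    have "4 * \<eta> \<le> 4 ^ Suc d * \<eta>" using Suc.prems(1) by (intro mult_right_mono) auto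
    then show "\<eta> \<le> 1 / 4" using Suc.prems(2) by linarith
  qed (use Suc.prems in auto)
  have IH: "eventually (\<lambda>N. \<forall>S f b \<epsilon>. S \<subseteq> {..N} \<longrightarrow> real (card S) \<ge> real N powr (1 - 4 * \<eta>) \<longrightarrow>
           poly_phase d b f \<longrightarrow> (\<forall>x\<in>S. near_int \<epsilon> (f x)) \<longrightarrow>
           (\<exists>q::nat. q \<ge> 1 \<and> real q \<le> real N powr ((4 ^ d - 1) * (4 * \<eta>)) \<and> near_int (2 ^ d * \<epsilon>) (b * real q))) at_top"
    if "4 * \<eta> < 1"
    using Suc.prems \<eta> that by (intro Suc.IH) auto
  \<comment> \<open>The induction hypothesis asks for 4\<eta> < 1, which can fail only for d = 0 and
    \<eta> = 1/4. In that case a single point of \<open>S\<close> gives the claim with q = 1, hence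
    the added premise that \<open>S\<close> is nonempty.\<close>
  have IH': "eventually (\<lambda>N. \<forall>S f b \<epsilon>. S \<subseteq> {..N} \<longrightarrow> real (card S) \<ge> real N powr (1 - 4 * \<eta>) \<longrightarrow> card S > 0 \<longrightarrow>
           poly_phase d b f \<longrightarrow> (\<forall>x\<in>S. near_int \<epsilon> (f x)) \<longrightarrow>
           (\<exists>q::nat. q \<ge> 1 \<and> real q \<le> real N powr ((4 ^ d - 1) * (4 * \<eta>)) \<and> near_int (2 ^ d * \<epsilon>) (b * real q))) at_top"
  proof (cases "4 * \<eta> < 1")
    case True
    show ?thesis using IH[OF True] by eventually_elim blast
  next
    case False
    then have "\<eta> = 1 / 4" using \<eta> by linarith
    then have "(4::real) ^ Suc d * (1 / 4) \<le> 1" using Suc.prems(2) by (simp only:)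
    then have "(4::real) ^ d \<le> 1" by simp
    then have "d = 0" using one_less_power[of "4::real" d] by (cases d) auto
    show ?thesis using eventually_gt_at_top[of 0]
    proof eventually_elim
      case (elim N)
      show ?case
      proof (intro allI impI)
        fix S :: "nat set" and f :: "nat \<Rightarrow> real" and b \<epsilon> :: real
        assume *: "card S > 0" "poly_phase d b f" "\<forall>x\<in>S. near_int \<epsilon> (f x)"
        then obtain x where "x \<in> S" by (metis card.empty equals0I less_irrefl)
        then have "near_int \<epsilon> b" using * \<open>d = 0\<close> by auto
        then show "\<exists>q::nat. q \<ge> 1 \<and> real q \<le> real N powr ((4 ^ d - 1) * (4 * \<eta>)) \<and> near_int (2 ^ d * \<epsilon>) (b * real q)"
          using elim \<open>d = 0\<close> by (intro exI[of _ 1]) auto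
      qed
    qed
  qed
  \<comment> \<open>Steps of size up to D, about N^(2\<eta>), make N/D negligible against
    N^(1-\<eta>). Dividing the rest by D leaves a set of size at least N^(1-4\<eta>): each level
    multiplies \<eta> by 4.\<close>
  have e1: "eventually (\<lambda>N::nat. 2 * real N powr (2 * \<eta>) * real N powr (1 - 4 * \<eta>) \<le>
              real N powr (1 - \<eta>) - real N powr (1 - 2 * \<eta>) - 1) at_top"
    using \<eta> by real_asymp
  have e2: "eventually (\<lambda>N::nat. real (Suc d) * (2 * real N powr (2 * \<eta>)) \<le> real N powr (3 * \<eta>)) at_top"
    using \<eta> by real_asymp
  show ?case using IH' e1 e2 eventually_gt_at_top[of 0]
  proof eventually_elim
    case (elim N)
    note IHN = elim(1)[rule_format]
    show ?case
    proof (intro allI impI)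
      fix S :: "nat set" and f :: "nat \<Rightarrow> real" and b \<epsilon> :: real
      assume *: "S \<subseteq> {..N}" "real N powr (1 - \<eta>) \<le> real (card S)" "poly_phase (Suc d) b f" "\<forall>x\<in>S. near_int \<epsilon> (f x)"
      define D where "D = nat \<lceil>real N powr (2 * \<eta>)\<rceil>"
      have N1: "real N powr (2 * \<eta>) \<ge> 1" using elim \<eta> by (intro ge_one_powr_ge_zero) auto
      have D: "real D \<ge> real N powr (2 * \<eta>)" "real D \<le> 2 * real N powr (2 * \<eta>)" "D > 0"
        using N1 unfolding D_def by linarith+
      obtain h where h: "h \<in> {1..D}" "card S \<le> N div D + 1 + D * card {x\<in>S. x + h \<in> S}"
        using popular_gap[OF *(1) D(3)] by blast
      define S' where "S' = {x\<in>S. x + h \<in> S}"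
      have "real (card S) \<le> real (N div D + 1 + D * card S')"
        using h unfolding S'_def by (simp only: of_nat_le_iff)
      also have "\<dots> = real (N div D) + 1 + real D * real (card S')" by simp
      also have "real (N div D) \<le> real N / real D" by (rule of_nat_div_le_of_nat)
      also have "\<dots> \<le> real N / real N powr (2 * \<eta>)" using D N1 by (intro divide_left_mono mult_pos_pos) linarith+
      also have "\<dots> = real N powr (1 - 2 * \<eta>)" using elim by (simp add: powr_diff)
      also have "real D * real (card S') \<le> 2 * real N powr (2 * \<eta>) * real (card S')"
        using D by (intro mult_right_mono) auto
      finally have "2 * real N powr (2 * \<eta>) * real N powr (1 - 4 * \<eta>) \<le> 2 * real N powr (2 * \<eta>) * real (card S')"
        using elim(2) *(2) by linarith
      then have c: "real N powr (1 - 4 * \<eta>) \<le> real (card S')" 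
        by (subst (asm) mult_le_cancel_left_pos) (use N1 in linarith)
      have c0: "card S' > 0" using c elim by (metis powr_gt_zero of_nat_0_less_iff of_nat_0 less_le_trans less_irrefl)
      have "\<exists>q::nat. q \<ge> 1 \<and> real q \<le> real N powr ((4 ^ d - 1) * (4 * \<eta>)) \<and>
              near_int (2 ^ d * (2 * \<epsilon>)) ((b * real (Suc d) * real h) * real q)"
      proof (rule IHN)
        show "S' \<subseteq> {..N}" using * by (auto simp: S'_def)
        show "poly_phase d (b * real (Suc d) * real h) (\<lambda>x. f (x + h) - f x)" using *(3) by simp
        show "near_int (2 * \<epsilon>) (f (x + h) - f x)" if "x \<in> S'" for x
          using that * by (intro near_int_diff) (auto simp: S'_def)
      qed (use c c0 in auto)
      then obtain q where q: "q \<ge> 1" "real q \<le> real N powr ((4 ^ d - 1) * (4 * \<eta>))"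
        "near_int (2 ^ d * (2 * \<epsilon>)) ((b * real (Suc d) * real h) * real q)" by blast
      show "\<exists>q::nat. q \<ge> 1 \<and> real q \<le> real N powr ((4 ^ Suc d - 1) * \<eta>) \<and> near_int (2 ^ Suc d * \<epsilon>) (b * real q)"
      \<comment> \<open>Differencing multiplied the leading coefficient by (d+1) h, so this factor
        joins the denominator. It costs N^(3\<eta>), and 3 + 4 (4^d - 1) = 4^(d+1) - 1.\<close>
      proof (intro exI[of _ "Suc d * h * q"] conjI)
        show "1 \<le> Suc d * h * q" using q h by simp
        have "real (Suc d * h * q) = real (Suc d) * real h * real q" by (simp only: of_nat_mult)
        also have "\<dots> \<le> real (Suc d) * (2 * real N powr (2 * \<eta>)) * real N powr ((4 ^ d - 1) * (4 * \<eta>))"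
          using h D q by (intro mult_mono) auto
        also have "\<dots> \<le> real N powr (3 * \<eta>) * real N powr ((4 ^ d - 1) * (4 * \<eta>))"
          using elim(3) by (intro mult_right_mono) auto
        also have "\<dots> = real N powr ((4 ^ Suc d - 1) * \<eta>)"
          by (simp add: powr_add[symmetric] algebra_simps)
        finally show "real (Suc d * h * q) \<le> real N powr ((4 ^ Suc d - 1) * \<eta>)" .
        show "near_int (2 ^ Suc d * \<epsilon>) (b * real (Suc d * h * q))" 
          using q(3) unfolding of_nat_mult power_Suc by (simp only: mult_ac)
      qed
    qed
  qed
qed

section \<open>Lower bounds for cosine sums over prime powers\<close>

abbreviation primes_le :: "nat \<Rightarrow> nat set" where
  "primes_le N \<equiv> {p. prime p \<and> p \<le> N}"

lemma one_minus_cos_ge_square: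
  assumes "\<bar>y\<bar> \<le> 1"
  shows "y\<^sup>2 / 4 \<le> 1 - cos (y::real)"
proof -
  have eq: "(\<Sum>k\<le>3. (\<i> * complex_of_real y)^k / fact k) = 1 + \<i> * y - y^2 / 2 - \<i> * y^3 / 6"
    by (simp add: numeral_eq_Suc power_mult_distrib fact_reduce field_simps)
  have 1: "\<bar>Re (iexp y - (\<Sum>k\<le>3. (\<i> * y)^k / fact k))\<bar> \<le> \<bar>y\<bar> ^ Suc 3 / fact (Suc 3)"
    by (rule order.trans[OF abs_Re_le_cmod iexp_approx1])
  have 2: "Re (iexp y - (\<Sum>k\<le>3. (\<i> * y)^k / fact k)) = cos y - 1 + y\<^sup>2 / 2"
    unfolding eq by (simp add: Re_exp Re_power_real flip: of_real_power)
  have "\<bar>cos y - 1 + y\<^sup>2 / 2\<bar> \<le> \<bar>y\<bar> ^ 4 / 24"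
    using 1 unfolding 2 by (simp add: fact_numeral)
  then have "1 - cos y \<ge> y\<^sup>2 / 2 - \<bar>y\<bar> ^ 4 / 24" by linarith
  moreover have "\<bar>y\<bar> ^ 4 \<le> y\<^sup>2"
  proof -
    have "\<bar>y\<bar> ^ 4 = y\<^sup>2 * y\<^sup>2" by (simp add: power_numeral_reduce power2_eq_square)
    also have "\<dots> \<le> y\<^sup>2 * 1" using assms by (intro mult_left_mono) (auto simp: abs_square_le_1)
    finally show ?thesis by simp
  qed
  moreover have "y\<^sup>2 \<ge> 0" by simp
  ultimately show ?thesis by linarith
qed

text \<open>Subtracting the nearest integer leaves u with \<epsilon> < |u| <= 1/2, where the cosine
  of 2 pi |u| is decreasing. The bound \<epsilon> <= 1/8 keeps 2 pi \<epsilon> below 1, the range of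
  the quadratic estimate.\<close>

lemma one_minus_cos_ge_of_not_near_int:
  assumes "\<not> near_int \<epsilon> x" "0 < \<epsilon>" "\<epsilon> \<le> 1 / 8"
  shows "\<epsilon>\<^sup>2 \<le> 1 - cos (2 * pi * x)"
proof -
  define u where "u = x - of_int (round x)"
  have u: "\<bar>u\<bar> \<le> 1 / 2" unfolding u_def using of_int_round_abs_le[of x] by (simp add: abs_minus_commute)
  have ue: "\<bar>u\<bar> > \<epsilon>" using assms(1) unfolding near_int_def u_def not_ex not_le by blast
  have "cos (2 * pi * x) = cos (2 * pi * u + 2 * pi * of_int (round x))"
    unfolding u_def by (simp add: algebra_simps)
  also have "\<dots> = cos (2 * pi * u)" unfolding cos_add sin_int_2pin cos_int_2pin by simp
  also have "\<dots> = cos (2 * pi * \<bar>u\<bar>)"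
    by (cases "u \<ge> 0") simp_all
  also have "\<dots> \<le> cos (2 * pi * \<epsilon>)"
    using u ue assms(2) by (intro cos_monotone_0_pi_le) auto
  finally have 1: "cos (2 * pi * x) \<le> cos (2 * pi * \<epsilon>)" .
  have "2 * pi * \<epsilon> \<le> 2 * 4 * (1 / 8)"
    using assms pi_less_4 by (intro mult_mono) auto
  then have "(2 * pi * \<epsilon>)\<^sup>2 / 4 \<le> 1 - cos (2 * pi * \<epsilon>)"
    using assms by (intro one_minus_cos_ge_square) auto
  moreover have "\<epsilon>\<^sup>2 \<le> (2 * pi * \<epsilon>)\<^sup>2 / 4"
  proof -
    have "1 * \<epsilon>\<^sup>2 \<le> pi\<^sup>2 * \<epsilon>\<^sup>2" using pi_gt3 by (intro mult_right_mono) auto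
    then show ?thesis by (simp add: power_mult_distrib)
  qed
  ultimately show ?thesis using 1 by linarith
qed

lemma sum_prime_powers_ge:
  assumes "\<eta> > 0"
  shows "eventually (\<lambda>M. (\<Sum>p\<in>primes_le M. real p ^ m) \<ge> real M powr ((real m + 1) * (1 - \<eta>))) at_top"
proof -
  define c where "c = (1/2::real) ^ (m + 1)"
  have "c > 0" by (simp add: c_def)
  then have "eventually (\<lambda>M::nat. real M powr ((real m + 1) * (1 - \<eta>)) \<le> c * real M powr ((real m + 1) * (1 - \<eta> / 2))) at_top"
    using assms by real_asymp
  moreover have "eventually (\<lambda>M. real (card (primes_le M)) \<ge> real M powr (1 - \<eta> / 2)) at_top"
    using prime_count_ge_powr[of "\<eta> / 2"] assms by simp
  ultimately show ?thesis using eventually_gt_at_top[of 0]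
  proof eventually_elim
    case (elim M)
    \<comment> \<open>Half of the guaranteed number of primes. At most y integers are <= y, so at
      least y of the primes exceed y, and they alone contribute y * y^m.\<close>
    define y where "y = real M powr (1 - \<eta> / 2) / 2"
    define Q where "Q = {p \<in> primes_le M. real p > y}"
    have y: "y > 0" using elim by (simp add: y_def)
    have "primes_le M \<subseteq> Q \<union> {1..nat \<lfloor>y\<rfloor>}"
    proof
      fix p assume p: "p \<in> primes_le M"
      show "p \<in> Q \<union> {1..nat \<lfloor>y\<rfloor>}"
      proof (cases "real p > y")
        case True
        then show ?thesis using p by (simp add: Q_def)
      next
        case False
        then have "p \<le> nat \<lfloor>y\<rfloor>" by (intro le_nat_floor) simp
        moreover have "p \<ge> 1" using p prime_gt_0_nat[of p] by simp
        ultimately show ?thesis by simp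
      qed
    qed
    then have "card (primes_le M) \<le> card (Q \<union> {1..nat \<lfloor>y\<rfloor>})"
      by (intro card_mono) (auto simp: Q_def)
    also have "\<dots> \<le> card Q + card {1..nat \<lfloor>y\<rfloor>}" by (rule card_Un_le)
    finally have "card (primes_le M) \<le> card Q + nat \<lfloor>y\<rfloor>" by simp
    then have "real (card (primes_le M)) \<le> real (card Q) + real (nat \<lfloor>y\<rfloor>)"
      by (simp flip: of_nat_add)
    moreover have "real (nat \<lfloor>y\<rfloor>) \<le> y" using y by simp
    ultimately have "real (card Q) \<ge> y" using elim(2) unfolding y_def by linarith
    have "real M powr ((real m + 1) * (1 - \<eta>)) \<le> c * real M powr ((real m + 1) * (1 - \<eta> / 2))" by (rule elim(1))
    also have "real M powr ((real m + 1) * (1 - \<eta> / 2)) = (real M powr (1 - \<eta> / 2)) ^ (m + 1)"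
      using elim by (simp add: powr_realpow[symmetric] powr_powr mult_ac add_ac del: power_Suc)
    also have "c * (real M powr (1 - \<eta> / 2)) ^ (m + 1) = y ^ (m + 1)"
      by (simp add: c_def y_def power_mult_distrib[symmetric] del: power_Suc)
    also have "\<dots> = y * y ^ m" by simp
    also have "\<dots> \<le> real (card Q) * y ^ m" using y \<open>real (card Q) \<ge> y\<close> by (intro mult_right_mono) auto
    also have "\<dots> = (\<Sum>p\<in>Q. y ^ m)" by simp
    also have "\<dots> \<le> (\<Sum>p\<in>Q. real p ^ m)"
      using y by (intro sum_mono power_mono) (auto simp: Q_def)
    also have "\<dots> \<le> (\<Sum>p\<in>primes_le M. real p ^ m)"
      by (intro sum_mono2) (auto simp: Q_def)
    finally show ?case .
  qed
qed

text \<open>When s N^k <= 1, this is up to the factor exp(-1) a lower bound for \<Phi>(r) - Re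
  \<Phi>(r e^(it)) with r = e^(-s): the part carried by the exponents p^k with p <= N.\<close>

definition minor_sum :: "nat \<Rightarrow> nat \<Rightarrow> real \<Rightarrow> real" where
  "minor_sum k N t = (\<Sum>p\<in>primes_le N. 1 - cos (real (p ^ k) * t))"

lemma minor_sum_mono: "M \<le> N \<Longrightarrow> minor_sum k M t \<le> minor_sum k N t"
  unfolding minor_sum_def by (intro sum_mono2) auto

lemma minor_sum_ge_square:
  assumes "\<bar>t\<bar> * real M ^ k \<le> 1"
  shows "t\<^sup>2 / 4 * (\<Sum>p\<in>primes_le M. real p ^ (2 * k)) \<le> minor_sum k M t"
  unfolding minor_sum_def sum_distrib_left
proof (rule sum_mono)
  fix p assume p: "p \<in> primes_le M"
  have "\<bar>real (p ^ k) * t\<bar> = \<bar>t\<bar> * real p ^ k" by (simp add: abs_mult)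
  also have "\<dots> \<le> \<bar>t\<bar> * real M ^ k" using p by (intro mult_left_mono power_mono) auto
  finally have "(real (p ^ k) * t)\<^sup>2 / 4 \<le> 1 - cos (real (p ^ k) * t)"
    using assms by (intro one_minus_cos_ge_square) simp
  then show "t\<^sup>2 / 4 * real p ^ (2 * k) \<le> 1 - cos (real (p ^ k) * t)"
    by (simp add: power_mult_distrib power_mult[symmetric] mult_ac)
qed

text \<open>For small \<open>t\<close> only primes up to \<open>M = min N (\<bar>t\<bar> powr (-1/k))\<close> are used, so that
  \<open>\<bar>p ^ k * t\<bar> \<le> 1\<close> and no wrap-around modulo \<open>2 * pi\<close> occurs.\<close>

lemma minor_sum_large_near_zero:
  assumes "k \<ge> 1" "\<nu> > 0"
  shows "\<exists>\<delta>>0. eventually (\<lambda>N. \<forall>t. real N powr (- real k - 1 / 2 + \<nu>) \<le> \<bar>t\<bar> \<longrightarrow>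
           \<bar>t\<bar> \<le> real N powr (- (1 / 8)) \<longrightarrow> real N powr \<delta> \<le> minor_sum k N t) at_top"
proof -
  define K where "K = 2 * real k + 1"
  have K: "K > 0" by (simp add: K_def)
  \<comment> \<open>The lower bound is t^2 M^(K(1-\<eta>)) / 4. For M = N its exponent in N is at
    least 2\<nu> - K\<eta>, so K\<eta> <= \<nu> is wanted; for M < N the size of t leaves
    M^(1-K\<eta>), so K\<eta> <= 1/2 is wanted.\<close>
  define \<eta> where "\<eta> = min (\<nu> / K) (1 / (2 * K))"
  have "\<eta> * K \<le> \<nu> / K * K" "\<eta> * K \<le> 1 / (2 * K) * K" unfolding \<eta>_def using K by (intro mult_right_mono; simp)+
  then have \<eta>: "\<eta> > 0" "\<eta> * K \<le> \<nu>" "\<eta> * K \<le> 1 / 2" using K assms by (auto simp: \<eta>_def)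
  define \<delta> where "\<delta> = min (\<nu> / 2) (1 / (32 * real k))"
  have \<delta>: "\<delta> > 0" "\<delta> \<le> \<nu> / 2" "\<delta> \<le> 1 / (32 * real k)" using assms by (auto simp: \<delta>_def)
  define c where "c = (1 / 4) ^ k / (4::real)"
  have c: "c > 0" by (simp add: c_def)
  obtain M0 where M0: "\<And>M. M \<ge> M0 \<Longrightarrow> (\<Sum>p\<in>primes_le M. real p ^ (2 * k)) \<ge> real M powr (K * (1 - \<eta>))"
    using sum_prime_powers_ge[OF \<eta>(1), of "2 * k"] unfolding eventually_sequentially K_def by auto
  \<comment> \<open>For |t| <= N^(-1/8) the cutoff |t|^(-1/k) is at least N^(1/(8k)) = N^(4z). Its
    square root N^(2z) exceeds N^z with room for the constants.\<close>
  define z where "z = 1 / (32 * real k)"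
  have z: "z > 0" "1 / (8 * real k) = 4 * z" using assms by (auto simp: z_def)
  have e1: "eventually (\<lambda>N::nat. real N powr (\<nu> / 2) \<le> real N powr \<nu> / 4) at_top"
    using assms by real_asymp
  have e2: "eventually (\<lambda>N::nat. real N powr z \<le> c * (real N powr (4 * z) / 2) powr (1 / 2)) at_top"
    using z(1) c by real_asymp
  have e3: "eventually (\<lambda>N::nat. real N powr (4 * z) \<ge> real M0 + 2) at_top"
    using z(1) by real_asymp
  have "eventually (\<lambda>N. \<forall>t. real N powr (- real k - 1 / 2 + \<nu>) \<le> \<bar>t\<bar> \<longrightarrow>
           \<bar>t\<bar> \<le> real N powr (- (1 / 8)) \<longrightarrow> real N powr \<delta> \<le> minor_sum k N t) at_top"
    using e1 e2 e3 eventually_gt_at_top[of "M0 + 1"]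
  proof eventually_elim
    case (elim N)
    show ?case
    proof (intro allI impI)
      fix t assume t: "real N powr (- real k - 1 / 2 + \<nu>) \<le> \<bar>t\<bar>" "\<bar>t\<bar> \<le> real N powr (- (1 / 8))"
      have N: "real N > 1" using elim by simp
      have t0: "\<bar>t\<bar> > 0" using t(1) N by (smt (verit) powr_gt_zero)
      define x where "x = \<bar>t\<bar> powr (- 1 / real k)"
      have x0: "x > 0" using t0 by (simp add: x_def)
      have tx: "\<bar>t\<bar> * x ^ k = 1"
      proof -
        have "x ^ k = \<bar>t\<bar> powr (-1)" using assms t0
          by (simp add: x_def powr_realpow[symmetric] powr_powr)
        then show ?thesis using t0 by (simp add: powr_minus)
      qed
      have "(real N powr (- (1 / 8))) powr (- 1 / real k) \<le> x"
        unfolding x_def using t(2) t0 assms by (intro powr_mono2') auto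
      also have "(real N powr (- (1 / 8))) powr (- 1 / real k) = real N powr (4 * z)"
        unfolding z(2)[symmetric] by (simp add: powr_powr)
      finally have x1: "real N powr (4 * z) \<le> x" .
      define M where "M = min N (nat \<lfloor>x\<rfloor>)"
      have fl: "real (nat \<lfloor>x\<rfloor>) \<le> x" "x \<le> real (nat \<lfloor>x\<rfloor>) + 1" using x0 by linarith+
      have "real M0 + 1 \<le> real (nat \<lfloor>x\<rfloor>)" using x1 elim(3) fl by linarith
      then have M: "M \<ge> M0" "M \<ge> 1" "M \<le> N" "real M \<le> x" using elim(4) fl by (auto simp: M_def)
      have "\<bar>t\<bar> * real M ^ k \<le> \<bar>t\<bar> * x ^ k" using M by (intro mult_left_mono power_mono) auto
      then have "t\<^sup>2 / 4 * (\<Sum>p\<in>primes_le M. real p ^ (2 * k)) \<le> minor_sum k M t"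
        using tx by (intro minor_sum_ge_square) simp
      moreover have "t\<^sup>2 / 4 * real M powr (K * (1 - \<eta>)) \<le> t\<^sup>2 / 4 * (\<Sum>p\<in>primes_le M. real p ^ (2 * k))"
        using M0[OF M(1)] by (intro mult_left_mono) auto
      ultimately have lower: "t\<^sup>2 / 4 * real M powr (K * (1 - \<eta>)) \<le> minor_sum k N t"
        using minor_sum_mono[OF M(3), of k t] by linarith
      have "real N powr \<delta> \<le> t\<^sup>2 / 4 * real M powr (K * (1 - \<eta>))"
      proof (cases "M = N")
        case True
        have "real N powr \<delta> \<le> real N powr (\<nu> / 2)" using N \<delta> by (intro powr_mono) auto
        also have "\<dots> \<le> real N powr \<nu> / 4" by (rule elim(1))
        also have "\<dots> \<le> real N powr (2 * (- real k - 1 / 2 + \<nu>) + K * (1 - \<eta>)) / 4"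
          using N \<eta> by (intro divide_right_mono powr_mono) (auto simp: K_def algebra_simps)
        also have "\<dots> = (real N powr (- real k - 1 / 2 + \<nu>))\<^sup>2 / 4 * real M powr (K * (1 - \<eta>))"
          using N True by (simp add: powr_add powr_realpow[symmetric] powr_powr power2_eq_square algebra_simps flip: powr_add)
        also have "\<dots> \<le> t\<^sup>2 / 4 * real M powr (K * (1 - \<eta>))"
          using power_mono[OF t(1), of 2] by (intro mult_right_mono divide_right_mono) auto
        finally show ?thesis .
      next
        case False
        \<comment> \<open>Here M is the rounded cutoff, so (2M)^k |t| >= 1: t^2 is at least a
          constant times M^(-2k), which cancels all but one of the 2k+1 powers of M.\<close>
        then have M': "M = nat \<lfloor>x\<rfloor>" by (simp add: M_def min_def split: if_splits)
        then have x2: "x \<le> 2 * real M" using fl M(2) by linarith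
        have "1 = \<bar>t\<bar> * x ^ k" by (simp add: tx)
        also have "\<dots> \<le> \<bar>t\<bar> * (2 * real M) ^ k" using x2 x0 by (intro mult_left_mono power_mono) auto
        finally have "1\<^sup>2 \<le> (\<bar>t\<bar> * (2 * real M) ^ k)\<^sup>2" by (intro power_mono) auto
        moreover have "((2 * real M) ^ k)\<^sup>2 = ((2 * real M)\<^sup>2) ^ k"
          by (simp only: power_mult[symmetric] mult.commute)
        ultimately have tt: "1 \<le> t\<^sup>2 * (4 ^ k * real M ^ (2 * k))"
          by (simp add: power_mult_distrib power_mult)
        have "real N powr \<delta> \<le> real N powr z" using N \<delta> by (intro powr_mono) (auto simp: z_def)
        also have "\<dots> \<le> c * (real N powr (4 * z) / 2) powr (1 / 2)" by (rule elim(2))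
        also have "\<dots> \<le> c * real M powr (1 / 2)"
          using c x1 x2 by (intro mult_left_mono powr_mono2) auto
        also have "\<dots> \<le> c * real M powr (K * (1 - \<eta>) - 2 * real k)"
          using c M(2) \<eta> by (intro mult_left_mono powr_mono) (auto simp: K_def algebra_simps)
        also have "\<dots> = c * (real M powr (K * (1 - \<eta>)) / real M ^ (2 * k))"
          using M(2) by (simp add: powr_diff powr_realpow[symmetric])
        also have "\<dots> \<le> c * (real M powr (K * (1 - \<eta>)) * (t\<^sup>2 * 4 ^ k))"
        proof (rule mult_left_mono)
          have "1 / real M ^ (2 * k) \<le> t\<^sup>2 * 4 ^ k" using tt M(2) by (simp add: field_simps)
          then have "real M powr (K * (1 - \<eta>)) * (1 / real M ^ (2 * k)) \<le> real M powr (K * (1 - \<eta>)) * (t\<^sup>2 * 4 ^ k)"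
            by (intro mult_left_mono) auto
          then show "real M powr (K * (1 - \<eta>)) / real M ^ (2 * k) \<le> real M powr (K * (1 - \<eta>)) * (t\<^sup>2 * 4 ^ k)" by simp
        qed (use c in simp)
        also have "\<dots> = t\<^sup>2 / 4 * real M powr (K * (1 - \<eta>))"
          by (simp add: c_def power_divide)
        finally show ?thesis .
      qed
      then show "real N powr \<delta> \<le> minor_sum k N t" using lower by linarith
    qed
  qed
  with \<delta>(1) show ?thesis by (intro exI[of _ \<delta>] conjI)
qed

text \<open>As p does not divide q, the fraction a p^k / q is not an integer, hence at distance at
  least 1/q from all integers. The perturbation is at most 1/(2q), so at least 1/(2q) remains, which
  exceeds 1/(4q).\<close>

lemma not_near_int_prime_power_mult:
  fixes a :: int and q p k :: nat
  assumes "prime p" "\<not> p dvd q" "q \<ge> 2" "coprime a (int q)"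
    and "\<bar>\<alpha> - of_int a / real q\<bar> * real p ^ k \<le> 1 / (2 * real q)" 
  shows "\<not> near_int (1 / (4 * real q)) (\<alpha> * real p ^ k)"
proof
  assume "near_int (1 / (4 * real q)) (\<alpha> * real p ^ k)"
  then obtain b :: int where b: "\<bar>\<alpha> * real p ^ k - of_int b\<bar> \<le> 1 / (4 * real q)" by (auto simp: near_int_def)
  have q0: "real q > 0" using assms by simp
  have "\<not> int q dvd a * int p ^ k"
  proof
    assume "int q dvd a * int p ^ k"
    then have "int q dvd int p ^ k" using assms(4) by (simp add: coprime_commute coprime_dvd_mult_right_iff)
    moreover have "coprime (int q) (int p ^ k)"
      using prime_imp_coprime[OF assms(1,2)] by (simp add: coprime_commute)
    ultimately have "int q dvd 1" by (metis coprime_common_divisor dvd_refl)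
    then show False using assms(3) by simp
  qed
  then have "a * int p ^ k - b * int q \<noteq> 0" by (metis dvd_triv_right eq_iff_diff_eq_0)
  then have "1 \<le> \<bar>a * int p ^ k - b * int q\<bar>" by linarith
  then have "(1::real) \<le> of_int \<bar>a * int p ^ k - b * int q\<bar>" by linarith
  then have 1: "1 \<le> \<bar>of_int a * real p ^ k - of_int b * real q\<bar>" by simp
  have "of_int a * real p ^ k - of_int b * real q = 
        real q * ((\<alpha> * real p ^ k - of_int b) - (\<alpha> - of_int a / real q) * real p ^ k)"
    using q0 by (simp add: field_simps)
  then have "\<bar>of_int a * real p ^ k - of_int b * real q\<bar> =
        real q * \<bar>(\<alpha> * real p ^ k - of_int b) - (\<alpha> - of_int a / real q) * real p ^ k\<bar>"
    by (simp add: abs_mult)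
  also have "\<dots> \<le> real q * (\<bar>\<alpha> * real p ^ k - of_int b\<bar> + \<bar>\<alpha> - of_int a / real q\<bar> * real p ^ k)"
  proof (rule mult_left_mono)
    have "\<bar>(\<alpha> - of_int a / real q) * real p ^ k\<bar> = \<bar>\<alpha> - of_int a / real q\<bar> * real p ^ k"
      by (simp add: abs_mult)
    then show "\<bar>(\<alpha> * real p ^ k - of_int b) - (\<alpha> - of_int a / real q) * real p ^ k\<bar> \<le>
               \<bar>\<alpha> * real p ^ k - of_int b\<bar> + \<bar>\<alpha> - of_int a / real q\<bar> * real p ^ k"
      using abs_triangle_ineq4[of "\<alpha> * real p ^ k - of_int b" "(\<alpha> - of_int a / real q) * real p ^ k"]
      by (simp only:)
  qed simp
  also have "\<dots> \<le> real q * (1 / (4 * real q) + 1 / (2 * real q))"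
    using b assms(5) by (intro mult_left_mono add_mono) auto
  also have "\<dots> = 3 / 4" using q0 by (simp add: field_simps)
  finally show False using 1 by simp
qed

text \<open>If the sum were small, \<open>\<alpha> p\<^sup>k\<close> with \<open>\<alpha> = t / (2 * pi)\<close> would be very close to an integer for most
  primes, which makes \<open>\<alpha>\<close> close to \<open>a / r\<close> with \<open>r\<close> tiny. If \<open>r \<ge> 2\<close>, then the primes up to a small
  power of \<open>N\<close> that do not divide \<open>r\<close> already give a contradiction; \<open>r = 1\<close> contradicts the size of \<open>t\<close>.\<close>

lemma minor_sum_large_away_from_zero:
  assumes "k \<ge> 1"
  shows "\<exists>\<delta>>0. eventually (\<lambda>N. \<forall>t. real N powr (- (1 / 8)) < \<bar>t\<bar> \<longrightarrow> \<bar>t\<bar> \<le> pi \<longrightarrow>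
           real N powr \<delta> \<le> minor_sum k N t) at_top"
proof -
  \<comment> \<open>The denominator will be at most N^z and the small primes at most N^(8z), so that
    p^k <= N^(1/8) for them.\<close>
  define z where "z = 1 / (64 * real k)"
  have z: "z > 0" "z \<le> 1 / 64" "1 / (8 * real k) = 8 * z" using assms by (auto simp: z_def field_simps)
  \<comment> \<open>Chosen so that the denominator bound N^((4^k - 1) \<eta>) of the cube argument
    is at most N^z.\<close>
  define \<eta> where "\<eta> = z / 4 ^ k"
  have \<eta>: "\<eta> > 0" "4 ^ k * \<eta> = z" "\<eta> \<le> z" using z by (auto simp: \<eta>_def field_simps)
  have cube: "eventually (\<lambda>N. \<forall>S f b \<epsilon>. S \<subseteq> {..N} \<longrightarrow> real (card S) \<ge> real N powr (1 - \<eta>) \<longrightarrow>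
           poly_phase k b f \<longrightarrow> (\<forall>x\<in>S. near_int \<epsilon> (f x)) \<longrightarrow>
           (\<exists>q::nat. q \<ge> 1 \<and> real q \<le> real N powr ((4 ^ k - 1) * \<eta>) \<and> near_int (2 ^ k * \<epsilon>) (b * real q))) at_top"
    using \<eta> z by (intro dense_near_int_imp_rational) auto
  have pc: "eventually (\<lambda>N. real (card (primes_le N)) \<ge> real N powr (1 - \<eta> / 2)) at_top"
    using prime_count_ge_powr[of "\<eta> / 2"] \<eta> by simp
  obtain M0 where M0: "\<And>M. M \<ge> M0 \<Longrightarrow> real (card (primes_le M)) \<ge> real M powr (1 / 2)"
    using prime_count_ge_powr[of "1 / 2"] unfolding eventually_sequentially by auto
  define C where "C = (2::real) ^ k"
  have C: "C \<ge> 1" by (simp add: C_def)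
  have e1: "eventually (\<lambda>N::nat. real N powr (1 - \<eta>) \<le> real N powr (1 - \<eta> / 2) - real N powr (1 / 2 + z)) at_top"
    using \<eta> z by real_asymp
  have e2: "eventually (\<lambda>N::nat. real N powr (- (1 / 4)) \<le> 1 / 8) at_top" by real_asymp
  have e3: "eventually (\<lambda>N::nat. C * real N powr (- (1 / 4)) < 1 / 2) at_top" using C by real_asymp
  have e4: "eventually (\<lambda>N::nat. 2 * pi * (C * real N powr (- (1 / 4))) \<le> real N powr (- (1 / 8))) at_top"
    using C by real_asymp
  have e5: "eventually (\<lambda>N::nat. C * real N powr (- (1 / 4)) * real N powr (1 / 8) \<le> 1 / (2 * real N powr z)) at_top"
    using C z by real_asymp
  have e6: "eventually (\<lambda>N::nat. real N powr (8 * z) \<ge> real M0 + 2) at_top" using z by real_asymp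
  have e7: "eventually (\<lambda>N::nat. real N powr z \<le> ((real N powr (8 * z) / 2) powr (1 / 2) - real N powr z) / (16 * real N powr (2 * z))) at_top"
    using z by real_asymp
  have e8: "eventually (\<lambda>N::nat. real N powr (8 * z) \<le> real N) at_top"
    using eventually_ge_at_top[of 1]
    by eventually_elim (use z in \<open>auto intro!: order.trans[OF powr_mono[of "8 * z" 1]]\<close>)
  have "eventually (\<lambda>N. \<forall>t. real N powr (- (1 / 8)) < \<bar>t\<bar> \<longrightarrow> \<bar>t\<bar> \<le> pi \<longrightarrow>
           real N powr z \<le> minor_sum k N t) at_top"
    using cube pc e1 e2 e3 e4 e5 e6 e7 e8 eventually_gt_at_top[of 1]
  proof eventually_elim
    case (elim N)
    note cubeN = elim(1)[rule_format]
    show ?case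
    proof (intro allI impI, rule ccontr)
      fix t assume t: "real N powr (- (1 / 8)) < \<bar>t\<bar>" "\<bar>t\<bar> \<le> pi" and "\<not> real N powr z \<le> minor_sum k N t"
      then have small: "minor_sum k N t < real N powr z" by simp
      define \<alpha> where "\<alpha> = t / (2 * pi)"
      have \<alpha>: "t = 2 * pi * \<alpha>" "\<bar>\<alpha>\<bar> \<le> 1 / 2" using t by (auto simp: \<alpha>_def field_simps)
      have ms: "minor_sum k N t = (\<Sum>p\<in>primes_le N. 1 - cos (2 * pi * (\<alpha> * real p ^ k)))"
        unfolding minor_sum_def \<alpha>(1) by (intro sum.cong) (auto simp: mult_ac)
      \<comment> \<open>Each prime with \<open>\<alpha> * p ^ k\<close> farther than \<epsilon> from
        the integers contributes \<epsilon>^2 = N^(-1/2) to the sum, so there are at most N^(1/2+z)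
        of them, negligible against all primes up to N.\<close>
      define \<epsilon> where "\<epsilon> = real N powr (- (1 / 4))"
      have \<epsilon>: "\<epsilon> > 0" "\<epsilon> \<le> 1 / 8" using elim(4,11) by (auto simp: \<epsilon>_def)
      define G where "G = {p \<in> primes_le N. near_int \<epsilon> (\<alpha> * real p ^ k)}"
      define B where "B = primes_le N - G"
      have "real (card B) * \<epsilon>\<^sup>2 = (\<Sum>p\<in>B. \<epsilon>\<^sup>2)" by simp
      also have "\<dots> \<le> (\<Sum>p\<in>B. 1 - cos (2 * pi * (\<alpha> * real p ^ k)))"
        using \<epsilon> by (intro sum_mono one_minus_cos_ge_of_not_near_int) (auto simp: B_def G_def)
      also have "\<dots> \<le> minor_sum k N t" unfolding ms by (intro sum_mono2) (auto simp: B_def)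
      finally have "real (card B) * \<epsilon>\<^sup>2 \<le> real N powr z" using small by linarith
      moreover have "\<epsilon>\<^sup>2 = real N powr (- (1 / 2))" 
        by (simp add: \<epsilon>_def power2_eq_square flip: powr_add)
      ultimately have "real (card B) \<le> real N powr z * real N powr (1 / 2)" 
        using elim(11) by (simp add: powr_minus field_simps)
      then have cB: "real (card B) \<le> real N powr (1 / 2 + z)" by (simp add: powr_add mult_ac)
      have "card (primes_le N) = card (G \<union> B)" by (intro arg_cong[of _ _ card]) (auto simp: B_def G_def)
      also have "\<dots> \<le> card G + card B" by (rule card_Un_le)
      finally have "real (card (primes_le N)) \<le> real (card G) + real (card B)" by simp
      then have cG: "real (card G) \<ge> real N powr (1 - \<eta>)" using cB elim(2,3) by linarith
      have "\<exists>q::nat. q \<ge> 1 \<and> real q \<le> real N powr ((4 ^ k - 1) * \<eta>) \<and> near_int (2 ^ k * \<epsilon>) (\<alpha> * real q)"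
        by (rule cubeN[OF _ cG poly_phase_monomial(1)]) (auto simp: G_def)
      then obtain q where q: "q \<ge> 1" "real q \<le> real N powr ((4 ^ k - 1) * \<eta>)" "near_int (C * \<epsilon>) (\<alpha> * real q)"
        by (auto simp: C_def)
      have "real N powr ((4 ^ k - 1) * \<eta>) \<le> real N powr z"
        using elim(11) \<eta> by (intro powr_mono) (auto simp: algebra_simps)
      then have qz: "real q \<le> real N powr z" using q by linarith
      obtain a0 :: int where a0: "\<bar>\<alpha> * real q - of_int a0\<bar> \<le> C * \<epsilon>" using q by (auto simp: near_int_def)
      \<comment> \<open>The approximation a0 / q need not be in lowest terms; coprimality is needed
        for the argument with small primes. Reduction only shrinks the denominator.\<close>
      define g where "g = gcd a0 (int q)"
      have g: "g > 0" using q by (simp add: g_def)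
      define a where "a = a0 div g"
      define r where "r = nat (int q div g)"
      have ga: "a0 = a * g" by (simp add: a_def g_def)
      have gq: "int q = int q div g * g" by (simp add: g_def)
      then have "int q div g \<ge> 1" using g q by (smt (verit) mult_nonpos_nonneg of_nat_1 of_nat_le_iff)
      then have gr: "int r = int q div g" "r \<ge> 1" by (auto simp: r_def)
      have cop: "coprime a (int r)" unfolding gr(1) a_def g_def using q
        by (intro div_gcd_coprime) auto
      have rq: "real q = real r * real_of_int g" using gq gr by (metis of_int_mult of_int_of_nat_eq)
      have rle: "real r \<le> real q" unfolding rq using g gr by (simp add: mult_le_cancel_left1)
      have ar: "of_int a / real r = of_int a0 / real q" unfolding rq ga using g by simp
      have "\<bar>\<alpha> - of_int a / real r\<bar> = \<bar>\<alpha> * real q - of_int a0\<bar> / real q"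
      proof -
        have "\<alpha> - x / y = (\<alpha> * y - x) / y" if "y > 0" for x y :: real
          using that by (simp add: diff_divide_distrib)
        then have "\<alpha> - of_int a0 / real q = (\<alpha> * real q - of_int a0) / real q" using q(1) by simp
        then show ?thesis unfolding ar by (simp add: abs_divide)
      qed
      also have "\<dots> \<le> \<bar>\<alpha> * real q - of_int a0\<bar> / 1" using q by (intro divide_left_mono) auto
      finally have ap: "\<bar>\<alpha> - of_int a / real r\<bar> \<le> C * \<epsilon>" using a0 by simp
      have N1: "real N > 0" using elim(11) by simp
      show False
      proof (cases "r = 1")
        case True
        then have "\<bar>\<alpha> - of_int a\<bar> < 1 / 2" using ap elim(5) by (simp add: \<epsilon>_def)
        then have "\<bar>of_int a :: real\<bar> < 1" using \<alpha>(2) by linarith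
        then have "a = 0" by linarith
        then have "\<bar>\<alpha>\<bar> \<le> C * \<epsilon>" using ap True by simp
        then have "2 * pi * \<bar>\<alpha>\<bar> \<le> 2 * pi * (C * \<epsilon>)" by (intro mult_left_mono) auto
        moreover have "\<bar>t\<bar> = 2 * pi * \<bar>\<alpha>\<bar>" by (simp add: \<alpha>(1) abs_mult)
        ultimately have "\<bar>t\<bar> \<le> real N powr (- (1 / 8))" using elim(6) unfolding \<epsilon>_def by linarith
        then show False using t by linarith
      next
        case False
        then have r2: "r \<ge> 2" using gr by simp
        \<comment> \<open>On this range the error in \<alpha> = a/r, amplified by p^k <= N^(1/8), is
          about N^(-1/8) and so stays below 1/(2r).\<close>
        define M where "M = nat \<lfloor>real N powr (8 * z)\<rfloor>"
        have "real N powr (8 * z) \<ge> 0" by simp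
        then have fl: "real M \<le> real N powr (8 * z)" "real N powr (8 * z) \<le> real M + 1" unfolding M_def by linarith+
        have M: "M \<ge> M0" "M \<ge> 1" "M \<le> N" using fl(1) fl(2) elim(8) elim(10) by linarith+
        define P where "P = {p \<in> primes_le M. \<not> p dvd r}"
        have "card (primes_le M) \<le> card (P \<union> {1..r})"
        proof (rule card_mono)
          have "p \<in> {1..r}" if "prime p" "p dvd r" for p
            using dvd_imp_le[OF that(2)] prime_gt_0_nat[OF that(1)] gr(2) by simp
          then show "primes_le M \<subseteq> P \<union> {1..r}" unfolding P_def by blast
        qed (simp add: P_def)
        also have "\<dots> \<le> card P + r" by (rule order.trans[OF card_Un_le]) simp
        finally have "real (card (primes_le M)) \<le> real (card P) + real r" by simp
        then have cP: "real (card P) \<ge> (real N powr (8 * z) / 2) powr (1 / 2) - real N powr z"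
        proof -
          have "(real N powr (8 * z) / 2) powr (1 / 2) \<le> real M powr (1 / 2)"
            using fl M(2) by (intro powr_mono2) auto
          moreover have "real M powr (1 / 2) \<le> real (card (primes_le M))" by (rule M0[OF M(1)])
          ultimately show ?thesis using \<open>real (card (primes_le M)) \<le> real (card P) + real r\<close> rle qz by linarith
        qed
        \<comment> \<open>About N^(4z) primes up to M are guaranteed, those dividing r number at
          most N^z, and each of the others contributes at least a constant times N^(-2z). The total,
          about N^(2z), contradicts the bound N^z.\<close>
        have each: "1 / (16 * real N powr (2 * z)) \<le> 1 - cos (2 * pi * (\<alpha> * real p ^ k))" if "p \<in> P" for p
        proof -
          have "real p ^ k \<le> (real N powr (8 * z)) ^ k" using that fl by (intro power_mono) (auto simp: P_def)
          also have "\<dots> = real N powr (1 / 8)" using N1 assms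
            by (simp add: powr_realpow[symmetric] powr_powr z_def)
          finally have pk: "real p ^ k \<le> real N powr (1 / 8)" .
          have "\<bar>\<alpha> - of_int a / real r\<bar> * real p ^ k \<le> C * \<epsilon> * real N powr (1 / 8)"
            using ap pk by (intro mult_mono) (use C \<epsilon> in auto)
          also have "\<dots> \<le> 1 / (2 * real N powr z)" using elim(7) by (simp add: \<epsilon>_def)
          also have "\<dots> \<le> 1 / (2 * real r)" using rle qz gr N1 by (intro divide_left_mono) auto
          finally have "\<not> near_int (1 / (4 * real r)) (\<alpha> * real p ^ k)"
            using that r2 cop by (intro not_near_int_prime_power_mult[where a = a]) (auto simp: P_def)
          then have "(1 / (4 * real r))\<^sup>2 \<le> 1 - cos (2 * pi * (\<alpha> * real p ^ k))"
            using r2 by (intro one_minus_cos_ge_of_not_near_int) (auto simp: field_simps)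
          moreover have "1 / (16 * real N powr (2 * z)) \<le> (1 / (4 * real r))\<^sup>2"
          proof -
            have "real r ^ 2 \<le> (real N powr z) ^ 2" using rle qz by (intro power_mono) auto
            also have "\<dots> = real N powr (2 * z)" by (simp add: power2_eq_square flip: powr_add)
            finally have "1 / (16 * real N powr (2 * z)) \<le> 1 / (16 * (real r)\<^sup>2)"
              using r2 N1 by (intro divide_left_mono mult_left_mono) auto
            then show ?thesis by (simp add: power_divide power_mult_distrib)
          qed
          ultimately show ?thesis by (rule order.trans[rotated])
        qed
        have "real N powr z \<le> ((real N powr (8 * z) / 2) powr (1 / 2) - real N powr z) / (16 * real N powr (2 * z))"
          by (rule elim(9))
        also have "\<dots> \<le> real (card P) / (16 * real N powr (2 * z))" using cP by (intro divide_right_mono) auto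
        also have "\<dots> = (\<Sum>p\<in>P. 1 / (16 * real N powr (2 * z)))" by simp
        also have "\<dots> \<le> (\<Sum>p\<in>P. 1 - cos (2 * pi * (\<alpha> * real p ^ k)))" by (intro sum_mono each)
        also have "\<dots> \<le> minor_sum k N t" unfolding ms using M by (intro sum_mono2) (auto simp: P_def)
        finally show False using small by linarith
      qed
    qed
  qed
  with z(1) show ?thesis by (intro exI[of _ z] conjI)
qed

lemma minor_sum_large:
  assumes "k \<ge> 1" "\<nu> > 0"
  shows "\<exists>\<delta>>0. eventually (\<lambda>N. \<forall>t. real N powr (- real k - 1 / 2 + \<nu>) \<le> \<bar>t\<bar> \<longrightarrow>
           \<bar>t\<bar> \<le> pi \<longrightarrow> real N powr \<delta> \<le> minor_sum k N t) at_top"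
proof -
  obtain \<delta>1 where d1: "\<delta>1 > 0" and
    e1: "eventually (\<lambda>N. \<forall>t. real N powr (- real k - 1 / 2 + \<nu>) \<le> \<bar>t\<bar> \<longrightarrow>
           \<bar>t\<bar> \<le> real N powr (- (1 / 8)) \<longrightarrow> real N powr \<delta>1 \<le> minor_sum k N t) at_top"
    using minor_sum_large_near_zero[OF assms] by (elim exE conjE)
  obtain \<delta>2 where d2: "\<delta>2 > 0" and
    e2: "eventually (\<lambda>N. \<forall>t. real N powr (- (1 / 8)) < \<bar>t\<bar> \<longrightarrow> \<bar>t\<bar> \<le> pi \<longrightarrow>
           real N powr \<delta>2 \<le> minor_sum k N t) at_top"
    using minor_sum_large_away_from_zero[OF assms(1)] by (elim exE conjE)
  have "eventually (\<lambda>N. \<forall>t. real N powr (- real k - 1 / 2 + \<nu>) \<le> \<bar>t\<bar> \<longrightarrow>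
           \<bar>t\<bar> \<le> pi \<longrightarrow> real N powr (min \<delta>1 \<delta>2) \<le> minor_sum k N t) at_top"
    using e1 e2 eventually_ge_at_top[of 1]
  proof eventually_elim
    case (elim N)
    have le: "real N powr (min \<delta>1 \<delta>2) \<le> real N powr \<delta>1" "real N powr (min \<delta>1 \<delta>2) \<le> real N powr \<delta>2"
      using elim by (auto intro!: powr_mono)
    show ?case
    proof (intro allI impI)
      fix t assume t: "real N powr (- real k - 1 / 2 + \<nu>) \<le> \<bar>t\<bar>" "\<bar>t\<bar> \<le> pi"
      show "real N powr (min \<delta>1 \<delta>2) \<le> minor_sum k N t"
      proof (cases "\<bar>t\<bar> \<le> real N powr (- (1 / 8))")
        case True
        with elim(1)[rule_format, OF t(1)] le(1) show ?thesis by linarith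
      next
        case False
        then have "real N powr (- (1 / 8)) < \<bar>t\<bar>" by simp
        with elim(2)[rule_format, OF _ t(2)] le(2) show ?thesis by linarith
      qed
    qed
  qed
  then show ?thesis using d1 d2 by (intro exI[of _ "min \<delta>1 \<delta>2"]) auto
qed

section \<open>Generating functions of restricted partitions\<close>

text \<open>An arbitrary set of parts permits induction over finite sets; \<open>pP\<close> is the
  case \<open>primePows k\<close>, reached as a limit.\<close>

definition parts_in :: "nat set \<Rightarrow> nat \<Rightarrow> nat multiset set" where
  "parts_in A n = {M. set_mset M \<subseteq> A \<and> sum_mset M = n}"

text \<open>Either \<open>a\<close> does not occur, or one copy of it can be removed.\<close>

lemma parts_in_insert:
  assumes "a \<notin> A"
  shows "parts_in (insert a A) n =
         parts_in A n \<union> (if a \<le> n then add_mset a ` parts_in (insert a A) (n - a) else {})"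
proof (intro equalityI subsetI)
  fix M assume M: "M \<in> parts_in (insert a A) n"
  show "M \<in> parts_in A n \<union> (if a \<le> n then add_mset a ` parts_in (insert a A) (n - a) else {})"
  proof (cases "a \<in># M")
    case True
    then obtain N where N: "M = add_mset a N" by (meson mset_add)
    then show ?thesis using M by (auto simp: parts_in_def)
  next
    case False
    then have "M \<in> parts_in A n" using M by (auto simp: parts_in_def)
    then show ?thesis by simp
  qed
qed (auto simp: parts_in_def split: if_splits)

lemma finite_parts_in:
  assumes "finite A" "0 \<notin> A"
  shows "finite (parts_in A n)"
  using assms
proof (induction A arbitrary: n rule: finite_induct)
  case empty
  have "parts_in {} n \<subseteq> {{#}}" by (auto simp: parts_in_def)
  then show ?case by (rule finite_subset) simp
next
  case (insert a A)
  show ?case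
  proof (induction n rule: less_induct)
    case (less n)
    have "finite (parts_in A n)" using insert by auto
    moreover have "finite (parts_in (insert a A) (n - a))" if "a \<le> n"
      using less[of "n - a"] insert.prems that by auto
    ultimately show ?case by (subst parts_in_insert) (use insert in auto)
  qed
qed

definition num_parts :: "nat set \<Rightarrow> nat \<Rightarrow> nat" where
  "num_parts A n = card (parts_in A n)"

lemma num_parts_empty: "num_parts {} n = (if n = 0 then 1 else 0)"
proof -
  have "parts_in {} n = (if n = 0 then {{#}} else {})" by (auto simp: parts_in_def)
  then show ?thesis by (simp add: num_parts_def)
qed

lemma num_parts_insert:
  assumes "finite A" "0 \<notin> A" "a \<notin> A" "a > 0"
  shows "num_parts (insert a A) n =
         num_parts A n + (if a \<le> n then num_parts (insert a A) (n - a) else 0)"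
proof -
  have "card (parts_in A n \<union> (if a \<le> n then add_mset a ` parts_in (insert a A) (n - a) else {})) =
        card (parts_in A n) + card (if a \<le> n then add_mset a ` parts_in (insert a A) (n - a) else {})"
    by (rule card_Un_disjoint)
       (use assms in \<open>auto simp: finite_parts_in\<close>, auto simp: parts_in_def)
  moreover have "card (add_mset a ` parts_in (insert a A) (n - a)) = card (parts_in (insert a A) (n - a))"
    by (rule card_image) (auto simp: inj_on_def)
  ultimately show ?thesis unfolding num_parts_def by (subst parts_in_insert) (use assms in auto)
qed

lemma num_parts_restrict:
  assumes "n \<le> b"
  shows "num_parts A n = num_parts (A \<inter> {..b}) n"
proof -
  have "x \<le> sum_mset M" if "x \<in># M" for x :: nat and M
    using that by (metis mset_add sum_mset.add_mset le_add1)
  then have "parts_in A n = parts_in (A \<inter> {..b}) n" using assms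
    by (auto simp: parts_in_def) (meson le_trans)
  then show ?thesis by (simp add: num_parts_def)
qed

text \<open>The recurrence gives S <= (product over A) + r^a S for the partial sums S, which can be
  solved because r^a < 1. Working with partial sums yields absolute convergence before the value of
  the series is known.\<close>

lemma num_parts_partial_sum_le:
  assumes "finite A" "0 \<notin> A" "0 \<le> r" "r < (1::real)"
  shows "(\<Sum>m<n. real (num_parts A m) * r ^ m) \<le> (\<Prod>a\<in>A. 1 / (1 - r ^ a))"
  using assms(1,2)
proof (induction A arbitrary: n rule: finite_induct)
  case empty
  have "(\<Sum>m<n. real (num_parts {} m) * r ^ m) = (\<Sum>m<n. if m = 0 then 1 else 0)"
    by (intro sum.cong) (auto simp: num_parts_empty)
  also have "\<dots> \<le> 1" by simp
  finally show ?case by simp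
next
  case (insert a A)
  define S where "S = (\<Sum>m<n. real (num_parts (insert a A) m) * r ^ m)"
  have a: "a > 0" "0 \<notin> A" using insert by auto
  have ra: "r ^ a < 1" using assms a by (simp add: power_less_one_iff)
  have "S = (\<Sum>m<n. real (num_parts A m) * r ^ m) + 
            (\<Sum>m<n. if a \<le> m then real (num_parts (insert a A) (m - a)) * r ^ m else 0)"
    unfolding S_def sum.distrib[symmetric]
  proof (rule sum.cong)
    fix m
    show "real (num_parts (insert a A) m) * r ^ m = real (num_parts A m) * r ^ m +
            (if a \<le> m then real (num_parts (insert a A) (m - a)) * r ^ m else 0)"
      using num_parts_insert[OF insert.hyps(1) a(2) insert.hyps(2) a(1), of m]
      by (cases "a \<le> m") (simp_all add: distrib_right)
  qed simp
  also have "(\<Sum>m<n. if a \<le> m then real (num_parts (insert a A) (m - a)) * r ^ m else 0)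
             = (\<Sum>m\<in>{m. m < n \<and> a \<le> m}. real (num_parts (insert a A) (m - a)) * r ^ m)"
    by (subst sum.inter_filter[symmetric]) (auto intro!: sum.cong)
  also have "\<dots> = (\<Sum>i<n - a. real (num_parts (insert a A) i) * r ^ (i + a))"
    by (rule sum.reindex_bij_witness[of _ "\<lambda>i. i + a" "\<lambda>m. m - a"]) auto
  also have "\<dots> = r ^ a * (\<Sum>i<n - a. real (num_parts (insert a A) i) * r ^ i)"
    by (simp add: sum_distrib_left power_add mult_ac)
  also have "\<dots> \<le> r ^ a * S" unfolding S_def
    by (intro mult_left_mono sum_mono2) (use assms in auto)
  finally have "S * (1 - r ^ a) \<le> (\<Prod>a\<in>A. 1 / (1 - r ^ a))"
    using insert.IH[of n] a by (simp add: algebra_simps)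
  then have "S \<le> (\<Prod>a\<in>A. 1 / (1 - r ^ a)) / (1 - r ^ a)"
    using ra by (simp add: field_simps)
  then show ?case unfolding S_def using insert by simp
qed

lemma num_parts_summable_norm:
  fixes z :: complex
  assumes "finite A" "0 \<notin> A" "norm z < 1"
  shows "summable (\<lambda>n. norm (of_nat (num_parts A n) * z ^ n))"
proof (rule bounded_imp_summable)
  show "(\<Sum>k\<le>n. norm (of_nat (num_parts A k) * z ^ k)) \<le> (\<Prod>a\<in>A. 1 / (1 - norm z ^ a))" for n
    using num_parts_partial_sum_le[OF assms(1,2) norm_ge_zero assms(3), of "Suc n"]
    by (simp add: norm_mult norm_power lessThan_Suc_atMost)
qed auto

lemma num_parts_sums:
  fixes z :: complex
  assumes "finite A" "0 \<notin> A" "norm z < 1"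
  shows "(\<lambda>n. of_nat (num_parts A n) * z ^ n) sums (\<Prod>a\<in>A. 1 / (1 - z ^ a))"
  using assms(1,2)
proof (induction A rule: finite_induct)
  case empty
  have "(\<lambda>n. of_nat (num_parts {} n) * z ^ n) = (\<lambda>n. if n = 0 then 1 else 0)"
    by (auto simp: num_parts_empty)
  then show ?case using sums_single[of 0 "\<lambda>_. 1 :: complex"] by simp
next
  case (insert a A)
  have a: "a > 0" "0 \<notin> A" using insert by auto
  define S where "S = (\<Sum>n. of_nat (num_parts (insert a A) n) * z ^ n)"
  have "summable (\<lambda>n. of_nat (num_parts (insert a A) n) * z ^ n)"
    by (rule summable_norm_cancel[OF num_parts_summable_norm]) (use insert assms in auto)
  then have S: "(\<lambda>n. of_nat (num_parts (insert a A) n) * z ^ n) sums S"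
    by (simp add: S_def summable_sums)
  define g where "g n = (if n < a then 0 else z ^ a * (of_nat (num_parts (insert a A) (n - a)) * z ^ (n - a)))" for n
  have "g (n + a) = z ^ a * (of_nat (num_parts (insert a A) n) * z ^ n)" for n
    by (simp add: g_def)
  then have "(\<lambda>n. g (n + a)) sums (z ^ a * S)"
    by (simp only: sums_mult[OF S])
  then have 1: "g sums (z ^ a * S)"
    unfolding sums_iff_shift[of g a] by (simp add: g_def)
  have "(\<lambda>n. of_nat (num_parts A n) * z ^ n + g n) sums
        ((\<Prod>a\<in>A. 1 / (1 - z ^ a)) + z ^ a * S)"
    by (rule sums_add[OF _ 1]) (use insert in auto)
  also have "(\<lambda>n. of_nat (num_parts A n) * z ^ n + g n) = 
        (\<lambda>n. of_nat (num_parts (insert a A) n) * z ^ n)"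
  proof
    fix n
    show "of_nat (num_parts A n) * z ^ n + g n =
         of_nat (num_parts (insert a A) n) * z ^ n"
      using num_parts_insert[OF insert.hyps(1) a(2) insert.hyps(2) a(1), of n]
        power_add[of z a "n - a"] unfolding g_def
      by (cases "a \<le> n") (simp_all add: distrib_right)
  qed
  finally have "S = (\<Prod>a\<in>A. 1 / (1 - z ^ a)) + z ^ a * S"
    using S sums_unique2 by blast
  then have "S * (1 - z ^ a) = (\<Prod>a\<in>A. 1 / (1 - z ^ a))" by (simp add: algebra_simps)
  moreover have "norm (z ^ a) < 1" using assms a by (simp add: norm_power power_less_one_iff)
  then have "1 - z ^ a \<noteq> 0" by auto
  ultimately have "S = (\<Prod>a\<in>insert a A. 1 / (1 - z ^ a))"
    using insert by (simp add: field_simps)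
  then show ?case using S by simp
qed

section \<open>The power series of the logarithm\<close>

text \<open>The coefficient of \<open>z ^ m\<close> in \<open>Phi\<close>: the sum of \<open>1 / j\<close> over all representations \<open>m = j * p ^ k\<close>.\<close>

definition phi_coeff :: "nat \<Rightarrow> nat \<Rightarrow> real" where
  "phi_coeff k m = (\<Sum>p | p \<le> m \<and> prime p \<and> p ^ k dvd m. real (p ^ k) / real m)"

lemma phi_coeff_nonneg: "phi_coeff k m \<ge> 0"
  unfolding phi_coeff_def by (intro sum_nonneg) auto

lemma phi_coeff_le: "phi_coeff k m \<le> real m"
proof -
  have "phi_coeff k m \<le> (\<Sum>p | p \<le> m \<and> prime p \<and> p ^ k dvd m. 1)"
    unfolding phi_coeff_def
    by (intro sum_mono) (auto simp: divide_le_eq_1 dest: dvd_imp_le)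
  also have "\<dots> = real (card {p. p \<le> m \<and> prime p \<and> p ^ k dvd m})" by simp
  also have "card {p. p \<le> m \<and> prime p \<and> p ^ k dvd m} \<le> card {1..m}"
    by (intro card_mono) (auto simp: Suc_le_eq prime_gt_0_nat)
  finally show ?thesis by simp
qed

lemma phi_coeff_prime_power:
  assumes "prime p" "k \<ge> 1"
  shows "phi_coeff k (p ^ k) \<ge> 1"
proof -
  have "p ^ 1 \<le> p ^ k" using assms prime_gt_0_nat[OF assms(1)] by (intro power_increasing) auto
  then have "(\<Sum>q\<in>{p}. real (q ^ k) / real (p ^ k)) \<le> phi_coeff k (p ^ k)"
    unfolding phi_coeff_def using assms by (intro sum_mono2) auto
  then show ?thesis using assms by (simp add: prime_gt_0_nat)
qed

text \<open>Pairs (j, p) correspond to pairs (m, p) with p^k dividing m via m = (j+1) p^k, and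
  1/(j+1) = p^k/m. The function \<open>g\<close> is arbitrary because both the power series (g m =
  z^m) and a Dirichlet series (g m = m^(-\<beta>)) are regrouped this way.\<close>

lemma phi_coeff_regroup:
  fixes g :: "nat \<Rightarrow> 'a :: real_normed_field"
  assumes "((\<lambda>(j, p). g (Suc j * p ^ k) / of_nat (Suc j)) has_sum S) (UNIV \<times> {p. prime p})" "k \<ge> 1"
  shows "((\<lambda>m. of_real (phi_coeff k m) * g m) has_sum S) UNIV"
proof -
  define D where "D m = {p::nat. p \<le> m \<and> prime p \<and> p ^ k dvd m}" for m
  define h where "h = (\<lambda>(m, p). of_real (real (p ^ k) / real m) * g m)"
  have pk: "p \<le> p ^ k" "p ^ k > 0" if "prime p" for p :: nat
    using power_increasing[of 1 k p] prime_gt_0_nat[OF that] assms(2) by auto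
  have "(h has_sum S) (Sigma UNIV D) \<longleftrightarrow>
        ((\<lambda>(j, p). g (Suc j * p ^ k) / of_nat (Suc j)) has_sum S) (UNIV \<times> {p. prime p})"
  proof (rule has_sum_reindex_bij_witness[of _ "\<lambda>(j, p). (Suc j * p ^ k, p)" "\<lambda>(m, p). (m div p ^ k - 1, p)"])
    fix x assume x: "x \<in> Sigma UNIV D"
    obtain m p where mp: "x = (m, p)" by (cases x)
    have p: "p \<le> m" "prime p" "p ^ k dvd m" using x mp by (auto simp: D_def)
    have m0: "m > 0" using p prime_gt_0_nat[of p] by auto
    from p(3) obtain c where c: "m = p ^ k * c" by (auto elim: dvdE)
    then obtain c' where c0: "c = Suc c'" using m0 by (cases c) auto
    have dv: "m div p ^ k = c" using c pk[OF p(2)] by simp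
    show "(case case x of (m, p) \<Rightarrow> (m div p ^ k - 1, p) of (j, p) \<Rightarrow> (Suc j * p ^ k, p)) = x"
      using mp c c0 dv by (simp add: mult.commute)
    show "(case x of (m, p) \<Rightarrow> (m div p ^ k - 1, p)) \<in> UNIV \<times> {p. prime p}" using mp p by simp
    show "(case case x of (m, p) \<Rightarrow> (m div p ^ k - 1, p) of (j, p) \<Rightarrow> g (Suc j * p ^ k) / of_nat (Suc j)) = h x"
    proof -
      have "m = Suc c' * p ^ k" using c c0 by (simp add: mult.commute)
      moreover have "of_real (real (p ^ k) / real (Suc c' * p ^ k)) = 1 / (of_nat (Suc c') :: 'a)"
      proof -
        have "real (p ^ k) / real (Suc c' * p ^ k) = 1 / real (Suc c')"
          unfolding of_nat_mult using pk(2)[OF p(2)] by (simp del: of_nat_Suc)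
        then show ?thesis by (simp only: of_real_divide of_real_1 of_real_of_nat_eq)
      qed
      ultimately show ?thesis using mp dv c0 by (simp only: h_def prod.case diff_Suc_1 mult.commute) simp
    qed
  next
    fix y :: "nat \<times> nat" assume y: "y \<in> UNIV \<times> {p. prime p}"
    obtain j p where jp: "y = (j, p)" by (cases y)
    have p: "prime p" using y jp by simp
    show "(case case y of (j, p) \<Rightarrow> (Suc j * p ^ k, p) of (m, p) \<Rightarrow> (m div p ^ k - 1, p)) = y"
      using jp pk[OF p] by simp
    have "p \<le> Suc j * p ^ k" using pk(1)[OF p] by simp
    then show "(case y of (j, p) \<Rightarrow> (Suc j * p ^ k, p)) \<in> Sigma UNIV D" 
      using jp p by (simp add: D_def)
  qed simp
  then have H: "(h has_sum S) (Sigma UNIV D)" using assms by simp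
  show ?thesis
  proof (rule has_sum_SigmaD[OF H])
    fix m :: nat
    have "finite (D m)" by (rule finite_subset[of _ "{..m}"]) (auto simp: D_def)
    then have "((\<lambda>p. h (m, p)) has_sum (\<Sum>p\<in>D m. h (m, p))) (D m)" by (rule has_sum_finite)
    also have "(\<Sum>p\<in>D m. h (m, p)) = of_real (phi_coeff k m) * g m"
      by (simp add: h_def phi_coeff_def D_def sum_distrib_right)
    finally show "((\<lambda>p. h (m, p)) has_sum of_real (phi_coeff k m) * g m) (D m)" .
  qed
qed

lemma abs_summable_on_product_bound:
  fixes f :: "'i \<times> 'j \<Rightarrow> 'a :: banach"
  assumes "u summable_on A" "v summable_on B"
    and "\<And>x y. x \<in> A \<Longrightarrow> y \<in> B \<Longrightarrow> norm (f (x, y)) \<le> u x * v y"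
    and "\<And>x. x \<in> A \<Longrightarrow> u x \<ge> (0 :: real)" "\<And>y. y \<in> B \<Longrightarrow> v y \<ge> (0 :: real)"
  shows "(\<lambda>x. norm (f x)) summable_on A \<times> B"
proof (rule Infinite_Sum.abs_summable_on_comparison_test)
  show "(\<lambda>x. norm (case x of (x, y) \<Rightarrow> u x * v y)) summable_on A \<times> B"
    unfolding Infinite_Sum.abs_summable_on_Sigma_iff
  proof (intro conjI ballI)
    fix x assume x: "x \<in> A"
    have "(\<lambda>y. u x * v y) summable_on B" using assms(2) by (rule summable_on_cmult_right)
    then show "(\<lambda>y. norm (case (x, y) of (x, y) \<Rightarrow> u x * v y)) summable_on B"
      unfolding prod.case by (rule summable_on_iff_abs_summable_on_real[THEN iffD1])
  next
    have "(\<lambda>x. u x * infsum v B) summable_on A" using assms(1) by (rule summable_on_cmult_left)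
    then have "(\<lambda>x. norm (u x * infsum v B)) summable_on A"
      by (rule summable_on_iff_abs_summable_on_real[THEN iffD1])
    moreover have "(\<Sum>\<^sub>\<infinity>y\<in>B. norm (case (x, y) of (x, y) \<Rightarrow> u x * v y)) = u x * infsum v B" if "x \<in> A" for x
    proof -
      have "(\<Sum>\<^sub>\<infinity>y\<in>B. norm (case (x, y) of (x, y) \<Rightarrow> u x * v y)) = (\<Sum>\<^sub>\<infinity>y\<in>B. u x * v y)"
        using that assms by (intro infsum_cong) simp
      also have "\<dots> = u x * infsum v B" by (rule infsum_cmult_right')
      finally show ?thesis .
    qed
    ultimately show "(\<lambda>x. norm (\<Sum>\<^sub>\<infinity>y\<in>B. norm (case (x, y) of (x, y) \<Rightarrow> u x * v y))) summable_on A"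
      by (subst summable_on_cong[of A _ "\<lambda>x. norm (u x * infsum v B)"]) auto
  qed
  fix z assume "z \<in> A \<times> B"
  then show "norm (f z) \<le> norm (case z of (x, y) \<Rightarrow> u x * v y)"
    using assms by (cases z) auto
qed

lemma geometric_summable_on:
  fixes r :: real
  assumes "0 \<le> r" "r < 1"
  shows "(\<lambda>n::nat. r ^ n) summable_on A"
proof (rule summable_on_subset_banach)
  show "(\<lambda>n::nat. r ^ n) summable_on UNIV"
    by (rule norm_summable_imp_summable_on) (use assms in \<open>simp add: summable_geometric\<close>)
qed simp

lemma phi_terms_abs_summable:
  fixes z :: "'a :: {real_normed_field, banach}"
  assumes "norm z < 1" "k \<ge> 1"
  shows "(\<lambda>x. norm (case x of (j, p) \<Rightarrow> z ^ (Suc j * p ^ k) / of_nat (Suc j))) summable_on (UNIV \<times> {p. prime p})"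
proof (rule abs_summable_on_product_bound)
  show "(\<lambda>j::nat. norm z ^ j) summable_on UNIV" "(\<lambda>j::nat. norm z ^ j) summable_on {p. prime p}"
    using assms by (auto intro: geometric_summable_on)
  fix j p :: nat assume "p \<in> {p. prime p}"
  then have p: "p \<ge> 1" by (simp add: Suc_le_eq prime_gt_0_nat)
  then have "p ^ 1 \<le> p ^ k" using assms by (intro power_increasing) auto
  then have "Suc j * p \<le> Suc j * p ^ k" by (intro mult_left_mono) auto
  moreover have "j + p \<le> Suc j * p" using mult_le_mono2[OF p, of j] by simp
  \<comment> \<open>This inequality decouples the indices: the terms are dominated by |z|^j |z|^p, a
    product of two geometric series.\<close>
  ultimately have le: "j + p \<le> Suc j * p ^ k" by (rule order.trans[rotated])
  have "norm (z ^ (Suc j * p ^ k) / of_nat (Suc j)) = norm z ^ (Suc j * p ^ k) / real (Suc j)"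
    by (simp only: norm_divide norm_power norm_of_nat)
  also have "\<dots> \<le> norm z ^ (Suc j * p ^ k) / 1" by (intro divide_left_mono) auto
  also have "\<dots> \<le> norm z ^ (j + p)" using le assms by (simp only: div_by_1) (intro power_decreasing, auto)
  finally show "norm (case (j, p) of (j, p) \<Rightarrow> z ^ (Suc j * p ^ k) / of_nat (Suc j)) \<le> norm z ^ j * norm z ^ p"
    by (simp add: power_add)
qed auto

text \<open>Polymorphic so that one definition covers the real axis and the circle; on [0,1) it
  agrees with the double series \<open>Phi\<close>.\<close>

definition PhiC :: "nat \<Rightarrow> 'a \<Rightarrow> 'a :: {real_normed_field, banach}" where
  "PhiC k z = (\<Sum>m. of_real (phi_coeff k m) * z ^ m)"

lemma PhiC_has_sum_terms:
  fixes z :: "'a :: {real_normed_field, banach}"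
  assumes "norm z < 1" "k \<ge> 1"
  shows "((\<lambda>(j, p). z ^ (Suc j * p ^ k) / of_nat (Suc j)) has_sum PhiC k z) (UNIV \<times> {p. prime p})"
proof -
  obtain S where S: "((\<lambda>(j, p). z ^ (Suc j * p ^ k) / of_nat (Suc j)) has_sum S) (UNIV \<times> {p. prime p})"
    using abs_summable_summable[OF phi_terms_abs_summable[OF assms]] by (auto simp: summable_on_def)
  from phi_coeff_regroup[of "\<lambda>m. z ^ m", OF S assms(2)]
  have "(\<lambda>m. of_real (phi_coeff k m) * z ^ m) sums S" by (rule has_sum_imp_sums)
  then have "S = PhiC k z" by (simp add: PhiC_def sums_iff)
  then show ?thesis using S by simp
qed

text \<open>Summing over j first turns the inner series into the logarithm series of w = z^(p^k);
  since |w| < 1, the principal branch is the right one.\<close>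

lemma PhiC_has_sum_primes:
  fixes z :: complex
  assumes "norm z < 1" "k \<ge> 1"
  shows "((\<lambda>p. - Ln (1 - z ^ (p ^ k))) has_sum PhiC k z) {p. prime p}"
proof -
  have "((\<lambda>(p, j). z ^ (Suc j * p ^ k) / of_nat (Suc j)) has_sum PhiC k z) ({p. prime p} \<times> UNIV)"
    using PhiC_has_sum_terms[OF assms]
    by (subst (asm) has_sum_reindex_bij_witness[of _ prod.swap prod.swap, where h = "\<lambda>(p, j). z ^ (Suc j * p ^ k) / of_nat (Suc j)" and T = "{p. prime p} \<times> UNIV"]) auto
  then show ?thesis
  proof (rule has_sum_SigmaD)
    fix p :: nat assume p: "p \<in> {p. prime p}"
    define w where "w = z ^ (p ^ k)"
    have "p ^ k > 0" using p by (simp add: prime_gt_0_nat)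
    then have w: "norm w < 1" using assms unfolding w_def by (simp add: norm_power power_less_one_iff)
    have "(\<lambda>n. - ((- (- w)) ^ n) / of_nat n) sums ln (1 + (- w))" by (rule Ln_series') (use w in simp)
    then have "(\<lambda>n. - (- (w ^ n) / of_nat n)) sums - ln (1 - w)"
      by (intro sums_minus) simp
    then have "(\<lambda>n. w ^ Suc n / of_nat (Suc n)) sums - ln (1 - w)"
      by (subst sums_Suc_iff) simp
    moreover have "summable (\<lambda>n. norm (w ^ Suc n / of_nat (Suc n)))"
    proof (rule summable_comparison_test)
      show "\<exists>N. \<forall>n\<ge>N. norm (norm (w ^ Suc n / of_nat (Suc n))) \<le> norm w ^ n"
      proof (intro exI allI impI)
        fix n
        have "norm (w ^ Suc n / of_nat (Suc n)) = norm w ^ Suc n / real (Suc n)"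
          by (simp only: norm_divide norm_power norm_of_nat)
        also have "\<dots> \<le> norm w ^ Suc n / 1" by (intro divide_left_mono) auto
        also have "\<dots> \<le> norm w ^ n" using w by (simp only: div_by_1) (intro power_decreasing, auto)
        finally show "norm (norm (w ^ Suc n / of_nat (Suc n))) \<le> norm w ^ n" by simp
      qed
    qed (use w in \<open>simp add: summable_geometric\<close>)
    ultimately have "((\<lambda>n. w ^ Suc n / of_nat (Suc n)) has_sum - Ln (1 - w)) UNIV"
      by (rule norm_summable_imp_has_sum[rotated])
    moreover have "w ^ Suc n = z ^ (Suc n * p ^ k)" for n
      unfolding w_def power_mult[symmetric] by (simp only: mult.commute)
    ultimately show "((\<lambda>j. case (p, j) of (p, j) \<Rightarrow> z ^ (Suc j * p ^ k) / of_nat (Suc j)) has_sum - Ln (1 - z ^ (p ^ k))) UNIV"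
      by (simp add: w_def)
  qed
qed

lemma Phi_eq_PhiC:
  assumes "0 \<le> r" "r < 1" "k \<ge> 1"
  shows "Phi k r = PhiC k r"
proof -
  have H: "((\<lambda>(j, p). r ^ (Suc j * p ^ k) / of_nat (Suc j)) has_sum PhiC k r) (UNIV \<times> {p. prime p})"
    using assms by (intro PhiC_has_sum_terms) auto
  have "(\<lambda>j. \<Sum>p. if prime p then r ^ (Suc j * p ^ k) / real (Suc j) else 0) sums PhiC k r"
  proof (rule has_sum_imp_sums, rule has_sum_SigmaD[OF H])
    fix j :: nat
    have "(\<lambda>p. r ^ (Suc j * p ^ k) / of_nat (Suc j)) summable_on {p. prime p}"
      using summable_on_SigmaD1[of "\<lambda>j p. r ^ (Suc j * p ^ k) / of_nat (Suc j)" UNIV "\<lambda>_. {p. prime p}" j] H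
      by (auto simp: summable_on_def)
    then obtain S where S: "((\<lambda>p. r ^ (Suc j * p ^ k) / of_nat (Suc j)) has_sum S) {p. prime p}"
      by (auto simp: summable_on_def)
    then have "((\<lambda>p. if prime p then r ^ (Suc j * p ^ k) / of_nat (Suc j) else 0) has_sum S) UNIV"
      by (subst has_sum_cong_neutral[where g = "\<lambda>p. r ^ (Suc j * p ^ k) / of_nat (Suc j)" and T = "{p. prime p}"]) auto
    then have "(\<lambda>p. if prime p then r ^ (Suc j * p ^ k) / of_nat (Suc j) else 0) sums S"
      by (rule has_sum_imp_sums)
    then show "((\<lambda>p. case (j, p) of (j, p) \<Rightarrow> r ^ (Suc j * p ^ k) / of_nat (Suc j)) has_sum
          (\<Sum>p. if prime p then r ^ (Suc j * p ^ k) / real (Suc j) else 0)) {p. prime p}"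
      using S by (simp add: sums_iff)
  qed
  then show ?thesis by (simp add: Phi_def sums_iff)
qed

lemma prime_partial_sums_tendsto_PhiC:
  fixes z :: complex
  assumes "norm z < 1" "k \<ge> 1"
  shows "(\<lambda>P. \<Sum>p | prime p \<and> p < P. - Ln (1 - z ^ (p ^ k))) \<longlonglongrightarrow> PhiC k z"
proof -
  have "((\<lambda>p. if prime p then - Ln (1 - z ^ (p ^ k)) else 0) has_sum PhiC k z) UNIV"
    using PhiC_has_sum_primes[OF assms]
    by (subst has_sum_cong_neutral[where g = "\<lambda>p. - Ln (1 - z ^ (p ^ k))" and T = "{p. prime p}"]) auto
  then have "(\<lambda>P. \<Sum>p<P. if prime p then - Ln (1 - z ^ (p ^ k)) else 0) \<longlonglongrightarrow> PhiC k z"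
    using has_sum_imp_sums unfolding sums_def by blast
  moreover have "(\<Sum>p<P. if prime p then - Ln (1 - z ^ (p ^ k)) else 0) = (\<Sum>p | prime p \<and> p < P. - Ln (1 - z ^ (p ^ k)))" for P
    by (subst sum.inter_filter[symmetric]) (auto intro!: sum.cong)
  ultimately show ?thesis by simp
qed

lemma PhiC_of_real: "norm r < 1 \<Longrightarrow> k \<ge> 1 \<Longrightarrow> PhiC k (of_real r :: complex) = of_real (PhiC k r)" for r :: real
proof -
  assume a: "norm r < 1" "k \<ge> 1"
  have "(\<lambda>m. phi_coeff k m * r ^ m) sums PhiC k r"
    using has_sum_imp_sums[OF phi_coeff_regroup[of "\<lambda>m. r ^ m", OF PhiC_has_sum_terms[OF a] a(2)]] by simp
  then have "(\<lambda>m. complex_of_real (phi_coeff k m * r ^ m)) sums of_real (PhiC k r)" by (rule sums_of_real)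
  then show ?thesis by (simp add: PhiC_def[of k "of_real r"] sums_iff)
qed

lemma prime_power_product_tendsto_exp_PhiC:
  fixes z :: complex
  assumes "norm z < 1" "k \<ge> 1"
  shows "(\<lambda>P. \<Prod>p | prime p \<and> p < P. 1 / (1 - z ^ (p ^ k))) \<longlonglongrightarrow> exp (PhiC k z)"
proof -
  have "(\<Prod>p | prime p \<and> p < P. 1 / (1 - z ^ (p ^ k))) = exp (\<Sum>p | prime p \<and> p < P. - Ln (1 - z ^ (p ^ k)))" for P
  proof -
    have "1 / (1 - z ^ (p ^ k)) = exp (- Ln (1 - z ^ (p ^ k)))" if "prime p" for p
    proof -
      have "norm (z ^ (p ^ k)) < 1" using assms that prime_gt_0_nat[of p] by (simp add: norm_power power_less_one_iff)
      then have "1 - z ^ (p ^ k) \<noteq> 0" by auto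
      then show ?thesis by (simp add: exp_minus divide_inverse)
    qed
    then show ?thesis by (subst exp_sum) (auto intro!: prod.cong)
  qed
  then show ?thesis using prime_partial_sums_tendsto_PhiC[OF assms] by (simp add: tendsto_exp)
qed

lemma prime_power_product_tendsto_exp_PhiC_real:
  fixes r :: real
  assumes "norm r < 1" "k \<ge> 1"
  shows "(\<lambda>P. \<Prod>p | prime p \<and> p < P. 1 / (1 - r ^ (p ^ k))) \<longlonglongrightarrow> exp (PhiC k r)"
proof -
  have "(\<lambda>P. of_real (\<Prod>p | prime p \<and> p < P. 1 / (1 - r ^ (p ^ k))) :: complex) \<longlonglongrightarrow> of_real (exp (PhiC k r))"
    using prime_power_product_tendsto_exp_PhiC[of "of_real r" k] assms PhiC_of_real[OF assms]
    by (simp add: exp_of_real)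
  then show ?thesis by (simp only: tendsto_of_real_iff)
qed

lemma Psi_eq_exp_PhiC:
  assumes "0 \<le> r" "r < 1" "k \<ge> 1"
  shows "Psi k r = exp (PhiC k r)"
proof -
  have "(\<lambda>n. \<Prod>m\<le>n. if prime m then 1 / (1 - r ^ (m ^ k)) else 1) = 
        (\<lambda>n. \<Prod>p | prime p \<and> p < Suc n. 1 / (1 - r ^ (p ^ k)))"
  proof
    fix n
    show "(\<Prod>m\<le>n. if prime m then 1 / (1 - r ^ (m ^ k)) else 1) = (\<Prod>p | prime p \<and> p < Suc n. 1 / (1 - r ^ (p ^ k)))"
      by (subst prod.inter_filter[symmetric]) (auto intro!: prod.cong)
  qed
  moreover have "(\<lambda>n. \<Prod>p | prime p \<and> p < Suc n. 1 / (1 - r ^ (p ^ k))) \<longlonglongrightarrow> exp (PhiC k r)"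
    using prime_power_product_tendsto_exp_PhiC_real[of r k] assms by (intro LIMSEQ_Suc) simp
  \<comment> \<open>\<open>has_prod\<close> demands a nonzero limit of the partial products, which
    an exponential always is.\<close>
  ultimately have "(\<lambda>m. if prime m then 1 / (1 - r ^ (m ^ k)) else 1) has_prod exp (PhiC k r)"
    unfolding has_prod_def raw_has_prod_def add_0_right by simp
  then show ?thesis unfolding Psi_def by (rule has_prod_unique[symmetric])
qed

section \<open>Partition numbers as coefficients of exp \<Phi>\<close>

lemma pP_eq_num_parts: "pP k n = num_parts (primePows k) n"
  unfolding pP_def num_parts_def parts_in_def ..

text \<open>A part p^k <= n has p <= p^k <= n < P, so truncating the primes at P does not affect the
  count for n.\<close>

lemma pP_eq_num_parts_finite:
  assumes "n < P" "k \<ge> 1"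
  shows "pP k n = num_parts ((\<lambda>p. p ^ k) ` {p. prime p \<and> p < P}) n"
proof -
  have "p < P" if "prime p" "p ^ k \<le> n" for p :: nat
  proof -
    have "p ^ 1 \<le> p ^ k" using assms prime_gt_0_nat[OF that(1)] by (intro power_increasing) auto
    then show ?thesis using that assms by simp
  qed
  then have "primePows k \<inter> {..n} = (\<lambda>p. p ^ k) ` {p. prime p \<and> p < P} \<inter> {..n}"
    by (auto simp: primePows_def)
  then show ?thesis
    unfolding pP_eq_num_parts by (metis num_parts_restrict order_refl)
qed

lemma prod_prime_powers_reindex:
  assumes "k \<ge> 1"
  shows "(\<Prod>a\<in>(\<lambda>p::nat. p ^ k) ` {p. prime p \<and> p < P}. f a) = (\<Prod>p | prime p \<and> p < P. f (p ^ k))"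
  using assms by (subst prod.reindex) (auto simp: inj_on_def intro: power_eq_imp_eq_base)

lemma pP_partial_sum_le:
  assumes "0 \<le> r" "r < (1::real)" "k \<ge> 1"
  shows "(\<Sum>m<n. real (pP k m) * r ^ m) \<le> exp (PhiC k r)"
proof -
  define F where "F P = (\<Prod>p | prime p \<and> p < P. 1 / (1 - r ^ (p ^ k)))" for P
  have lim: "F \<longlonglongrightarrow> exp (PhiC k r)"
    unfolding F_def using assms by (intro prime_power_product_tendsto_exp_PhiC_real) auto
  have "(\<Sum>m<n. real (pP k m) * r ^ m) \<le> F P" if "P \<ge> n" for P
  proof -
    have "(\<Sum>m<n. real (pP k m) * r ^ m) = (\<Sum>m<n. real (num_parts ((\<lambda>p. p ^ k) ` {p. prime p \<and> p < P}) m) * r ^ m)"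
      using that assms by (intro sum.cong) (auto simp: pP_eq_num_parts_finite[where P = P])
    also have "\<dots> \<le> (\<Prod>a\<in>(\<lambda>p. p ^ k) ` {p. prime p \<and> p < P}. 1 / (1 - r ^ a))"
      using assms by (intro num_parts_partial_sum_le) auto
    finally show ?thesis unfolding F_def using assms by (simp add: prod_prime_powers_reindex)
  qed
  then show ?thesis using lim by (intro tendsto_lowerbound[OF lim]) (auto simp: eventually_at_top_linorder)
qed

lemma pP_summable_norm:
  fixes z :: complex
  assumes "norm z < 1" "k \<ge> 1"
  shows "summable (\<lambda>n. norm (of_nat (pP k n) * z ^ n))"
proof (rule bounded_imp_summable)
  show "(\<Sum>i\<le>n. norm (of_nat (pP k i) * z ^ i)) \<le> exp (PhiC k (norm z))" for n
    using pP_partial_sum_le[of "norm z" k "Suc n"] assms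
    by (simp add: norm_mult norm_power lessThan_Suc_atMost)
qed auto

lemma pP_finite_le:
  assumes "k \<ge> 1"
  shows "num_parts ((\<lambda>p. p ^ k) ` {p. prime p \<and> p < P}) n \<le> pP k n"
proof -
  have "pP k n = num_parts ((\<lambda>p. p ^ k) ` {p. prime p \<and> p < max P (Suc n)}) n"
    using assms by (intro pP_eq_num_parts_finite) auto
  also have "num_parts ((\<lambda>p. p ^ k) ` {p. prime p \<and> p < P}) n \<le> \<dots>"
    unfolding num_parts_def
    by (intro card_mono finite_parts_in) (auto simp: parts_in_def subset_iff)
  finally show ?thesis by simp
qed

text \<open>The products over p < P are generating functions for finite sets of parts. Their
  coefficients are eventually equal to, and always at most, those of \<open>pP\<close>, so Tannery's
  theorem passes to the limit.\<close>

lemma pP_sums: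
  fixes z :: complex
  assumes "norm z < 1" "k \<ge> 1"
  shows "(\<lambda>n. of_nat (pP k n) * z ^ n) sums exp (PhiC k z)"
proof -
  define A where "A P = (\<lambda>p::nat. p ^ k) ` {p. prime p \<and> p < P}" for P
  have A: "finite (A P)" "0 \<notin> A P" for P by (auto simp: A_def)
  have "(\<lambda>P. \<Sum>n. of_nat (num_parts (A P) n) * z ^ n) \<longlonglongrightarrow> (\<Sum>n. of_nat (pP k n) * z ^ n)"
  proof (rule tannerys_theorem[THEN conjunct2, THEN conjunct2])
    show "(\<lambda>P. of_nat (num_parts (A P) n) * z ^ n) \<longlonglongrightarrow> of_nat (pP k n) * z ^ n" for n
    proof (rule tendsto_eventually)
      show "\<forall>\<^sub>F P in sequentially. of_nat (num_parts (A P) n) * z ^ n = of_nat (pP k n) * z ^ n"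
        using eventually_gt_at_top[of n]
        by eventually_elim (use assms in \<open>simp add: pP_eq_num_parts_finite A_def\<close>)
    qed
    show "\<forall>\<^sub>F (n, P) in sequentially \<times>\<^sub>F sequentially.
            norm (of_nat (num_parts (A P) n) * z ^ n) \<le> norm (of_nat (pP k n) * z ^ n)"
    proof (rule always_eventually, clarify)
      fix n P
      have "num_parts (A P) n \<le> pP k n" unfolding A_def using assms(2) by (rule pP_finite_le)
      then show "norm (of_nat (num_parts (A P) n) * z ^ n) \<le> norm (of_nat (pP k n) * z ^ n)"
        by (simp add: norm_mult mult_right_mono)
    qed
    show "summable (\<lambda>n. norm (of_nat (pP k n) * z ^ n))" by (rule pP_summable_norm[OF assms])
  qed simp
  moreover have "(\<Sum>n. of_nat (num_parts (A P) n) * z ^ n) = (\<Prod>p | prime p \<and> p < P. 1 / (1 - z ^ (p ^ k)))" for P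
    using num_parts_sums[OF A assms(1), of P] prod_prime_powers_reindex[OF assms(2), of "\<lambda>a. 1 / (1 - z ^ a)" P]
    by (simp add: sums_iff A_def)
  ultimately have "(\<Sum>n. of_nat (pP k n) * z ^ n) = exp (PhiC k z)"
    using prime_power_product_tendsto_exp_PhiC[OF assms] LIMSEQ_unique by simp
  moreover have "summable (\<lambda>n. of_nat (pP k n) * z ^ n)"
    by (rule summable_norm_cancel[OF pP_summable_norm[OF assms]])
  ultimately show ?thesis by (simp add: sums_iff)
qed

section \<open>Logarithmic derivatives of \<Phi> and the saddle point equation\<close>

text \<open>This is (r d/dr)^i \<Phi>: i = 1 gives the saddle point equation, i = 2 the variance
  \<Phi>_(2), and i = 3 controls the Taylor remainder.\<close>

definition phi_moment :: "nat \<Rightarrow> nat \<Rightarrow> real \<Rightarrow> real" where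
  "phi_moment k i r = (\<Sum>m. real m ^ i * phi_coeff k m * r ^ m)"

lemma summable_times_index:
  fixes a :: "nat \<Rightarrow> real"
  assumes "\<And>x. \<bar>x\<bar> < 1 \<Longrightarrow> summable (\<lambda>m. a m * x ^ m)" "\<bar>x\<bar> < 1"
  shows "summable (\<lambda>m. real m * a m * x ^ m)"
proof -
  have "summable (\<lambda>n. diffs a n * x ^ n)"
    by (rule termdiff_converges[of x 1]) (use assms in auto)
  then have "summable (\<lambda>n. x * (diffs a n * x ^ n))" by (rule summable_mult)
  then have "summable (\<lambda>n. real (Suc n) * a (Suc n) * x ^ Suc n)" by (simp add: diffs_def mult_ac)
  then show ?thesis by (subst (asm) summable_Suc_iff)
qed

lemma phi_moment_summable:
  assumes "\<bar>r\<bar> < 1"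
  shows "summable (\<lambda>m. real m ^ i * phi_coeff k m * r ^ m)"
  using assms
proof (induction i arbitrary: r)
  case 0
  have "summable (\<lambda>m. real m * 1 * \<bar>r\<bar> ^ m)"
    by (rule summable_times_index) (use 0 in \<open>auto simp: summable_geometric\<close>)
  then have "summable (\<lambda>m. phi_coeff k m * r ^ m)"
  proof (rule summable_comparison_test[rotated], intro exI allI impI)
    fix m
    show "norm (phi_coeff k m * r ^ m) \<le> real m * 1 * \<bar>r\<bar> ^ m"
      using phi_coeff_nonneg[of k m] phi_coeff_le[of k m] by (simp add: abs_mult power_abs mult_right_mono)
  qed
  then show ?case by simp
next
  case (Suc i)
  have "summable (\<lambda>m. real m * (real m ^ i * phi_coeff k m) * r ^ m)"
    using Suc by (intro summable_times_index) auto
  then show ?case by (simp add: mult_ac)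
qed

lemma phi_moment_deriv:
  assumes "\<bar>r\<bar> < 1"
  obtains D where "(phi_moment k i has_real_derivative D) (at r)" "r * D = phi_moment k (Suc i) r"
proof -
  define a where "a m = real m ^ i * phi_coeff k m" for m
  define D where "D = (\<Sum>n. diffs a n * r ^ n)"
  have sm: "summable (\<lambda>m. a m * x ^ m)" if "norm x < 1" for x
    unfolding a_def using that by (intro phi_moment_summable) simp
  have "((\<lambda>z. \<Sum>n. a n * z ^ n) has_real_derivative D) (at r)"
    unfolding D_def by (rule termdiffs_strong'[of 1]) (use sm assms in auto)
  then have 1: "(phi_moment k i has_real_derivative D) (at r)"
    by (simp add: phi_moment_def[abs_def] a_def)
  have "summable (\<lambda>n. diffs a n * r ^ n)"
    by (rule termdiff_converges[of r 1]) (use sm assms in auto)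
  then have "(\<lambda>n. r * (diffs a n * r ^ n)) sums (r * D)" unfolding D_def by (intro sums_mult summable_sums)
  then have "(\<lambda>n. real (Suc n) ^ Suc i * phi_coeff k (Suc n) * r ^ Suc n) sums (r * D)"
    by (simp add: diffs_def a_def mult_ac)
  then have "(\<lambda>n. real n ^ Suc i * phi_coeff k n * r ^ n) sums (r * D)"
    by (subst (asm) sums_Suc_iff) simp
  then have "r * D = phi_moment k (Suc i) r" by (simp add: phi_moment_def sums_iff)
  with 1 show ?thesis using that by blast
qed

lemma PhiC_eq_phi_moment: "PhiC k r = phi_moment k 0 r"
  by (simp add: PhiC_def phi_moment_def)

text \<open>A derivative is local, so agreement of \<open>Phi\<close> with its power series on the
  open interval (0,1) suffices.\<close>

lemma Phi_deriv:
  assumes "0 < r" "r < 1" "k \<ge> 1"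
  shows "r * deriv (Phi k) r = phi_moment k 1 r"
proof -
  obtain D where D: "(phi_moment k 0 has_real_derivative D) (at r)" "r * D = phi_moment k 1 r"
    using phi_moment_deriv[of r k 0] assms by auto
  have "(Phi k has_real_derivative D) (at r)"
    by (rule has_field_derivative_transform_within_open[OF D(1), of "{0<..<1}"])
       (use assms in \<open>auto simp: Phi_eq_PhiC PhiC_eq_phi_moment\<close>)
  then show ?thesis using D(2) by (simp add: DERIV_imp_deriv)
qed

lemma Phi2_eq:
  assumes "0 < r" "r < 1" "k \<ge> 1"
  shows "Phi2 k r = phi_moment k 2 r"
proof -
  obtain D where D: "(phi_moment k 1 has_real_derivative D) (at r)" "r * D = phi_moment k (Suc 1) r"
    using phi_moment_deriv[of r k 1] assms by auto
  have "((\<lambda>s. s * deriv (Phi k) s) has_real_derivative D) (at r)"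
    by (rule has_field_derivative_transform_within_open[OF D(1), of "{0<..<1}"])
       (use assms Phi_deriv in auto)
  then show ?thesis using D(2) unfolding Phi2_def by (simp add: DERIV_imp_deriv numeral_2_eq_2)
qed

text \<open>Only the terms m = p^k with p <= N are kept; there the coefficient is at least 1 and s
  p^k <= 1 bounds the exponential below by exp(-1). The weight \<open>g\<close> is m^i for the
  moments and 1 - cos(m t) on the circle.\<close>

lemma phi_series_ge_prime_sum:
  assumes "k \<ge> 1" "0 \<le> s" "s * real N ^ k \<le> 1" "\<And>m. g m \<ge> 0"
    and "summable (\<lambda>m. g m * phi_coeff k m * exp (- s) ^ m)"
  shows "exp (- 1) * (\<Sum>p | prime p \<and> p \<le> N. g (p ^ k)) \<le> (\<Sum>m. g m * phi_coeff k m * exp (- s) ^ m)"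
proof -
  have "exp (- 1) * (\<Sum>p | prime p \<and> p \<le> N. g (p ^ k)) = (\<Sum>p | prime p \<and> p \<le> N. g (p ^ k) * 1 * exp (- 1))"
    by (simp add: sum_distrib_left mult_ac)
  also have "\<dots> \<le> (\<Sum>p | prime p \<and> p \<le> N. g (p ^ k) * phi_coeff k (p ^ k) * exp (- s) ^ (p ^ k))"
  proof (intro sum_mono mult_mono)
    fix p assume p: "p \<in> {p. prime p \<and> p \<le> N}"
    show "1 \<le> phi_coeff k (p ^ k)" using p assms by (intro phi_coeff_prime_power) auto
    have "s * real p ^ k \<le> s * real N ^ k" using p assms by (intro mult_left_mono power_mono) auto
    then have "exp (- 1) \<le> exp (- (s * real (p ^ k)))" using assms by simp
    also have "\<dots> = exp (- s) ^ (p ^ k)" by (simp add: exp_of_nat_mult[symmetric] mult.commute)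
    finally show "exp (- 1) \<le> exp (- s) ^ (p ^ k)" .
  qed (use assms phi_coeff_nonneg in auto)
  also have "\<dots> = (\<Sum>m\<in>(\<lambda>p. p ^ k) ` {p. prime p \<and> p \<le> N}. g m * phi_coeff k m * exp (- s) ^ m)"
    using assms by (subst sum.reindex) (auto simp: inj_on_def intro: power_eq_imp_eq_base)
  also have "\<dots> \<le> (\<Sum>m. g m * phi_coeff k m * exp (- s) ^ m)"
    using assms phi_coeff_nonneg by (intro sum_le_suminf) auto
  finally show ?thesis .
qed

lemma phi_moment_ge_prime_sum:
  assumes "k \<ge> 1" "0 < s" "s * real N ^ k \<le> 1"
  shows "exp (- 1) * (\<Sum>p | prime p \<and> p \<le> N. real p ^ (i * k)) \<le> phi_moment k i (exp (- s))"
  using phi_series_ge_prime_sum[of k s N "\<lambda>m. real m ^ i"] phi_moment_summable[of "exp (- s)" i k] assms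
  by (simp add: phi_moment_def power_mult[symmetric] mult.commute)

lemma phi_moment_pos:
  assumes "0 < r" "r < 1" "k \<ge> 1"
  shows "phi_moment k i r > 0"
proof -
  have "summable (\<lambda>m. real m ^ i * phi_coeff k m * r ^ m)" using assms by (intro phi_moment_summable) auto
  then show ?thesis unfolding phi_moment_def
  proof (rule suminf_pos2)
    have "phi_coeff k (2 ^ k) \<ge> 1" using assms by (intro phi_coeff_prime_power) auto
    then show "0 < real (2 ^ k) ^ i * phi_coeff k (2 ^ k) * r ^ 2 ^ k" using assms by simp
  qed (use assms phi_coeff_nonneg in auto)
qed

lemma phi_moment_unbounded:
  assumes "k \<ge> 1"
  shows "\<exists>r. 0 < r \<and> r < 1 \<and> phi_moment k 1 r \<ge> x"
proof -
  obtain N0 where N0: "\<And>N. N \<ge> N0 \<Longrightarrow> real (card {p. prime p \<and> p \<le> N}) \<ge> real N powr (1 / 2)"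
    using prime_count_ge_powr[of "1 / 2"] unfolding eventually_sequentially by auto
  \<comment> \<open>Makes sqrt N, a lower bound for the number of primes up to N, at least e |x|;
    the e undoes the factor exp(-1).\<close>
  define N where "N = N0 + 1 + nat \<lceil>(exp 1 * \<bar>x\<bar>)\<^sup>2\<rceil>"
  have N: "N \<ge> N0" "N \<ge> 1" "real N \<ge> (exp 1 * \<bar>x\<bar>)\<^sup>2" unfolding N_def by (auto; linarith)+
  define s where "s = 1 / real N ^ k"
  have s: "s > 0" "s * real N ^ k \<le> 1" using N by (auto simp: s_def)
  have "sqrt ((exp 1 * \<bar>x\<bar>)\<^sup>2) \<le> sqrt (real N)" using N(3) by (rule real_sqrt_le_mono)
  then have "exp 1 * \<bar>x\<bar> \<le> real N powr (1 / 2)" by (simp add: powr_half_sqrt)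
  also have "\<dots> \<le> real (card {p. prime p \<and> p \<le> N})" by (rule N0[OF N(1)])
  also have "\<dots> = (\<Sum>p | prime p \<and> p \<le> N. 1)" by simp
  also have "\<dots> \<le> (\<Sum>p | prime p \<and> p \<le> N. real p ^ (1 * k))"
    by (intro sum_mono) (auto intro!: one_le_power simp: Suc_le_eq prime_gt_0_nat)
  finally have "exp (-1) * (exp 1 * \<bar>x\<bar>) \<le> exp (-1) * (\<Sum>p | prime p \<and> p \<le> N. real p ^ (1 * k))"
    by (rule mult_left_mono) simp
  also have "\<dots> \<le> phi_moment k 1 (exp (- s))" using s assms by (intro phi_moment_ge_prime_sum) auto
  also have "exp (-1) * (exp 1 * \<bar>x\<bar>) = \<bar>x\<bar>" by (simp add: mult.assoc[symmetric] exp_add[symmetric])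
  finally have "\<bar>x\<bar> \<le> phi_moment k 1 (exp (- s))" .
  then show ?thesis using s by (intro exI[of _ "exp (- s)"]) auto
qed

text \<open>This justifies the definite description in \<open>rho\<close>: existence by the
  intermediate value theorem between 0 and a point where the first moment is at least n, uniqueness
  because r times its derivative is the positive second moment.\<close>

lemma rho_props:
  assumes "k \<ge> 1" "n \<ge> 1"
  shows "0 < rho k n" "rho k n < 1" "phi_moment k 1 (rho k n) = real n"
proof -
  have cont: "continuous_on {0..b} (phi_moment k 1)" if "b < 1" for b
  proof (rule continuous_at_imp_continuous_on, rule ballI)
    fix x assume "x \<in> {0..b}"
    then have "\<bar>x\<bar> < 1" using that by auto
    then show "isCont (phi_moment k 1) x" by (metis phi_moment_deriv DERIV_isCont)
  qed
  have mono: "phi_moment k 1 x < phi_moment k 1 y" if "0 < x" "x < y" "y < 1" for x y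
  proof (rule DERIV_pos_imp_increasing[OF that(2)])
    fix z assume z: "x \<le> z" "z \<le> y"
    then have "\<bar>z\<bar> < 1" using that by auto
    then obtain D where D: "(phi_moment k 1 has_real_derivative D) (at z)" "z * D = phi_moment k (Suc 1) z"
      by (rule phi_moment_deriv)
    have "z * D > 0" unfolding D(2) using z that assms by (intro phi_moment_pos) auto
    then have "D > 0" using z that by (simp add: zero_less_mult_iff)
    then show "\<exists>D. (phi_moment k 1 has_real_derivative D) (at z) \<and> D > 0" using D by blast
  qed
  obtain b where b: "0 < b" "b < 1" "phi_moment k 1 b \<ge> real n" using phi_moment_unbounded[OF assms(1)] by blast
  have "(\<lambda>m. real m ^ 1 * phi_coeff k m * 0 ^ m) = (\<lambda>m. 0)" by (auto simp: fun_eq_iff power_0_left)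
  then have z: "phi_moment k 1 0 = 0" unfolding phi_moment_def by simp
  have "\<exists>x\<ge>0. x \<le> b \<and> phi_moment k 1 x = real n"
    using b z by (intro IVT' cont) auto
  then obtain x where x: "0 \<le> x" "x \<le> b" "phi_moment k 1 x = real n" by blast
  have x0: "x > 0" using x z assms by (cases "x = 0") auto
  have "rho k n = x" unfolding rho_def
  proof (rule the_equality)
    show "x \<in> {0<..<1} \<and> x * deriv (Phi k) x = real n" using x x0 b assms Phi_deriv[of x k] by auto
    fix y assume y: "y \<in> {0<..<1} \<and> y * deriv (Phi k) y = real n"
    then have "phi_moment k 1 y = phi_moment k 1 x" using x assms Phi_deriv[of y k] by auto
    then show "y = x" using mono[of x y] mono[of y x] y x0 x b by (cases x y rule: linorder_cases) auto
  qed
  then show "0 < rho k n" "rho k n < 1" "phi_moment k 1 (rho k n) = real n" using x x0 b by auto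
qed

section \<open>Upper bounds for the moments near r = 1\<close>

lemma powr_le_exp:
  assumes "a > 0" "x > (0::real)"
  shows "x powr a \<le> a powr a * exp x"
proof -
  have "ln (x / a) \<le> x / a" using ln_le_minus_one[of "x / a"] assms by simp
  then have "a * ln (x / a) \<le> a * (x / a)" using assms by (intro mult_left_mono) auto
  then have "a * ln x \<le> a * ln a + x" using assms by (simp add: ln_div algebra_simps)
  then have "exp (a * ln x) \<le> exp (a * ln a + x)" by simp
  then show ?thesis using assms by (simp add: powr_def exp_add)
qed

text \<open>Ungrouped, the series factors into the sum of (j+1)^(-1-\<beta>) and the sum of
  p^(-k\<beta>). The latter converges even over all integers since k\<beta> > 1, so no upper bound
  for the number of primes is used.\<close>

lemma phi_coeff_zeta_summable:
  assumes "k \<ge> 1" "\<beta> > 1 / real k"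
  shows "summable (\<lambda>m. phi_coeff k m * real m powr (- \<beta>))"
proof -
  have b0: "\<beta> > 0" using assms by (smt (verit) divide_nonneg_nonneg of_nat_0_le_iff)
  have kb: "real k * \<beta> > 1" using assms by (simp add: field_simps)
  define f where "f = (\<lambda>(j, p). real (Suc j * p ^ k) powr (- \<beta>) / of_nat (Suc j))"
  have "(\<lambda>x. norm (f x)) summable_on UNIV \<times> {p. prime p}"
  proof (rule abs_summable_on_product_bound)
    have "summable (\<lambda>j. real (Suc j) powr (- 1 - \<beta>))"
      using b0 by (subst summable_Suc_iff) (simp add: summable_real_powr_iff)
    then show "(\<lambda>j. real (Suc j) powr (- 1 - \<beta>)) summable_on UNIV"
      by (intro norm_summable_imp_summable_on) simp
    have "summable (\<lambda>p. real p powr (- (real k * \<beta>)))" using kb by (simp add: summable_real_powr_iff)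
    then have "(\<lambda>p. real p powr (- (real k * \<beta>))) summable_on UNIV"
      by (intro norm_summable_imp_summable_on) simp
    then show "(\<lambda>p. real p powr (- (real k * \<beta>))) summable_on {p. prime p}"
      by (rule summable_on_subset_banach) simp
    fix j p :: nat assume p: "p \<in> {p. prime p}"
    then have p0: "real p > 0" by (simp add: prime_gt_0_nat)
    have "f (j, p) = (real (Suc j) * real p ^ k) powr (- \<beta>) / real (Suc j)" 
      unfolding f_def prod.case of_nat_mult of_nat_power ..
    also have "\<dots> = real (Suc j) powr (- \<beta>) / real (Suc j) * (real p ^ k) powr (- \<beta>)"
      by (subst powr_mult) (auto simp del: of_nat_Suc)
    also have "real (Suc j) powr (- \<beta>) / real (Suc j) = real (Suc j) powr (- \<beta> - 1)"
      by (simp add: powr_diff del: of_nat_Suc)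
    also have "(real p ^ k) powr (- \<beta>) = real p powr (- (real k * \<beta>))"
      using p0 by (simp add: powr_realpow[symmetric] powr_powr)
    also have "- \<beta> - 1 = - 1 - \<beta>" by simp
    finally show "norm (f (j, p)) \<le> real (Suc j) powr (- 1 - \<beta>) * real p powr (- (real k * \<beta>))"
      by simp
  qed auto
  then have "f summable_on UNIV \<times> {p. prime p}" by (rule abs_summable_summable)
  then obtain S where "(f has_sum S) (UNIV \<times> {p. prime p})" by (auto simp: summable_on_def)
  then have "((\<lambda>m. of_real (phi_coeff k m) * real m powr (- \<beta>)) has_sum S) UNIV"
    unfolding f_def by (rule phi_coeff_regroup) (use assms in auto)
  from has_sum_imp_sums[OF this] show ?thesis by (auto simp: sums_iff)
qed

text \<open>Bounding \<open>x powr (i + \<beta>) * exp (- x)\<close> by a constant at \<open>x = s * m\<close> reduces the claim to the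
  convergence of the Dirichlet series of \<open>phi_coeff\<close> at \<open>\<beta>\<close>.\<close>

lemma phi_moment_upper:
  assumes "k \<ge> 1" "\<beta> > 1 / real k"
  shows "\<exists>C>0. \<forall>s>0. phi_moment k i (exp (- s)) \<le> C * s powr (- real i - \<beta>)"
proof -
  have b0: "\<beta> > 0" using assms by (smt (verit) divide_nonneg_nonneg of_nat_0_le_iff)
  define a where "a = real i + \<beta>"
  have a: "a > 0" using b0 by (simp add: a_def)
  define S where "S = (\<Sum>m. phi_coeff k m * real m powr (- \<beta>))"
  have S0: "S \<ge> 0" unfolding S_def using phi_coeff_zeta_summable[OF assms] phi_coeff_nonneg by (intro suminf_nonneg) auto
  define C where "C = a powr a * (S + 1)"
  have C: "C > 0" using a S0 by (simp add: C_def)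
  have "phi_moment k i (exp (- s)) \<le> C * s powr (- real i - \<beta>)" if s: "s > 0" for s
  proof -
    have "real m ^ i * phi_coeff k m * exp (- s) ^ m \<le> (a powr a * s powr (- a)) * (phi_coeff k m * real m powr (- \<beta>))" for m
    proof (cases "m = 0")
      case True
      then show ?thesis by (simp add: phi_coeff_def)
    next
      case False
      have "real m ^ i = s powr (- a) * (real m powr (- \<beta>) * (s * real m) powr a)"
      proof -
        have 1: "real m ^ i = real m powr (- \<beta>) * real m powr a"
          using False by (simp add: powr_add[symmetric] a_def powr_realpow)
        have 2: "s powr (- a) * s powr a = 1" using s by (simp add: powr_add[symmetric])
        have "s powr (- a) * (real m powr (- \<beta>) * (s * real m) powr a) =
              (s powr (- a) * s powr a) * (real m powr (- \<beta>) * real m powr a)"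
          using s by (simp add: powr_mult)
        then show ?thesis by (simp only: 1 2 mult_1)
      qed
      also have "\<dots> \<le> s powr (- a) * (real m powr (- \<beta>) * (a powr a * exp (s * real m)))"
        using a s False by (intro mult_left_mono powr_le_exp) auto
      finally have "real m ^ i * (phi_coeff k m * exp (- s) ^ m) \<le>
             s powr (- a) * (real m powr (- \<beta>) * (a powr a * exp (s * real m))) * (phi_coeff k m * exp (- s) ^ m)"
        using phi_coeff_nonneg by (intro mult_right_mono) auto
      also have "\<dots> = (a powr a * s powr (- a)) * (phi_coeff k m * real m powr (- \<beta>)) * (exp (s * real m) * exp (- s) ^ m)"
        by (simp add: mult_ac)
      also have "exp (s * real m) * exp (- s) ^ m = 1"
        unfolding exp_of_nat_mult[symmetric] by (simp add: exp_add[symmetric])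
      finally show ?thesis by (simp add: mult_ac)
    qed
    then have "phi_moment k i (exp (- s)) \<le> (\<Sum>m. (a powr a * s powr (- a)) * (phi_coeff k m * real m powr (- \<beta>)))"
      unfolding phi_moment_def using phi_moment_summable[of "exp (- s)" i k] s
      by (intro suminf_le summable_mult phi_coeff_zeta_summable[OF assms]) auto
    also have "\<dots> = (a powr a * s powr (- a)) * S"
      unfolding S_def by (rule suminf_mult[OF phi_coeff_zeta_summable[OF assms]])
    also have "\<dots> \<le> (a powr a * s powr (- a)) * (S + 1)" by (intro mult_left_mono) auto
    finally show ?thesis by (simp add: C_def a_def mult_ac)
  qed
  then show ?thesis using C by blast
qed

section \<open>The saddle point\<close>

lemma has_integral_iexp_int:
  fixes j :: int
  shows "((\<lambda>t. exp (\<i> * of_int j * of_real t)) has_integral (if j = 0 then 2 * of_real pi else 0)) {- pi..pi}"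
proof (cases "j = 0")
  case True
  show ?thesis
    using True has_integral_const_real[of "1 :: complex" "- pi" pi] by (simp add: scaleR_conv_of_real)
next
  case False
  define F where "F t = exp (\<i> * of_int j * of_real t) / (\<i> * of_int j)" for t :: real
  have d: "(F has_vector_derivative exp (\<i> * of_int j * of_real t)) (at t within {- pi..pi})" for t
    unfolding F_def
    by (rule has_vector_derivative_real_field) (use False in \<open>auto intro!: derivative_eq_intros\<close>)
  have "((\<lambda>t. exp (\<i> * of_int j * of_real t)) has_integral F pi - F (- pi)) {- pi..pi}"
    by (rule fundamental_theorem_of_calculus) (use d in auto)
  moreover have "exp (\<i> * of_int j * of_real pi) = exp (\<i> * of_int j * of_real (- pi))"
  proof -
    have "\<i> * of_int j * of_real pi = \<i> * of_int j * of_real (- pi) + \<i> * (of_int j * (of_real pi * 2))"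
      by (simp add: algebra_simps)
    then show ?thesis using exp_plus_2pin[of "\<i> * of_int j * of_real (- pi)" j] by (simp add: mult_ac)
  qed
  ultimately show ?thesis using False by (simp add: F_def)
qed

text \<open>Cauchy's coefficient formula in real form: on the circle the series converges uniformly
  by the Weierstrass test and is integrated term by term against orthogonal exponentials.\<close>

lemma coefficient_has_integral:
  fixes a :: "nat \<Rightarrow> complex" and r :: real
  assumes "summable (\<lambda>m. norm (a m) * r ^ m)" "0 < r"
    and "\<And>t. (\<lambda>m. a m * (of_real r * exp (\<i> * of_real t)) ^ m) sums F t"
  shows "((\<lambda>t. F t * exp (- \<i> * of_nat n * of_real t)) has_integral 2 * of_real pi * (a n * of_real r ^ n)) {- pi..pi}"
proof -
  define f where "f m t = a m * of_real r ^ m * exp (\<i> * of_int (int m - int n) * of_real t)" for m and t :: real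
  have f_eq: "f m t = a m * (of_real r * exp (\<i> * of_real t)) ^ m * exp (- \<i> * of_nat n * of_real t)" for m t
    unfolding f_def power_mult_distrib exp_of_nat_mult[symmetric]
    by (simp add: exp_add[symmetric] mult.assoc algebra_simps)
  have nf: "norm (f m t) = norm (a m) * r ^ m" for m t
    using assms(2) by (simp add: f_def norm_mult norm_power)
  have u: "uniform_limit {- pi..pi} (\<lambda>M t. \<Sum>m<M. f m t) (\<lambda>t. \<Sum>m. f m t) sequentially"
    by (rule Weierstrass_m_test[where M = "\<lambda>m. norm (a m) * r ^ m"]) (use assms nf in auto)
  have Ft: "(\<Sum>m. f m t) = F t * exp (- \<i> * of_nat n * of_real t)" for t
    unfolding f_eq using sums_mult2[OF assms(3)[of t], of "exp (- \<i> * of_nat n * of_real t)"] by (simp add: sums_iff)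
  have c: "continuous_on {- pi..pi} (\<lambda>t. \<Sum>m<M. f m t)" for M
    unfolding f_def by (intro continuous_intros)
  obtain I J where IJ: "\<And>M. ((\<lambda>t. \<Sum>m<M. f m t) has_integral I M) {- pi..pi}"
    "((\<lambda>t. \<Sum>m. f m t) has_integral J) {- pi..pi}" "(I \<longlongrightarrow> J) sequentially"
    by (rule uniform_limit_integral[OF u c]) auto
  have If: "(f m has_integral (if m = n then 2 * of_real pi * (a n * of_real r ^ n) else 0)) {- pi..pi}" for m
    using has_integral_mult_right[OF has_integral_iexp_int[of "int m - int n"], of "a m * of_real r ^ m"]
    unfolding f_def by (auto split: if_splits simp: mult_ac)
  have "I M = 2 * of_real pi * (a n * of_real r ^ n)" if "M > n" for M
  proof -
    have "((\<lambda>t. \<Sum>m<M. f m t) has_integral (\<Sum>m<M. if m = n then 2 * of_real pi * (a n * of_real r ^ n) else 0)) {- pi..pi}"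
      by (rule has_integral_sum) (use If in auto)
    then have "I M = (\<Sum>m<M. if m = n then 2 * of_real pi * (a n * of_real r ^ n) else 0)"
      using IJ(1) has_integral_unique by blast
    then show ?thesis using that by simp
  qed
  then have "eventually (\<lambda>M. I M = 2 * of_real pi * (a n * of_real r ^ n)) sequentially"
    by (rule eventually_mono[OF eventually_gt_at_top[of n]])
  then have "I \<longlonglongrightarrow> 2 * of_real pi * (a n * of_real r ^ n)" by (rule tendsto_eventually)
  then have "J = 2 * of_real pi * (a n * of_real r ^ n)" using IJ(3) LIMSEQ_unique by blast
  then show ?thesis using IJ(2) unfolding Ft by simp
qed

definition circle_pt :: "real \<Rightarrow> real \<Rightarrow> complex" where
  "circle_pt r t = of_real r * exp (\<i> * of_real t)"

lemma norm_circle_pt: "0 \<le> r \<Longrightarrow> norm (circle_pt r t) = r"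
  by (simp add: circle_pt_def norm_mult)

lemma circle_pt_power: "circle_pt r t ^ m = of_real (r ^ m) * iexp (real m * t)"
  unfolding circle_pt_def power_mult_distrib exp_of_nat_mult[symmetric]
  by (simp add: mult_ac)

lemma pP_has_integral:
  assumes "0 < r" "r < 1" "k \<ge> 1"
  shows "((\<lambda>t. exp (PhiC k (circle_pt r t)) * exp (- \<i> * of_nat n * of_real t)) has_integral
           2 * of_real pi * of_real (real (pP k n) * r ^ n)) {- pi..pi}"
proof -
  have "((\<lambda>t. exp (PhiC k (circle_pt r t)) * exp (- \<i> * of_nat n * of_real t)) has_integral
           2 * of_real pi * (of_nat (pP k n) * of_real r ^ n)) {- pi..pi}"
  proof (rule coefficient_has_integral)
    show "summable (\<lambda>m. norm (of_nat (pP k m) :: complex) * r ^ m)"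
      using pP_summable_norm[of "of_real r" k] assms by (simp add: norm_mult norm_power)
    show "(\<lambda>m. of_nat (pP k m) * (of_real r * exp (\<i> * of_real t)) ^ m) sums exp (PhiC k (circle_pt r t))" for t
      using pP_sums[of "circle_pt r t" k] assms norm_circle_pt[of r t] by (simp add: circle_pt_def)
  qed (use assms in auto)
  then show ?thesis by simp
qed

text \<open>Multiplying the integral for index n + 1 by e^s = 1/r gives both coefficients the same
  weight r^n; the integrands then differ by the factor e^(s-it) - 1.\<close>

lemma pP_diff_has_integral:
  assumes "s > 0" "k \<ge> 1"
  defines "r \<equiv> exp (- s)"
  shows "((\<lambda>t. exp (PhiC k (circle_pt r t)) * exp (- \<i> * of_nat n * of_real t) * (exp (of_real s - \<i> * of_real t) - 1)) 
           has_integral of_real (2 * pi * ((real (pP k (n + 1)) - real (pP k n)) * r ^ n))) {- pi..pi}"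
proof -
  have r: "0 < r" "r < 1" using assms by (auto simp: r_def)
  have er: "of_real (exp s) * of_real (real x * r ^ Suc n) = of_real (real x * r ^ n)" for x
  proof -
    have "exp s * r = 1" by (simp add: r_def exp_minus)
    moreover have "exp s * (real x * r ^ Suc n) = (exp s * r) * (real x * r ^ n)" by simp
    ultimately show ?thesis by (simp only: of_real_mult[symmetric] mult_1)
  qed
  have "((\<lambda>t. of_real (exp s) * (exp (PhiC k (circle_pt r t)) * exp (- \<i> * of_nat (Suc n) * of_real t)) 
              - exp (PhiC k (circle_pt r t)) * exp (- \<i> * of_nat n * of_real t)) has_integral
          of_real (exp s) * (2 * of_real pi * of_real (real (pP k (Suc n)) * r ^ Suc n)) 
              - 2 * of_real pi * of_real (real (pP k n) * r ^ n)) {- pi..pi}"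
    by (intro has_integral_diff has_integral_mult_right pP_has_integral r assms)
  also have "of_real (exp s) * (2 * of_real pi * of_real (real (pP k (Suc n)) * r ^ Suc n)) 
              - 2 * of_real pi * of_real (real (pP k n) * r ^ n) =
             2 * of_real pi * (of_real (exp s) * of_real (real (pP k (Suc n)) * r ^ Suc n) - (of_real (real (pP k n) * r ^ n) :: complex))"
    by (simp only: right_diff_distrib mult_ac)
  also have "\<dots> = of_real (2 * pi * ((real (pP k (n + 1)) - real (pP k n)) * r ^ n))"
    unfolding er by (simp add: algebra_simps)
  also have "(\<lambda>t. of_real (exp s) * (exp (PhiC k (circle_pt r t)) * exp (- \<i> * of_nat (Suc n) * of_real t)) 
              - exp (PhiC k (circle_pt r t)) * exp (- \<i> * of_nat n * of_real t)) = 
       (\<lambda>t. exp (PhiC k (circle_pt r t)) * exp (- \<i> * of_nat n * of_real t) * (exp (of_real s - \<i> * of_real t) - 1))"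
  proof
    fix t :: real
    have "exp (- \<i> * of_nat (Suc n) * of_real t) = exp (- \<i> * of_nat n * of_real t) * exp (- \<i> * of_real t)"
      by (simp add: exp_add[symmetric] algebra_simps)
    moreover have "exp (of_real s - \<i> * of_real t) = of_real (exp s) * exp (- \<i> * of_real t)"
      by (simp add: exp_of_real[symmetric] exp_add[symmetric])
    ultimately show "of_real (exp s) * (exp (PhiC k (circle_pt r t)) * exp (- \<i> * of_nat (Suc n) * of_real t)) 
              - exp (PhiC k (circle_pt r t)) * exp (- \<i> * of_nat n * of_real t) = 
       exp (PhiC k (circle_pt r t)) * exp (- \<i> * of_nat n * of_real t) * (exp (of_real s - \<i> * of_real t) - 1)"
      by (simp add: algebra_simps)
  qed
  finally show ?thesis .
qed

section \<open>Behaviour of \<Phi> on the circle\<close>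

lemma PhiC_circle_sums:
  assumes "0 < r" "r < 1"
  shows "(\<lambda>m. of_real (phi_coeff k m * r ^ m) * iexp (real m * t)) sums PhiC k (circle_pt r t)"
proof -
  have "summable (\<lambda>m. norm (of_real (phi_coeff k m * r ^ m) * iexp (real m * t)))"
    using phi_moment_summable[of r 0 k] assms phi_coeff_nonneg by (simp add: norm_mult del: of_real_power of_real_mult)
  then have "summable (\<lambda>m. of_real (phi_coeff k m * r ^ m) * iexp (real m * t))" by (rule summable_norm_cancel)
  then show ?thesis unfolding PhiC_def circle_pt_power by (simp add: sums_iff mult_ac)
qed

lemma phi_moment_sums:
  assumes "0 < r" "r < 1"
  shows "(\<lambda>m. real m ^ i * phi_coeff k m * r ^ m) sums phi_moment k i r"
  unfolding phi_moment_def using assms by (intro summable_sums phi_moment_summable) auto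

text \<open>Each e^(imt) is expanded to second order with remainder |mt|^3 / 6; by nonnegativity of
  the coefficients these remainders add up to the third moment.\<close>

lemma PhiC_circle_taylor:
  assumes "0 < r" "r < 1"
  shows "norm (PhiC k (circle_pt r t) - of_real (PhiC k r) - \<i> * of_real (phi_moment k 1 r * t)
                + of_real (phi_moment k 2 r * t\<^sup>2 / 2)) \<le> phi_moment k 3 r * \<bar>t\<bar> ^ 3 / 6"
proof -
  define f where "f m = of_real (phi_coeff k m * r ^ m) * (iexp (real m * t) - 1 - \<i> * of_real (real m * t) + of_real ((real m * t)\<^sup>2 / 2))" for m
  have s0: "(\<lambda>m. complex_of_real (real m ^ 0 * phi_coeff k m * r ^ m)) sums of_real (phi_moment k 0 r)"
    and s1: "(\<lambda>m. complex_of_real (real m ^ 1 * phi_coeff k m * r ^ m)) sums of_real (phi_moment k 1 r)"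
    and s2: "(\<lambda>m. complex_of_real (real m ^ 2 * phi_coeff k m * r ^ m)) sums of_real (phi_moment k 2 r)"
    by (rule sums_of_real[OF phi_moment_sums[OF assms]])+
  have "(\<lambda>m. of_real (phi_coeff k m * r ^ m) * iexp (real m * t) - of_real (real m ^ 0 * phi_coeff k m * r ^ m)
            - (\<i> * of_real t) * of_real (real m ^ 1 * phi_coeff k m * r ^ m) 
            + of_real (t\<^sup>2 / 2) * of_real (real m ^ 2 * phi_coeff k m * r ^ m)) sums
        (PhiC k (circle_pt r t) - of_real (phi_moment k 0 r) - (\<i> * of_real t) * of_real (phi_moment k 1 r)
            + of_real (t\<^sup>2 / 2) * of_real (phi_moment k 2 r))"
    by (intro sums_add sums_diff sums_mult PhiC_circle_sums assms s0 s1 s2)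
  also have "(\<lambda>m. of_real (phi_coeff k m * r ^ m) * iexp (real m * t) - of_real (real m ^ 0 * phi_coeff k m * r ^ m)
            - (\<i> * of_real t) * of_real (real m ^ 1 * phi_coeff k m * r ^ m) 
            + of_real (t\<^sup>2 / 2) * of_real (real m ^ 2 * phi_coeff k m * r ^ m)) = f"
    by (simp add: f_def fun_eq_iff algebra_simps power_mult_distrib power2_eq_square)
  also have "PhiC k (circle_pt r t) - of_real (phi_moment k 0 r) - (\<i> * of_real t) * of_real (phi_moment k 1 r)
            + of_real (t\<^sup>2 / 2) * of_real (phi_moment k 2 r) = 
             PhiC k (circle_pt r t) - of_real (PhiC k r) - \<i> * of_real (phi_moment k 1 r * t)
                + of_real (phi_moment k 2 r * t\<^sup>2 / 2)"
    by (simp add: PhiC_eq_phi_moment mult_ac)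
  finally have F: "f sums (PhiC k (circle_pt r t) - of_real (PhiC k r) - \<i> * of_real (phi_moment k 1 r * t)
                + of_real (phi_moment k 2 r * t\<^sup>2 / 2))" .
  have G: "(\<lambda>m. \<bar>t\<bar> ^ 3 / 6 * (real m ^ 3 * phi_coeff k m * r ^ m)) sums (\<bar>t\<bar> ^ 3 / 6 * phi_moment k 3 r)"
    by (intro sums_mult phi_moment_sums assms)
  have le: "norm (f m) \<le> \<bar>t\<bar> ^ 3 / 6 * (real m ^ 3 * phi_coeff k m * r ^ m)" for m
  proof -
    define x where "x = real m * t"
    have eq: "(\<Sum>k\<le>2. (\<i> * complex_of_real x)^k / fact k) = 1 + \<i> * x - of_real (x\<^sup>2 / 2)"
      by (simp add: numeral_eq_Suc power_mult_distrib fact_reduce field_simps)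
    have "norm (iexp x - (\<Sum>k\<le>2. (\<i> * x)^k / fact k)) \<le> \<bar>x\<bar> ^ Suc 2 / fact (Suc 2)" by (rule iexp_approx1)
    then have n: "norm (iexp x - 1 - \<i> * of_real x + of_real (x\<^sup>2 / 2)) \<le> \<bar>x\<bar> ^ 3 / 6"
      unfolding eq by (simp add: fact_numeral algebra_simps eval_nat_numeral)
    have "norm (f m) = phi_coeff k m * r ^ m * norm (iexp x - 1 - \<i> * of_real x + of_real (x\<^sup>2 / 2))"
      unfolding f_def x_def using assms phi_coeff_nonneg by (simp add: norm_mult del: of_real_mult of_real_power)
    also have "\<dots> \<le> phi_coeff k m * r ^ m * (\<bar>x\<bar> ^ 3 / 6)"
      using n assms phi_coeff_nonneg by (intro mult_left_mono) auto
    also have "\<dots> = \<bar>t\<bar> ^ 3 / 6 * (real m ^ 3 * phi_coeff k m * r ^ m)"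
      by (simp add: x_def abs_mult power_mult_distrib)
    finally show ?thesis .
  qed
  have "norm (suminf f) \<le> (\<Sum>m. \<bar>t\<bar> ^ 3 / 6 * (real m ^ 3 * phi_coeff k m * r ^ m))"
    by (rule norm_suminf_le[OF le sums_summable[OF G]])
  then show ?thesis using F G by (simp add: sums_iff mult_ac)
qed

text \<open>All terms of this series are nonnegative, so discarding any of them gives a lower bound
  for the decay of |exp \<Phi>| off the real axis.\<close>

lemma Re_PhiC_circle:
  assumes "0 < r" "r < 1"
  shows "(\<lambda>m. (1 - cos (real m * t)) * phi_coeff k m * r ^ m) sums (PhiC k r - Re (PhiC k (circle_pt r t)))"
proof -
  have "(\<lambda>m. phi_coeff k m * r ^ m) sums PhiC k r"
    using phi_moment_sums[OF assms, of 0 k] by (simp add: PhiC_eq_phi_moment)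
  moreover have "(\<lambda>m. Re (of_real (phi_coeff k m * r ^ m) * iexp (real m * t))) sums Re (PhiC k (circle_pt r t))"
    by (rule sums_Re[OF PhiC_circle_sums[OF assms]])
  then have "(\<lambda>m. phi_coeff k m * r ^ m * cos (real m * t)) sums Re (PhiC k (circle_pt r t))"
    by (simp add: Re_exp del: of_real_mult)
  ultimately show ?thesis using sums_diff by (fastforce simp: algebra_simps)
qed

section \<open>Gaussian integrals and the saddle point estimate\<close>

lemma gaussian_has_integral:
  assumes "b > 0"
  shows "((\<lambda>t. exp (- (b * t\<^sup>2 / 2))) has_integral sqrt (2 * pi / b)) UNIV"
proof -
  define \<sigma> where "\<sigma> = 1 / sqrt b"
  have s: "\<sigma> > 0" "\<sigma>\<^sup>2 = 1 / b" using assms by (auto simp: \<sigma>_def power_divide)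
  have "(normal_density 0 \<sigma> has_integral (\<integral>x. normal_density 0 \<sigma> x \<partial>lborel)) UNIV"
    using s by (intro has_integral_integral_lborel integrable_normal_density) auto
  then have "(normal_density 0 \<sigma> has_integral 1) UNIV" using s by simp
  then have "((\<lambda>t. sqrt (2 * pi / b) * normal_density 0 \<sigma> t) has_integral sqrt (2 * pi / b) * 1) UNIV"
    by (rule has_integral_mult_right)
  moreover have "sqrt (2 * pi / b) * normal_density 0 \<sigma> t = exp (- (b * t\<^sup>2 / 2))" for t
    using assms by (simp add: normal_density_def s mult_ac)
  ultimately show ?thesis by simp
qed

text \<open>Beyond T, half of the exponent yields the factor exp(-b T^2 / 4), and the other half is
  a Gaussian with b/2, whose integral is larger by sqrt 2 < 2.\<close>

lemma gaussian_truncated: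
  assumes "b > 0" "T \<ge> 0"
  defines "I \<equiv> integral {-T..T} (\<lambda>t. exp (- (b * t\<^sup>2 / 2)))"
  shows "I \<le> sqrt (2 * pi / b)" "sqrt (2 * pi / b) - I \<le> 2 * exp (- (b * T\<^sup>2 / 4)) * sqrt (2 * pi / b)"
proof -
  define f where "f t = exp (- (b * t\<^sup>2 / 2))" for t :: real
  have fi: "f integrable_on {-T..T}" unfolding f_def by (intro integrable_continuous_interval continuous_intros) auto
  then have fI: "(f has_integral I) {-T..T}" unfolding I_def f_def by (simp add: has_integral_iff)
  have fU: "(f has_integral sqrt (2 * pi / b)) UNIV" unfolding f_def by (rule gaussian_has_integral[OF assms(1)])
  show "I \<le> sqrt (2 * pi / b)"
    by (rule has_integral_subset_le[OF _ fI fU]) (auto simp: f_def)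
  have "((\<lambda>t. if t \<in> {-T..T} then f t else 0) has_integral I) UNIV"
    using fI by (subst has_integral_restrict_UNIV)
  moreover have "((\<lambda>t. exp (- (b * T\<^sup>2 / 4)) * exp (- (b / 2 * t\<^sup>2 / 2))) has_integral exp (- (b * T\<^sup>2 / 4)) * sqrt (2 * pi / (b / 2))) UNIV"
    using assms by (intro has_integral_mult_right gaussian_has_integral) auto
  ultimately have g: "((\<lambda>t. (if t \<in> {-T..T} then f t else 0) + exp (- (b * T\<^sup>2 / 4)) * exp (- (b / 2 * t\<^sup>2 / 2))) has_integral
        I + exp (- (b * T\<^sup>2 / 4)) * sqrt (2 * pi / (b / 2))) UNIV"
    by (rule has_integral_add)
  have "sqrt (2 * pi / b) \<le> I + exp (- (b * T\<^sup>2 / 4)) * sqrt (2 * pi / (b / 2))"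
  proof (rule has_integral_le[OF fU g])
    fix t :: real
    show "f t \<le> (if t \<in> {-T..T} then f t else 0) + exp (- (b * T\<^sup>2 / 4)) * exp (- (b / 2 * t\<^sup>2 / 2))"
    proof (cases "t \<in> {-T..T}")
      case False
      then have "\<bar>T\<bar> \<le> \<bar>t\<bar>" using assms by auto
      then have "T\<^sup>2 \<le> t\<^sup>2" by (simp add: abs_le_square_iff)
      then have "b * T\<^sup>2 \<le> b * t\<^sup>2" using assms by (intro mult_left_mono) auto
      then have "- (b * t\<^sup>2 / 2) \<le> - (b * T\<^sup>2 / 4) + - (b / 2 * t\<^sup>2 / 2)" by simp
      then have "f t \<le> exp (- (b * T\<^sup>2 / 4) + - (b / 2 * t\<^sup>2 / 2))" unfolding f_def by simp
      then show ?thesis using False by (simp only: exp_add) simp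
    qed simp
  qed
  also have "sqrt (2 * pi / (b / 2)) = sqrt 2 * sqrt (2 * pi / b)"
    by (simp add: real_sqrt_mult[symmetric] real_sqrt_divide[symmetric])
  also have "exp (- (b * T\<^sup>2 / 4)) * (sqrt 2 * sqrt (2 * pi / b)) \<le> exp (- (b * T\<^sup>2 / 4)) * (2 * sqrt (2 * pi / b))"
    using assms by (intro mult_left_mono mult_right_mono) (auto simp: sqrt2_less_2 less_imp_le)
  finally show "sqrt (2 * pi / b) - I \<le> 2 * exp (- (b * T\<^sup>2 / 4)) * sqrt (2 * pi / b)" by simp
qed

lemma norm_exp_minus_one_le:
  fixes z :: complex
  assumes "norm z \<le> 1"
  shows "norm (exp z - 1) \<le> 3 * norm z"
proof -
  have "(\<lambda>n. z ^ Suc n /\<^sub>R fact (Suc n)) sums (exp z - 1)"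
    using exp_converges[of z] by (subst sums_Suc_iff) simp
  then have eq: "exp z - 1 = (\<Sum>n. z ^ Suc n /\<^sub>R fact (Suc n))" by (simp only: sums_iff)
  have g: "(\<lambda>n. norm z * (norm z ^ n /\<^sub>R fact n)) sums (norm z * exp (norm z))"
    by (intro sums_mult exp_converges)
  have "norm (exp z - 1) \<le> (\<Sum>n. norm z * (norm z ^ n /\<^sub>R fact n))"
    unfolding eq
  proof (rule norm_suminf_le[OF _ sums_summable[OF g]])
    fix n
    have "norm (z ^ Suc n /\<^sub>R fact (Suc n)) = norm z ^ Suc n * inverse (fact (Suc n))"
      by (simp add: norm_mult norm_power mult_ac del: fact_Suc)
    also have "\<dots> \<le> norm z ^ Suc n * inverse (fact n)"
      by (intro mult_left_mono le_imp_inverse_le fact_mono) auto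
    finally show "norm (z ^ Suc n /\<^sub>R fact (Suc n)) \<le> norm z * (norm z ^ n /\<^sub>R fact n)"
      by (simp add: mult_ac)
  qed
  also have "\<dots> = norm z * exp (norm z)" using g by (simp only: sums_iff)
  also have "\<dots> \<le> norm z * 3"
    using assms exp_le by (intro mult_left_mono) (auto intro: order.trans[of _ "exp 1"])
  finally show ?thesis by simp
qed

text \<open>All analytic input is isolated in parameters: \<open>\<epsilon>1\<close> bounds the
  cubic remainder for |t| <= T, \<open>\<epsilon>2\<close> the relative error of replacing e^(s-it)
  - 1 by s there, and \<open>\<Delta>\<close> is the saving in the exponent for |t| >= T. The
  remaining exponential is the Gaussian tail lost by truncating at T.\<close>

lemma saddle_estimate:
  fixes s T \<epsilon>1 \<epsilon>2 \<Delta> :: real and n k :: nat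
  defines "r \<equiv> exp (- s)"
  defines "b \<equiv> phi_moment k 2 r" and "P \<equiv> exp (PhiC k r)"
  assumes s: "0 < s" "s \<le> 1" and k: "k \<ge> 1" and T: "0 < T" "T \<le> pi"
    and n: "phi_moment k 1 r = real n"
    and e1: "phi_moment k 3 r * T ^ 3 / 6 \<le> \<epsilon>1" "\<epsilon>1 \<le> 1"
    and e2: "s + 3 * T / s \<le> \<epsilon>2" "\<epsilon>2 \<le> 1"
    and minor: "\<And>t. T \<le> \<bar>t\<bar> \<Longrightarrow> \<bar>t\<bar> \<le> pi \<Longrightarrow> \<Delta> \<le> PhiC k r - Re (PhiC k (circle_pt r t))"
  shows "\<bar>(real (pP k (n + 1)) - real (pP k n)) * r ^ n - P * s / sqrt (2 * pi * b)\<bar> \<le>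
           P * s / sqrt (2 * pi * b) * (6 * \<epsilon>1 + \<epsilon>2 + 2 * exp (- (b * T\<^sup>2 / 4))) + P * (4 * exp (- \<Delta>))"
proof -
  have r: "0 < r" "r < 1" using s by (auto simp: r_def)
  have b: "b > 0" unfolding b_def using r k by (rule phi_moment_pos)
  have P: "P > 0" by (simp add: P_def)
  define w where "w t = exp (of_real s - \<i> * of_real t) - (1 :: complex)" for t
  define G where "G t = exp (PhiC k (circle_pt r t)) * exp (- \<i> * of_nat n * of_real t) * w t" for t
  define Q where "Q = (real (pP k (n + 1)) - real (pP k n)) * r ^ n"
  define f where "f t = exp (- (b * t\<^sup>2 / 2))" for t :: real
  have GI: "(G has_integral of_real (2 * pi * Q)) {- pi..pi}"
    unfolding G_def w_def Q_def r_def by (rule pP_diff_has_integral) (use s k in auto)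
  then have Gint: "G integrable_on {- pi..pi}" by blast
  have es: "exp s \<le> 3" using s exp_le by (meson exp_le_cancel_iff order.trans)
  have w_diff: "norm (w t - of_real s) \<le> s\<^sup>2 + 3 * \<bar>t\<bar>" for t
  proof -
    have "w t - of_real s = of_real (exp s) * (iexp (- t) - 1) + of_real (exp s - 1 - s)"
      unfolding w_def by (simp add: exp_diff exp_minus exp_of_real algebra_simps divide_inverse)
    also have "norm \<dots> \<le> norm (of_real (exp s) * (iexp (- t) - 1)) + norm (of_real (exp s - 1 - s) :: complex)"
      by (rule norm_triangle_ineq)
    also have "norm (of_real (exp s) * (iexp (- t) - 1)) = exp s * norm (iexp (- t) - 1)" by (simp add: norm_mult)
    also have "norm (iexp (- t) - 1) \<le> \<bar>t\<bar>" using iexp_approx1[of "- t" 0] by simp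
    also have "norm (of_real (exp s - 1 - s) :: complex) = exp s - 1 - s"
      using exp_ge_add_one_self[of s] by (simp only: norm_of_real)
    also have "exp s - 1 - s \<le> s\<^sup>2" using exp_bound[of s] s by simp
    finally have "norm (w t - of_real s) \<le> exp s * \<bar>t\<bar> + s\<^sup>2" by simp
    moreover have "exp s * \<bar>t\<bar> \<le> 3 * \<bar>t\<bar>" using es by (intro mult_right_mono) auto
    ultimately show ?thesis by simp
  qed
  have w_bound: "norm (w t) \<le> 4" for t
  proof -
    have "norm (w t) \<le> norm (exp (of_real s - \<i> * of_real t)) + norm (1 :: complex)"
      unfolding w_def by (rule norm_triangle_ineq4)
    then show ?thesis using es by simp
  qed
  have near: "norm (G t - of_real (P * s * f t)) \<le> P * s * (6 * \<epsilon>1 + \<epsilon>2) * f t" if t: "t \<in> {- T..T}" for t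
  proof -
    define R where "R = PhiC k (circle_pt r t) - of_real (PhiC k r) - \<i> * of_real (phi_moment k 1 r * t)
                + of_real (phi_moment k 2 r * t\<^sup>2 / 2)"
    have "norm R \<le> phi_moment k 3 r * \<bar>t\<bar> ^ 3 / 6" unfolding R_def by (rule PhiC_circle_taylor[OF r])
    also have "\<dots> \<le> phi_moment k 3 r * T ^ 3 / 6"
      using t phi_moment_pos[OF r k, of 3] by (intro divide_right_mono mult_left_mono power_mono) auto
    also have "\<dots> \<le> \<epsilon>1" by (rule e1)
    finally have R: "norm R \<le> \<epsilon>1" .
    then have eR: "norm (exp R - 1) \<le> 3 * \<epsilon>1"
      using norm_exp_minus_one_le[of R] e1(2) by simp
    \<comment> \<open>The saddle point equation \<open>n\<close> cancels the linear phase, leaving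
      the Gaussian exponent and the remainder R.\<close>
    have "PhiC k (circle_pt r t) + (- \<i> * of_nat n * of_real t) = of_real (PhiC k r) + of_real (- (b * t\<^sup>2 / 2)) + R"
      unfolding R_def n b_def by (simp add: algebra_simps)
    then have "exp (PhiC k (circle_pt r t)) * exp (- \<i> * of_nat n * of_real t) = of_real (P * f t) * exp R"
      unfolding exp_add[symmetric] P_def f_def of_real_mult exp_of_real[symmetric] by (simp only: exp_add[symmetric] of_real_add)
    then have "G t - of_real (P * s * f t) = of_real (P * f t) * ((exp R - 1) * w t + (w t - of_real s))"
      unfolding G_def by (simp add: algebra_simps)
    then have "norm (G t - of_real (P * s * f t)) = P * f t * norm ((exp R - 1) * w t + (w t - of_real s))"
      using P by (simp add: norm_mult f_def)
    also have "\<dots> \<le> P * f t * (s * (6 * \<epsilon>1 + \<epsilon>2))"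
    proof (rule mult_left_mono)
      have "s\<^sup>2 + 3 * \<bar>t\<bar> \<le> s\<^sup>2 + 3 * T" using t by auto
      also have "\<dots> = s * (s + 3 * T / s)" using s by (simp add: power2_eq_square field_simps)
      also have "\<dots> \<le> s * \<epsilon>2" using e2 s by (intro mult_left_mono) auto
      \<comment> \<open>Since \<epsilon>2 <= 1, this also gives |w t| <= 2 s. Together with |exp R -
        1| <= 3 \<epsilon>1 it is the origin of the constant 6.\<close>
      finally have ws: "norm (w t - of_real s) \<le> s * \<epsilon>2" using w_diff[of t] by linarith
      have "norm (w t) \<le> norm (w t - of_real s) + norm (of_real s :: complex)"
        using norm_triangle_ineq[of "w t - of_real s" "of_real s"] by simp
      also have "\<dots> \<le> s * 1 + s" using ws s e2(2) by (intro add_mono order.trans[OF ws] mult_left_mono) auto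
      finally have w2: "norm (w t) \<le> 2 * s" by simp
      have "norm ((exp R - 1) * w t + (w t - of_real s)) \<le> norm (exp R - 1) * norm (w t) + norm (w t - of_real s)"
        by (rule order.trans[OF norm_triangle_ineq]) (simp add: norm_mult)
      also have "\<dots> \<le> 3 * \<epsilon>1 * (2 * s) + s * \<epsilon>2"
        using eR w2 ws norm_ge_zero[of R] R by (intro add_mono mult_mono) (auto intro: order.trans[OF norm_ge_zero])
      finally show "norm ((exp R - 1) * w t + (w t - of_real s)) \<le> s * (6 * \<epsilon>1 + \<epsilon>2)" by (simp add: algebra_simps)
    qed (use P in \<open>simp add: f_def\<close>)
    finally show ?thesis by (simp add: mult_ac)
  qed
  have far: "norm (G t) \<le> P * (4 * exp (- \<Delta>))" if t: "T \<le> \<bar>t\<bar>" "\<bar>t\<bar> \<le> pi" for t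
  proof -
    have "norm (G t) = exp (Re (PhiC k (circle_pt r t))) * norm (w t)"
      by (simp add: G_def norm_mult)
    also have "\<dots> \<le> exp (PhiC k r - \<Delta>) * 4"
      using minor[OF t] w_bound by (intro mult_mono) auto
    also have "\<dots> = P * (4 * exp (- \<Delta>))" by (simp add: P_def exp_diff exp_minus divide_inverse)
    finally show ?thesis .
  qed
  define I where "I = integral {-T..T} f"
  have fint: "f integrable_on {-T..T}" unfolding f_def by (intro integrable_continuous_interval continuous_intros) auto
  have I: "I \<le> sqrt (2 * pi / b)" "sqrt (2 * pi / b) - I \<le> 2 * exp (- (b * T\<^sup>2 / 4)) * sqrt (2 * pi / b)"
    using gaussian_truncated[of b T] b T unfolding I_def f_def by auto
  have sub: "G integrable_on {- pi..- T}" "G integrable_on {- T..T}" "G integrable_on {T..pi}" "G integrable_on {- T..pi}"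
    by (rule integrable_on_subinterval[OF Gint]; use T in auto)+
  have split: "integral {- pi..- T} G + (integral {- T..T} G + integral {T..pi} G) = of_real (2 * pi * Q)"
  proof -
    have "integral {- T..T} G + integral {T..pi} G = integral {- T..pi} G"
      using T sub by (intro Henstock_Kurzweil_Integration.integral_combine) auto
    moreover have "integral {- pi..- T} G + integral {- T..pi} G = integral {- pi..pi} G"
      using T Gint by (intro Henstock_Kurzweil_Integration.integral_combine) auto
    moreover have "integral {- pi..pi} G = of_real (2 * pi * Q)" using GI by (rule integral_unique)
    ultimately show ?thesis by simp
  qed
  have tail: "norm (integral {c..d} G) \<le> P * (4 * exp (- \<Delta>)) * pi" 
    if "c \<le> d" "d - c \<le> pi" "G integrable_on {c..d}" "\<And>t. t \<in> {c..d} \<Longrightarrow> T \<le> \<bar>t\<bar> \<and> \<bar>t\<bar> \<le> pi" for c d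
  proof -
    have "norm (integral {c..d} G) \<le> integral {c..d} (\<lambda>_. P * (4 * exp (- \<Delta>)))"
      using that far by (intro integral_norm_bound_integral) auto
    also have "\<dots> = (d - c) * (P * (4 * exp (- \<Delta>)))" using that by simp
    also have "\<dots> \<le> pi * (P * (4 * exp (- \<Delta>)))" using that P by (intro mult_right_mono) auto
    finally show ?thesis by (simp add: mult_ac)
  qed
  have t1: "norm (integral {- pi..- T} G) \<le> P * (4 * exp (- \<Delta>)) * pi"
    by (rule tail) (use T sub in auto)
  have t2: "norm (integral {T..pi} G) \<le> P * (4 * exp (- \<Delta>)) * pi"
    by (rule tail) (use T sub in auto)
  have fI: "((\<lambda>t. of_real (P * s * f t) :: complex) has_integral of_real (P * s * I)) {-T..T}"
    using has_integral_of_real[OF has_integral_mult_right[OF integrable_integral[OF fint], of "P * s"]] by (simp add: I_def)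
  have mid: "norm (integral {- T..T} G - of_real (P * s * I)) \<le> P * s * (6 * \<epsilon>1 + \<epsilon>2) * I"
  proof -
    have "integral {- T..T} G - of_real (P * s * I) = integral {-T..T} (\<lambda>t. G t - of_real (P * s * f t))"
      using Henstock_Kurzweil_Integration.integral_diff[OF sub(2), of "\<lambda>t. of_real (P * s * f t)"] fI
      by (simp add: integral_unique[OF fI] has_integral_integrable[OF fI] del: of_real_mult)
    also have "norm \<dots> \<le> integral {-T..T} (\<lambda>t. P * s * (6 * \<epsilon>1 + \<epsilon>2) * f t)"
      using near by (intro integral_norm_bound_integral integrable_diff sub has_integral_integrable[OF fI] integrable_on_mult_right fint) auto
    also have "\<dots> = P * s * (6 * \<epsilon>1 + \<epsilon>2) * I" by (simp add: I_def)
    finally show ?thesis .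
  qed
  define H where "H = sqrt (2 * pi / b)"
  have e0: "\<epsilon>1 \<ge> 0" "\<epsilon>2 \<ge> 0"
  proof -
    have "0 \<le> phi_moment k 3 r * T ^ 3 / 6" using phi_moment_pos[OF r k, of 3] T by simp
    then show "\<epsilon>1 \<ge> 0" using e1 by linarith
    have "0 \<le> s + 3 * T / s" using s T by simp
    then show "\<epsilon>2 \<ge> 0" using e2 by linarith
  qed
  have "of_real (2 * pi * Q - P * s * H) = integral {- pi..- T} G + (integral {- T..T} G - of_real (P * s * I)) + integral {T..pi} G
           + complex_of_real (P * s * (I - H))"
    using split by (simp add: algebra_simps)
  then have "norm (complex_of_real (2 * pi * Q - P * s * H)) \<le> norm (integral {- pi..- T} G) + norm (integral {- T..T} G - of_real (P * s * I))
         + norm (integral {T..pi} G) + norm (complex_of_real (P * s * (I - H)))"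
    by (simp only:) (intro order.trans[OF norm_triangle_ineq] add_mono order.refl)
  also have "norm (complex_of_real (P * s * (I - H))) = P * s * (H - I)"
    using P s I(1) unfolding norm_of_real by (simp add: abs_mult H_def)
  also have "P * s * (H - I) \<le> P * s * (2 * exp (- (b * T\<^sup>2 / 4)) * H)"
    using I(2) P s unfolding H_def by (intro mult_left_mono) auto
  also have "norm (integral {- T..T} G - of_real (P * s * I)) \<le> P * s * (6 * \<epsilon>1 + \<epsilon>2) * H"
    by (rule order.trans[OF mid], rule mult_left_mono) (use I(1) P s e0 in \<open>auto simp: H_def\<close>)
  finally have main: "\<bar>2 * pi * Q - P * s * H\<bar> \<le> P * s * H * (6 * \<epsilon>1 + \<epsilon>2 + 2 * exp (- (b * T\<^sup>2 / 4))) + 2 * pi * (P * (4 * exp (- \<Delta>)))"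
    using t1 t2 unfolding norm_of_real by (simp add: algebra_simps)
  have H: "H = 2 * pi * (1 / sqrt (2 * pi * b))"
  proof -
    have "sqrt (2 * pi / b) * sqrt (2 * pi * b) = sqrt ((2 * pi)\<^sup>2)"
      unfolding real_sqrt_mult[symmetric] using b by (simp add: power2_eq_square)
    also have "\<dots> = 2 * pi" unfolding real_sqrt_abs by simp
    finally show ?thesis unfolding H_def using b by (simp add: field_simps)
  qed
  have "2 * pi * \<bar>Q - P * s / sqrt (2 * pi * b)\<bar> = \<bar>2 * pi * (Q - P * s / sqrt (2 * pi * b))\<bar>"
    by (simp add: abs_mult)
  also have "2 * pi * (Q - P * s / sqrt (2 * pi * b)) = 2 * pi * Q - P * s * H"
    unfolding H by (simp add: algebra_simps)
  also note main
  also have "P * s * H * (6 * \<epsilon>1 + \<epsilon>2 + 2 * exp (- (b * T\<^sup>2 / 4))) + 2 * pi * (P * (4 * exp (- \<Delta>))) = 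
     2 * pi * (P * s / sqrt (2 * pi * b) * (6 * \<epsilon>1 + \<epsilon>2 + 2 * exp (- (b * T\<^sup>2 / 4))) + P * (4 * exp (- \<Delta>)))"
    unfolding H by (simp add: algebra_simps)
  finally show ?thesis unfolding Q_def by (subst (asm) mult_le_cancel_left_pos) auto
qed

section \<open>Powers of s as s tends to 0\<close>

lemma eventually_powr_le_powr_at_0:
  fixes a b c :: real
  assumes "b < a" "c > 0"
  shows "eventually (\<lambda>s::real. s powr a \<le> c * s powr b) (at_right 0)"
  using assms by real_asymp

text \<open>N is s^(-1/k) rounded down, essentially the longest range on which e^(-s p^k) stays
  above e^(-1); the factor 1/2 pays for the rounding.\<close>

lemma prime_cutoff:
  assumes "k \<ge> 1"
  obtains N :: "real \<Rightarrow> nat" where "filterlim N at_top (at_right 0)"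
    "eventually (\<lambda>s. s powr (- 1 / real k) / 2 \<le> real (N s) \<and> s * real (N s) ^ k \<le> 1) (at_right 0)"
proof
  define N where "N s = nat \<lfloor>s powr (- 1 / real k)\<rfloor>" for s
  have x: "filterlim (\<lambda>s. s powr (- 1 / real k)) at_top (at_right 0)"
    using assms by real_asymp
  show "filterlim N at_top (at_right 0)"
    unfolding N_def by (intro filterlim_compose[OF filterlim_nat_sequentially] filterlim_compose[OF filterlim_floor_sequentially] x)
  show "eventually (\<lambda>s. s powr (- 1 / real k) / 2 \<le> real (N s) \<and> s * real (N s) ^ k \<le> 1) (at_right 0)"
    using filterlim_at_top[THEN iffD1, rule_format, OF x, of 2] eventually_at_right_less[of 0]
  proof eventually_elim
    case (elim s)
    define y where "y = s powr (- 1 / real k)"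
    have y: "y \<ge> 2" using elim by (simp add: y_def)
    have Nf: "real (N s) \<le> y" "y \<le> real (N s) + 1" unfolding N_def y_def[symmetric] using y by linarith+
    have "s * real (N s) ^ k \<le> s * y ^ k" using elim Nf by (intro mult_left_mono power_mono) auto
    also have "y ^ k = s powr (- 1)" using assms elim by (simp add: y_def powr_realpow[symmetric] powr_powr)
    also have "s * s powr (- 1) = 1" using elim by (simp add: powr_minus)
    finally show ?case using Nf y unfolding y_def by auto
  qed
qed

text \<open>Primes up to about s^(-1/k) contribute about N^((2k+1)(1-\<eta>)), that is
  s^(-(2+1/k)(1-\<eta>)).\<close>

lemma phi_moment_2_lower:
  assumes "k \<ge> 1" "\<nu> > 0"
  shows "eventually (\<lambda>s. s powr (- 2 - 1 / real k + \<nu>) \<le> phi_moment k 2 (exp (- s))) (at_right 0)"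
proof -
  \<comment> \<open>As 2 + 1/k <= 3, the loss (2 + 1/k) \<eta> is at most \<nu>/2; the other half of
    \<nu> absorbs constants.\<close>
  define \<eta> where "\<eta> = min (\<nu> / 6) 1"
  have \<eta>: "\<eta> > 0" "\<eta> \<le> \<nu> / 6" "\<eta> \<le> 1" using assms by (auto simp: \<eta>_def)
  define e where "e = (2 * real k + 1) * (1 - \<eta>)"
  have e: "e \<ge> 0" using \<eta> by (simp add: e_def)
  define c where "c = exp (- 1) * (1 / 2) powr e"
  have c: "c > 0" by (simp add: c_def)
  have "(2 + 1 / real k) * \<eta> \<le> 3 * (\<nu> / 6)" using \<eta> assms by (intro mult_mono) auto
  moreover have "e / real k = 2 + 1 / real k - (2 + 1 / real k) * \<eta>" using assms by (simp add: e_def field_simps)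
  ultimately have ek: "- (e / real k) < - 2 - 1 / real k + \<nu>" using assms(2) by linarith
  obtain N where N: "filterlim N at_top (at_right 0)"
    "eventually (\<lambda>s. s powr (- 1 / real k) / 2 \<le> real (N s) \<and> s * real (N s) ^ k \<le> 1) (at_right 0)"
    using prime_cutoff[OF assms(1)] by blast
  have "eventually (\<lambda>M. (\<Sum>p\<in>primes_le M. real p ^ (2 * k)) \<ge> real M powr e) at_top"
    using sum_prime_powers_ge[OF \<eta>(1), of "2 * k"] by (simp add: e_def)
  with N(1) have ev: "eventually (\<lambda>s. (\<Sum>p\<in>primes_le (N s). real p ^ (2 * k)) \<ge> real (N s) powr e) (at_right 0)"
    unfolding filterlim_iff by auto
  show ?thesis using ev N(2) eventually_powr_le_powr_at_0[OF ek c] eventually_at_right_less[of 0]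
  proof eventually_elim
    case (elim s)
    have "s powr (- 2 - 1 / real k + \<nu>) \<le> c * s powr (- (e / real k))" by (rule elim(3))
    also have "\<dots> = exp (- 1) * (s powr (- 1 / real k) / 2) powr e"
      using elim(4) by (simp add: c_def powr_divide powr_powr)
    also have "\<dots> \<le> exp (- 1) * real (N s) powr e" using elim(2) e by (intro mult_left_mono powr_mono2) auto
    also have "\<dots> \<le> exp (- 1) * (\<Sum>p\<in>primes_le (N s). real p ^ (2 * k))" using elim(1) by (intro mult_left_mono) auto
    also have "\<dots> \<le> phi_moment k 2 (exp (- s))" using elim assms by (intro phi_moment_ge_prime_sum) auto
    finally show ?case .
  qed
qed

text \<open>Transfers the cosine sum bound to the circle with N about s^(-1/k), which turns
  N^(-k-1/2) into s^(1+1/(2k)).\<close>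

lemma PhiC_minor_arc_saving:
  assumes "k \<ge> 1" "0 < \<nu>" "\<nu> \<le> 1"
  shows "\<exists>\<delta>>0. eventually (\<lambda>s. \<forall>t. s powr (1 + 1 / (2 * real k) - \<nu>) \<le> \<bar>t\<bar> \<longrightarrow> \<bar>t\<bar> \<le> pi \<longrightarrow>
           s powr (- \<delta>) \<le> PhiC k (exp (- s)) - Re (PhiC k (circle_pt (exp (- s)) t))) (at_right 0)"
proof -
  \<comment> \<open>In terms of s the threshold becomes a constant times s^(1+1/(2k)-\<nu>/2), which
    is below the required s^(1+1/(2k)-\<nu>) for small s. Halving the exponent in the definition of
    \<delta> absorbs constants in the same way.\<close>
  define \<nu>' where "\<nu>' = real k * \<nu> / 2"
  have \<nu>': "\<nu>' > 0" using assms by (simp add: \<nu>'_def)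
  obtain d where d: "d > 0" and evd: "eventually (\<lambda>N. \<forall>t. real N powr (- real k - 1 / 2 + \<nu>') \<le> \<bar>t\<bar> \<longrightarrow>
           \<bar>t\<bar> \<le> pi \<longrightarrow> real N powr d \<le> minor_sum k N t) at_top"
    using minor_sum_large[OF assms(1) \<nu>'] by (elim exE conjE)
  define e where "e = real k + 1 / 2 - \<nu>'"
  have "real k * \<nu> \<le> real k * 1" using assms by (intro mult_left_mono) auto
  moreover have "real k \<ge> 1" using assms by simp
  ultimately have e: "e > 0" unfolding e_def \<nu>'_def by linarith
  have ek: "e / real k = 1 + 1 / (2 * real k) - \<nu> / 2" using assms by (simp add: e_def \<nu>'_def field_simps)
  define c where "c = (1 / 2 :: real) powr (- e)"
  have c: "c > 0" by (simp add: c_def)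
  define c' where "c' = exp (- 1) * (1 / 2) powr d"
  have c': "c' > 0" by (simp add: c'_def)
  define \<delta> where "\<delta> = d / real k / 2"
  have \<delta>: "\<delta> > 0" using d assms by (simp add: \<delta>_def)
  obtain N where N: "filterlim N at_top (at_right 0)"
    "eventually (\<lambda>s. s powr (- 1 / real k) / 2 \<le> real (N s) \<and> s * real (N s) ^ k \<le> 1) (at_right 0)"
    using prime_cutoff[OF assms(1)] by blast
  from N(1) evd have ev: "eventually (\<lambda>s. \<forall>t. real (N s) powr (- real k - 1 / 2 + \<nu>') \<le> \<bar>t\<bar> \<longrightarrow>
           \<bar>t\<bar> \<le> pi \<longrightarrow> real (N s) powr d \<le> minor_sum k (N s) t) (at_right 0)"
    unfolding filterlim_iff by auto
  have f1: "eventually (\<lambda>s. s powr (e / real k) \<le> 1 / c * s powr (1 + 1 / (2 * real k) - \<nu>)) (at_right 0)"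
    by (rule eventually_powr_le_powr_at_0) (use ek c assms in auto)
  have f2: "eventually (\<lambda>s. s powr (- \<delta>) \<le> c' * s powr (- (d / real k))) (at_right 0)"
    by (rule eventually_powr_le_powr_at_0) (use c' d assms in \<open>auto simp: \<delta>_def field_simps\<close>)
  have "eventually (\<lambda>s. \<forall>t. s powr (1 + 1 / (2 * real k) - \<nu>) \<le> \<bar>t\<bar> \<longrightarrow> \<bar>t\<bar> \<le> pi \<longrightarrow>
           s powr (- \<delta>) \<le> PhiC k (exp (- s)) - Re (PhiC k (circle_pt (exp (- s)) t))) (at_right 0)"
    using ev N(2) f1 f2 eventually_at_right_less[of 0]
  proof eventually_elim
    case (elim s)
    show ?case
    proof (intro allI impI)
      fix t assume t: "s powr (1 + 1 / (2 * real k) - \<nu>) \<le> \<bar>t\<bar>" "\<bar>t\<bar> \<le> pi"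
      define y where "y = s powr (- 1 / real k) / 2"
      have y: "y > 0" "y \<le> real (N s)" "s * real (N s) ^ k \<le> 1" using elim(2,5) by (auto simp: y_def)
      have "real (N s) powr (- real k - 1 / 2 + \<nu>') = real (N s) powr (- e)"
      proof -
        have "- real k - 1 / 2 + \<nu>' = - e" by (simp add: e_def)
        then show ?thesis by (simp only:)
      qed
      also have "\<dots> \<le> y powr (- e)" using y e by (intro powr_mono2') auto
      also have "\<dots> = c * s powr (e / real k)" using elim(5) by (simp add: y_def c_def powr_divide powr_powr)
      also have "\<dots> \<le> c * (1 / c * s powr (1 + 1 / (2 * real k) - \<nu>))" using c elim(3) by (intro mult_left_mono) auto
      also have "\<dots> = s powr (1 + 1 / (2 * real k) - \<nu>)" using c by simp
      also note t(1)
      finally have "real (N s) powr d \<le> minor_sum k (N s) t" using elim(1)[rule_format, of t] t(2) by simp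
      moreover have "y powr d \<le> real (N s) powr d" using y d by (intro powr_mono2) auto
      ultimately have m: "y powr d \<le> minor_sum k (N s) t" by linarith
      have "s powr (- \<delta>) \<le> c' * s powr (- (d / real k))" by (rule elim(4))
      also have "\<dots> = exp (- 1) * y powr d" using elim(5) by (simp add: y_def c'_def powr_divide powr_powr)
      also have "\<dots> \<le> exp (- 1) * minor_sum k (N s) t" using m by (intro mult_left_mono) auto
      also have "\<dots> \<le> (\<Sum>m. (1 - cos (real m * t)) * phi_coeff k m * exp (- s) ^ m)"
        unfolding minor_sum_def
        by (rule phi_series_ge_prime_sum) (use assms elim y Re_PhiC_circle[where r = "exp (- s)" and k = k and t = t] in \<open>auto simp: sums_iff\<close>)
      also have "\<dots> = PhiC k (exp (- s)) - Re (PhiC k (circle_pt (exp (- s)) t))"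
        using Re_PhiC_circle[where r = "exp (- s)" and k = k and t = t] elim(5) by (simp add: sums_iff)
      finally show "s powr (- \<delta>) \<le> PhiC k (exp (- s)) - Re (PhiC k (circle_pt (exp (- s)) t))" .
    qed
  qed
  with \<delta> show ?thesis by (intro exI[of _ \<delta>] conjI)
qed

text \<open>The predicted difference with the factor \<rho>^(-n) removed, which leaves a function of
  s = ln(1/\<rho>) alone.\<close>

definition main_term :: "nat \<Rightarrow> real \<Rightarrow> real" where
  "main_term k s = exp (PhiC k (exp (- s))) * s / sqrt (2 * pi * phi_moment k 2 (exp (- s)))"

text \<open>Phrased as s tends to 0 with n tied to s through the saddle point equation, so that all
  errors are powers of s; n is brought in once, at the end.\<close>

lemma saddle_asymptotics:
  assumes k: "k \<ge> 1"
  shows "\<exists>K. eventually (\<lambda>s. \<forall>n. phi_moment k 1 (exp (- s)) = real n \<longrightarrow> n \<ge> 1 \<longrightarrow>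
           \<bar>(real (pP k (n + 1)) - real (pP k n)) * exp (- s) ^ n - main_term k s\<bar> \<le>
             K * (main_term k s * real n powr (- 1 / (2 * real k + 3)))) (at_right 0)"
proof -
  define \<kappa> where "\<kappa> = 1 / (2 * real k + 3)"
  \<comment> \<open>The saddle point argument gives a relative error of about \<open>s powr (1 / (2 * k))\<close>, whereas
    \<open>n powr (- \<kappa>)\<close> is about \<open>s powr (\<kappa> * (1 + 1 / k)) = s powr (1 / (2 * k) - 5 * \<nu>)\<close>.
    The gap \<open>5 * \<nu>\<close> absorbs all losses.\<close>
  define \<nu> where "\<nu> = \<kappa> / (10 * real k)"
  have kk: "\<kappa> > 0" "\<kappa> \<le> 1" by (auto simp: \<kappa>_def)
  have "\<kappa> / (10 * real k) \<le> \<kappa> / 1" using kk k by (intro divide_left_mono) auto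
  then have \<nu>: "\<nu> > 0" "\<nu> \<le> \<kappa>" using kk k by (auto simp: \<nu>_def)
  define \<beta> where "\<beta> = 1 / real k + \<nu>"
  have \<beta>: "\<beta> > 1 / real k" using \<nu> by (simp add: \<beta>_def)
  \<comment> \<open>The exponent of the cubic remainder, -3 - \<beta> + 3 \<tau> with
    \<open>\<tau>\<close> defined below; the other relative errors are shown to be of at most this
    order.\<close>
  define \<theta> where "\<theta> = 1 / (2 * real k) - 4 * \<nu>"
  have kap: "\<kappa> * (1 + 1 / real k) = 1 / (2 * real k) - 5 * \<nu>" 
    using k by (simp add: \<nu>_def \<kappa>_def divide_simps) (simp add: algebra_simps)
  \<comment> \<open>From n <= C1 s^(-1-\<beta>) the target n^(-\<kappa>) is at least a constant
    times s^(\<kappa>(1+\<beta>)), and by this inequality at least a constant times s^\<theta> when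
    s <= 1.\<close>
  have expo: "\<kappa> * (1 + \<beta>) \<le> \<theta>"
  proof -
    have "\<kappa> * \<nu> \<le> 1 * \<nu>" using kk \<nu> by (intro mult_right_mono) auto
    moreover have "\<kappa> * (1 + \<beta>) = \<kappa> * (1 + 1 / real k) + \<kappa> * \<nu>" by (simp add: \<beta>_def algebra_simps)
    ultimately show ?thesis unfolding kap \<theta>_def by simp
  qed
  have \<theta>: "\<theta> > 0" "\<theta> \<le> 1"
  proof -
    have "\<kappa> * (1 + \<beta>) > 0" using kk \<beta> k by (intro mult_pos_pos) (auto intro: add_pos_nonneg simp: \<beta>_def \<nu> less_imp_le)
    then show "\<theta> > 0" using expo by linarith
    have "1 / (2 * real k) \<le> 1" using k by (simp add: field_simps)
    then show "\<theta> \<le> 1" using \<nu> by (simp add: \<theta>_def)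
  qed
  obtain C1 where C1: "C1 > 0" "\<And>s. s > 0 \<Longrightarrow> phi_moment k 1 (exp (- s)) \<le> C1 * s powr (- real 1 - \<beta>)"
    using phi_moment_upper[OF k \<beta>] by meson
  obtain C2 where C2: "C2 > 0" "\<And>s. s > 0 \<Longrightarrow> phi_moment k 2 (exp (- s)) \<le> C2 * s powr (- real 2 - \<beta>)"
    using phi_moment_upper[OF k \<beta>] by meson
  obtain C3 where C3: "C3 > 0" "\<And>s. s > 0 \<Longrightarrow> phi_moment k 3 (exp (- s)) \<le> C3 * s powr (- real 3 - \<beta>)"
    using phi_moment_upper[OF k \<beta>] by meson
  \<comment> \<open>The major arc |t| <= T = s^\<tau> is wider than the Gaussian by s^(-\<nu>): then
    b T^2 >= s^(-\<nu>), so the truncated tail is smaller than any power of s.\<close>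
  define \<tau> where "\<tau> = 1 + 1 / (2 * real k) - \<nu>"
  have \<tau>: "\<tau> > 0" using \<theta>(1) \<nu>(1) unfolding \<tau>_def \<theta>_def by simp
  obtain \<delta> where \<delta>: "\<delta> > 0" and minor: "eventually (\<lambda>s. \<forall>t. s powr \<tau> \<le> \<bar>t\<bar> \<longrightarrow> \<bar>t\<bar> \<le> pi \<longrightarrow>
           s powr (- \<delta>) \<le> PhiC k (exp (- s)) - Re (PhiC k (circle_pt (exp (- s)) t))) (at_right 0)"
    unfolding \<tau>_def using PhiC_minor_arc_saving[OF k \<nu>(1) order.trans[OF \<nu>(2) kk(2)]] by (elim exE conjE)
  have lower: "eventually (\<lambda>s. s powr (- 2 - 1 / real k + \<nu>) \<le> phi_moment k 2 (exp (- s))) (at_right 0)"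
    by (rule phi_moment_2_lower[OF k \<nu>(1)])
  have f1: "eventually (\<lambda>s. C3 * s powr \<theta> \<le> 1) (at_right 0)" using \<theta> by real_asymp
  have f2: "eventually (\<lambda>s. 4 * s powr \<theta> \<le> 1) (at_right 0)" using \<theta> by real_asymp
  have f3: "eventually (\<lambda>s::real. 2 * exp (- (s powr (- \<nu>) / 4)) \<le> s powr 1) (at_right 0)" using \<nu> by real_asymp
  \<comment> \<open>The minor arcs must be small relative to P s / sqrt(2 pi b). Since b is at most
    a constant times a power of 1/s, the factor exp(-s^(-\<delta>)) wins.\<close>
  have f4: "eventually (\<lambda>s::real. 4 * exp (- (s powr (- \<delta>))) * sqrt (2 * pi * (C2 * s powr (- 2 - \<beta>))) \<le> s powr 2) (at_right 0)"
    using \<delta> C2(1) by real_asymp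
  have f5: "eventually (\<lambda>s::real. s powr \<tau> \<le> pi) (at_right 0)" using \<tau> pi_gt_zero by real_asymp
  have f6: "eventually (\<lambda>s::real. s \<le> 1) (at_right 0)" by real_asymp
  define K0 where "K0 = 6 * C3 + 6"
  define K where "K = K0 * C1 powr \<kappa>"
  have K0: "K0 > 0" using C3 by (simp add: K0_def)
  have "eventually (\<lambda>s. \<forall>n. phi_moment k 1 (exp (- s)) = real n \<longrightarrow> n \<ge> 1 \<longrightarrow>
           \<bar>(real (pP k (n + 1)) - real (pP k n)) * exp (- s) ^ n - main_term k s\<bar> \<le>
             K * (main_term k s * real n powr (- 1 / (2 * real k + 3)))) (at_right 0)"
    using minor lower f1 f2 f3 f4 f5 f6 eventually_at_right_less[of 0]
  proof eventually_elim
    case (elim s)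
    note minor_s = elim(1)[rule_format] and lower_s = elim(2)
    have s: "0 < s" "s \<le> 1" using elim(8,9) by auto
    have r: "0 < exp (- s)" "exp (- s) < 1" using s by auto
    define T where "T = s powr \<tau>"
    have T: "T > 0" "T \<le> pi" using s elim(7) by (auto simp: T_def)
    define b where "b = phi_moment k 2 (exp (- s))"
    have b0: "b > 0" unfolding b_def using r k by (rule phi_moment_pos)
    have e1: "phi_moment k 3 (exp (- s)) * T ^ 3 / 6 \<le> C3 * s powr \<theta>"
    proof -
      have "phi_moment k 3 (exp (- s)) * T ^ 3 \<le> C3 * s powr (- real 3 - \<beta>) * T ^ 3"
        using C3(2)[OF s(1)] T by (intro mult_right_mono) auto
      also have "\<dots> = C3 * s powr (- real 3 - \<beta> + 3 * \<tau>)"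
      proof -
        have "T ^ 3 = s powr (3 * \<tau>)" using s by (simp add: T_def powr_realpow[symmetric] powr_powr mult.commute)
        then show ?thesis by (simp add: powr_add)
      qed
      also have "- real 3 - \<beta> + 3 * \<tau> = \<theta>" using k by (simp add: \<beta>_def \<tau>_def \<theta>_def field_simps)
      finally have "phi_moment k 3 (exp (- s)) * T ^ 3 \<le> C3 * s powr \<theta>" .
      moreover have "0 \<le> C3 * s powr \<theta>" using C3 by simp
      ultimately show ?thesis by linarith
    qed
    have e2: "s + 3 * T / s \<le> 4 * s powr \<theta>"
    proof -
      have "T / s = s powr (\<tau> - 1)" using s by (simp add: T_def powr_diff)
      also have "\<dots> \<le> s powr \<theta>" using s \<nu> by (intro powr_mono') (auto simp: \<tau>_def \<theta>_def)
      finally have "3 * T / s \<le> 3 * s powr \<theta>" by simp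
      moreover have "s powr 1 \<le> s powr \<theta>" using s \<theta> by (intro powr_mono') auto
      ultimately show ?thesis using s by simp
    qed
    have bT: "s powr (- \<nu>) \<le> b * T\<^sup>2"
    proof -
      have "s powr (- \<nu>) = s powr (- 2 - 1 / real k + \<nu>) * s powr (2 * \<tau>)"
        using k by (simp add: powr_add[symmetric] \<tau>_def field_simps)
      also have "s powr (2 * \<tau>) = T\<^sup>2" by (simp add: T_def power2_eq_square powr_add[symmetric])
      also have "s powr (- 2 - 1 / real k + \<nu>) * T\<^sup>2 \<le> b * T\<^sup>2"
        using lower_s unfolding b_def by (intro mult_right_mono) auto
      finally show ?thesis .
    qed
    have e3: "2 * exp (- (b * T\<^sup>2 / 4)) \<le> s powr \<theta>"
    proof -
      have "2 * exp (- (b * T\<^sup>2 / 4)) \<le> 2 * exp (- (s powr (- \<nu>) / 4))" using bT by simp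
      also have "\<dots> \<le> s powr 1" by (rule elim(5))
      also have "\<dots> \<le> s powr \<theta>" using s \<theta> by (intro powr_mono') auto
      finally show ?thesis .
    qed
    define P where "P = exp (PhiC k (exp (- s)))"
    have P: "P > 0" by (simp add: P_def)
    define m where "m = main_term k s"
    have m_eq: "m = P * s / sqrt (2 * pi * b)" by (simp add: m_def main_term_def P_def b_def)
    have m: "m > 0" using P s b0 by (simp add: m_eq)
    have e4: "P * (4 * exp (- (s powr (- \<delta>)))) \<le> m * s powr \<theta>"
    proof -
      have "4 * exp (- (s powr (- \<delta>))) * sqrt (2 * pi * b) \<le> 4 * exp (- (s powr (- \<delta>))) * sqrt (2 * pi * (C2 * s powr (- 2 - \<beta>)))"
        using C2(2)[OF s(1)] unfolding b_def by (intro mult_left_mono real_sqrt_le_mono) auto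
      also have "\<dots> \<le> s powr 2" by (rule elim(6))
      also have "\<dots> = s * s powr 1" using s by (simp add: power2_eq_square)
      also have "\<dots> \<le> s * s powr \<theta>" using s \<theta> by (intro mult_left_mono powr_mono') auto
      finally have "4 * exp (- (s powr (- \<delta>))) \<le> s * s powr \<theta> / sqrt (2 * pi * b)" using b0 by (simp add: field_simps)
      then have "P * (4 * exp (- (s powr (- \<delta>)))) \<le> P * (s * s powr \<theta> / sqrt (2 * pi * b))" using P by (intro mult_left_mono) auto
      then show ?thesis by (simp add: m_eq)
    qed
    show ?case
    proof (intro allI impI)
      fix n :: nat assume n: "phi_moment k 1 (exp (- s)) = real n" "n \<ge> 1"
      have "\<bar>(real (pP k (n + 1)) - real (pP k n)) * exp (- s) ^ n - P * s / sqrt (2 * pi * b)\<bar> \<le>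
           P * s / sqrt (2 * pi * b) * (6 * (C3 * s powr \<theta>) + 4 * s powr \<theta> + 2 * exp (- (b * T\<^sup>2 / 4))) + P * (4 * exp (- (s powr (- \<delta>))))"
        unfolding P_def b_def
        by (rule saddle_estimate[OF s k T n(1) e1 elim(3) e2 elim(4)]) (use minor_s in \<open>auto simp: T_def\<close>)
      then have "\<bar>(real (pP k (n + 1)) - real (pP k n)) * exp (- s) ^ n - m\<bar> \<le>
           m * (6 * (C3 * s powr \<theta>) + 4 * s powr \<theta> + 2 * exp (- (b * T\<^sup>2 / 4))) + P * (4 * exp (- (s powr (- \<delta>))))"
        by (simp only: m_eq)
      also have "\<dots> \<le> m * (6 * (C3 * s powr \<theta>) + 4 * s powr \<theta> + s powr \<theta>) + m * s powr \<theta>"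
        using e3 e4 m by (intro add_mono mult_left_mono order.refl) auto
      also have "\<dots> = m * (K0 * s powr \<theta>)" by (simp add: K0_def algebra_simps)
      also have "\<dots> \<le> m * (K0 * (C1 powr \<kappa> * real n powr (- \<kappa>)))"
      proof -
        have "real n \<le> C1 * s powr (- 1 - \<beta>)" using C1(2)[OF s(1)] n(1) by simp
        then have "(C1 * s powr (- 1 - \<beta>)) powr (- \<kappa>) \<le> real n powr (- \<kappa>)"
          using n kk by (intro powr_mono2') auto
        then have "C1 powr \<kappa> * (C1 * s powr (- 1 - \<beta>)) powr (- \<kappa>) \<le> C1 powr \<kappa> * real n powr (- \<kappa>)"
          by (intro mult_left_mono) auto
        moreover have "C1 powr \<kappa> * (C1 * s powr (- 1 - \<beta>)) powr (- \<kappa>) = s powr (\<kappa> * (1 + \<beta>))"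
        proof -
          have "C1 powr \<kappa> * C1 powr (- \<kappa>) = 1" using C1(1) by (simp add: powr_add[symmetric])
          moreover have "(C1 * s powr (- 1 - \<beta>)) powr (- \<kappa>) = C1 powr (- \<kappa>) * s powr (\<kappa> * (1 + \<beta>))"
            using C1(1) by (simp add: powr_mult powr_powr algebra_simps)
          ultimately show ?thesis by (simp add: mult.assoc[symmetric])
        qed
        moreover have "s powr \<theta> \<le> s powr (\<kappa> * (1 + \<beta>))" using s expo by (intro powr_mono') auto
        ultimately have "s powr \<theta> \<le> C1 powr \<kappa> * real n powr (- \<kappa>)" by linarith
        then show ?thesis using m K0 by (intro mult_left_mono) auto
      qed
      also have "\<dots> = K * (m * real n powr (- 1 / (2 * real k + 3)))" by (simp add: K_def \<kappa>_def mult_ac)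
      finally show "\<bar>(real (pP k (n + 1)) - real (pP k n)) * exp (- s) ^ n - main_term k s\<bar> \<le>
             K * (main_term k s * real n powr (- 1 / (2 * real k + 3)))" unfolding m_def .
    qed
  qed
  then show ?thesis by (rule exI)
qed

text \<open>Inverting the upper bound n <= C s^(-1-\<beta>) for the first moment gives s <=
  (C/n)^(1/(1+\<beta>)); for this qualitative statement the value \<beta> = 1/k + 1 is good
  enough.\<close>

lemma ln_rho_tendsto_0:
  assumes "k \<ge> 1"
  shows "filterlim (\<lambda>n. ln (1 / rho k n)) (at_right 0) at_top"
proof -
  define s where "s n = ln (1 / rho k n)" for n
  define \<beta> where "\<beta> = 1 / real k + 1"
  obtain C where C: "C > 0" "\<And>s. s > 0 \<Longrightarrow> phi_moment k 1 (exp (- s)) \<le> C * s powr (- real 1 - \<beta>)"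
    using phi_moment_upper[OF assms, of \<beta> 1] unfolding \<beta>_def by auto
  define e where "e = 1 + \<beta>"
  have e: "e > 0" by (simp add: e_def \<beta>_def add_pos_nonneg)
  have s: "0 < s n" "s n \<le> (C / real n) powr (1 / e)" if "n \<ge> 1" for n
  proof -
    note rp = rho_props[OF assms that]
    show s0: "0 < s n" using rp by (simp add: s_def)
    have "exp (- s n) = rho k n" using rp by (simp add: s_def ln_div)
    then have "real n \<le> C * s n powr (- e)" using C(2)[OF s0] rp(3) by (simp add: e_def)
    then have "s n powr e \<le> C / real n" using s0 that by (simp add: powr_minus field_simps)
    then have "(s n powr e) powr (1 / e) \<le> (C / real n) powr (1 / e)" using e by (intro powr_mono2) auto
    then show "s n \<le> (C / real n) powr (1 / e)" using e s0 by (simp add: powr_powr)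
  qed
  have lim: "(\<lambda>n. (C / real n) powr (1 / e)) \<longlonglongrightarrow> 0" using C(1) e by real_asymp
  have "s \<longlonglongrightarrow> 0"
    by (rule tendsto_sandwich[OF _ _ tendsto_const lim])
       (use s(1)[THEN less_imp_le] s(2) in \<open>auto intro!: eventually_at_top_linorderI[of 1]\<close>)
  moreover have "eventually (\<lambda>n. s n \<in> {0<..}) at_top" using s(1) by (intro eventually_at_top_linorderI[of 1]) auto
  ultimately show ?thesis unfolding s_def[symmetric] filterlim_at by (auto elim: eventually_mono)
qed

text \<open>The factor 1 + O(...) is expressed by bounding the difference from the main term by the
  main term times the error rate; since that rate tends to 0, asymptotic equivalence is included.
  The estimate in s is applied at s = ln(1/\<rho>) and multiplied by \<rho>^(-n).\<close>

theorem theorem1p4: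
  fixes k :: nat
  assumes "k \<ge> 1"
  shows "(\<lambda>n. (real (pP k (n + 1)) - real (pP k n))
              - inverse (rho k n) ^ n * ln (1 / rho k n) * Psi k (rho k n)
                  / sqrt (2 * pi * Phi2 k (rho k n)))
         \<in> O[at_top](\<lambda>n. inverse (rho k n) ^ n * ln (1 / rho k n) * Psi k (rho k n)
                  / sqrt (2 * pi * Phi2 k (rho k n))
                  * real n powr (- 1 / (2 * real k + 3)))"
proof -
  obtain K where K: "eventually (\<lambda>s. \<forall>n. phi_moment k 1 (exp (- s)) = real n \<longrightarrow> n \<ge> 1 \<longrightarrow>
           \<bar>(real (pP k (n + 1)) - real (pP k n)) * exp (- s) ^ n - main_term k s\<bar> \<le>
             K * (main_term k s * real n powr (- 1 / (2 * real k + 3)))) (at_right 0)"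
    using saddle_asymptotics[OF assms] by (elim exE)
  with ln_rho_tendsto_0[OF assms] have ev: "eventually (\<lambda>n. \<forall>n'. phi_moment k 1 (exp (- ln (1 / rho k n))) = real n' \<longrightarrow> n' \<ge> 1 \<longrightarrow>
           \<bar>(real (pP k (n' + 1)) - real (pP k n')) * exp (- ln (1 / rho k n)) ^ n' - main_term k (ln (1 / rho k n))\<bar> \<le>
             K * (main_term k (ln (1 / rho k n)) * real n' powr (- 1 / (2 * real k + 3)))) at_top"
    unfolding filterlim_iff by auto
  show ?thesis
  proof (rule bigoI[of _ K])
    show "eventually (\<lambda>n. norm ((real (pP k (n + 1)) - real (pP k n))
              - inverse (rho k n) ^ n * ln (1 / rho k n) * Psi k (rho k n) / sqrt (2 * pi * Phi2 k (rho k n)))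
         \<le> K * norm (inverse (rho k n) ^ n * ln (1 / rho k n) * Psi k (rho k n)
                  / sqrt (2 * pi * Phi2 k (rho k n)) * real n powr (- 1 / (2 * real k + 3)))) at_top"
      using ev eventually_ge_at_top[of 1]
    proof eventually_elim
      case (elim n)
      note rp = rho_props[OF assms elim(2)]
      define r where "r = rho k n"
      have r: "0 < r" "r < 1" using rp by (auto simp: r_def)
      define D where "D = real (pP k (n + 1)) - real (pP k n)"
      define m where "m = main_term k (ln (1 / r))"
      define q where "q = real n powr (- 1 / (2 * real k + 3))"
      have er: "exp (- ln (1 / r)) = r" using r by (simp add: ln_div)
      have main: "\<bar>D * r ^ n - m\<bar> \<le> K * (m * q)"
        using elim(1)[rule_format, of n] elim(2) rp(3) unfolding r_def[symmetric] er D_def m_def q_def by simp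
      have m_eq: "m = Psi k r * ln (1 / r) / sqrt (2 * pi * Phi2 k r)"
        unfolding m_def main_term_def er using r assms by (simp add: Psi_eq_exp_PhiC Phi2_eq)
      have m0: "m \<ge> 0" unfolding m_eq using r assms phi_moment_pos[of r k 2]
        by (simp add: Psi_eq_exp_PhiC Phi2_eq less_imp_le)
      have ri: "inverse r ^ n * r ^ n = 1" using r by (simp add: power_mult_distrib[symmetric])
      have "norm (D - inverse r ^ n * m) = norm (inverse r ^ n * (D * r ^ n - m))"
        using ri by (simp add: algebra_simps)
      also have "\<dots> = inverse r ^ n * \<bar>D * r ^ n - m\<bar>" using r by (simp add: abs_mult)
      also have "\<dots> \<le> inverse r ^ n * (K * (m * q))" using r main by (intro mult_left_mono) auto
      also have "\<dots> = K * norm (inverse r ^ n * m * q)"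
        using r m0 by (simp add: abs_mult q_def mult_ac)
      finally have "norm (D - inverse r ^ n * m) \<le> K * norm (inverse r ^ n * m * q)" .
      then show ?case unfolding D_def q_def r_def[symmetric] m_eq by (simp add: mult_ac)
    qed
  qed
qed

end
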